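(* Let $\Delta$ be a $d$-dimensional simplicial complex which is acyclic in positive codimension (APC). Then: (1) $\displaystyle \hat\pi_d(\Delta)=\frac{\hat\tau_d(\Delta)\,\tau_{d-1}(\Delta)}{|\tilde H_{d-2}(\Delta;\mathbb Z)|^2}$. (2) Let $U$ be the set of $(d-1)$-dimensional faces of a $(d-1)$-dimensional simplicial spanning tree of $\Delta$, let $\Delta_U=U\cup\Delta_{(d-2)}$, and let $\hat L_U$ be obtained from $\hat L=\hat\partial\hat\partial^T$ by deleting the rows and columns indexed by $U$. Then $$\hat\tau_d(\Delta)=\frac{|\tilde H_{d-2}(\Delta;\mathbb Z)|^2}{|\tilde H_{d-2}(\Delta_U;\mathbb Z)|^2}\det\hat L_U.$$
   Context: Simplicial complexes are finite on a totally ordered vertex set; $\Delta_i$ = set of $i$-dimensional faces, $f_i=|\Delta_i|$, $\Delta_{(i)}$ = $i$-skeleton, $\tilde H_i$ = reduced homology over $\mathbb Z$, $\beta_i$ = rank of $\tilde H_i(\cdot;\mathbb Z)$. $\partial=\partial_d$ is the simplicial boundary matrix from $d$-faces to $(d-1)$-faces with the usual signs $(-1)^{j+1}$ for deleting the $j$-th smallest vertex. APC means $\beta_j(\Delta)=0$ for all $j<\dim\Delta$. A $k$-SST of $\Delta$ ($k\le d$) is a $k$-dimensional subcomplex $\Upsilon$ with $\Upsilon_{(k-1)}=\Delta_{(k-1)}$, $\tilde H_k(\Upsilon)=0$, $|\tilde H_{k-1}(\Upsilon)|<\infty$, $f_k(\Upsilon)=f_k(\Delta)-\beta_k(\Delta)+\beta_{k-1}(\Delta)$;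 $\mathcal T_k(\Delta)$ is the set of these, and $\tau_k(\Delta)=\sum_{\Upsilon\in\mathcal T_k(\Delta)}|\tilde H_{k-1}(\Upsilon)|^2$. Weighting: introduce an indeterminate $x_F$ for each $F\in\Delta_d$, set $X_F=x_F^2$, and for a set $T$ of $d$-faces $x_T=\prod_{F\in T}x_F$, $X_T=x_T^2$; for a subcomplex $\Upsilon$, $X_\Upsilon=X_{\Upsilon_d}$. The weighted boundary matrix $\hat\partial$ is obtained from $\partial_d$ by multiplying the column of each $F\in\Delta_d$ by $x_F$. $\hat\pi_d(\Delta)$ is the product of the nonzero eigenvalues (with multiplicity, in an algebraic closure of the field of rational functions) of $\hat L=\hat\partial\hat\partial^T$, and $\hat\tau_d(\Delta)=\sum_{\Upsilon\in\mathcal T_d(\Delta)}|\tilde H_{d-1}(\Upsilon;\mathbb Z)|^2X_\Upsilon$.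
   Formalization: In the face-count condition for a k-SST, the Betti numbers are those of the k-skeleton of Δ, not of Δ (with Δ's own, τ_{d-1} would be 0, e.g. for a single edge); the void complex counts as having dimension -1, so that d = 0 is included. *)

theory Defs
  imports
    "HOL-Algebra.Free_Abelian_Groups"
    "HOL-Algebra.Algebraic_Closure_Type"
    "HOL-Computational_Algebra.Fraction_Field"
    "HOL-Library.List_Lexorder"
    "HOL-Library.Poly_Mapping"
    "Jordan_Normal_Form.Char_Poly"
    "Jordan_Normal_Form.DL_Submatrix"
begin

section \<open>Simplicial complexes\<close>

text \<open>
  The empty face is a face of dimension \<open>-1\<close>, so dimensions are integers. The void complex \<open>{}\<close>
  is admitted and given dimension \<open>-1\<close>, like \<open>{{}}\<close>. This only matters for the spanning trees of
  dimension \<open>-1\<close> of a \<open>0\<close>-dimensional complex: the void complex is then the unique one.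
\<close>

definition simplicial_complex :: "'v set set \<Rightarrow> bool" where
  "simplicial_complex \<Delta> \<longleftrightarrow>
     finite \<Delta> \<and> (\<forall>F\<in>\<Delta>. finite F) \<and> (\<forall>F\<in>\<Delta>. \<forall>G. G \<subseteq> F \<longrightarrow> G \<in> \<Delta>)"

definition face_dim :: "'v set \<Rightarrow> int" where
  "face_dim F = int (card F) - 1"

definition complex_dim :: "'v set set \<Rightarrow> int" where
  "complex_dim \<Delta> = Max (insert (-1) (face_dim ` \<Delta>))"

definition faces :: "int \<Rightarrow> 'v set set \<Rightarrow> 'v set set" where
  "faces i \<Delta> = {F \<in> \<Delta>. face_dim F = i}"

definition skeleton :: "int \<Rightarrow> 'v set set \<Rightarrow> 'v set set" where
  "skeleton i \<Delta> = {F \<in> \<Delta>. face_dim F \<le> i}"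


section \<open>Reduced simplicial homology over the integers\<close>

definition face_boundary :: "'v::linorder set \<Rightarrow> ('v set \<Rightarrow>\<^sub>0 int)" where
  "face_boundary F =
     (\<Sum>v\<in>F. frag_cmul ((-1) ^ (card {u \<in> F. u \<le> v} + 1)) (frag_of (F - {v})))"

definition boundary :: "('v::linorder set \<Rightarrow>\<^sub>0 int) \<Rightarrow> ('v set \<Rightarrow>\<^sub>0 int)" where
  "boundary = frag_extend face_boundary"

definition chain_group :: "int \<Rightarrow> 'v set set \<Rightarrow> ('v set \<Rightarrow>\<^sub>0 int) monoid" where
  "chain_group i \<Delta> = free_Abelian_group (faces i \<Delta>)"

definition cycle_group :: "int \<Rightarrow> 'v::linorder set set \<Rightarrow> ('v set \<Rightarrow>\<^sub>0 int) monoid" where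
  "cycle_group i \<Delta> =
     subgroup_generated (chain_group i \<Delta>)
       (kernel (chain_group i \<Delta>) (chain_group (i - 1) \<Delta>) boundary)"

definition reduced_homology :: "int \<Rightarrow> 'v::linorder set set \<Rightarrow> ('v set \<Rightarrow>\<^sub>0 int) set monoid" where
  "reduced_homology i \<Delta> = cycle_group i \<Delta> Mod (boundary ` carrier (chain_group (i + 1) \<Delta>))"

text \<open>The rank of a (finitely generated) abelian group, written multiplicatively as in
  HOL-Algebra: the largest number of \<open>\<int>\<close>-linearly independent elements.\<close>

definition int_independent :: "('g, 'm) monoid_scheme \<Rightarrow> 'g set \<Rightarrow> bool" where
  "int_independent G B \<longleftrightarrow>
     finite B \<and> B \<subseteq> carrier G \<and>
     (\<forall>a :: 'g \<Rightarrow> int. finprod G (\<lambda>b. b [^]\<^bsub>G\<^esub> a b) B = \<one>\<^bsub>G\<^esub> \<longrightarrow> (\<forall>b\<in>B. a b = 0))"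

definition abelian_rank :: "('g, 'm) monoid_scheme \<Rightarrow> nat" where
  "abelian_rank G = Max {card B |B. int_independent G B}"

definition betti :: "int \<Rightarrow> 'v::linorder set set \<Rightarrow> nat" where
  "betti i \<Delta> = abelian_rank (reduced_homology i \<Delta>)"

definition APC :: "'v::linorder set set \<Rightarrow> bool" where
  "APC \<Delta> \<longleftrightarrow> (\<forall>j < complex_dim \<Delta>. betti j \<Delta> = 0)"


section \<open>Simplicial spanning trees\<close>

text \<open>
  A \<open>k\<close>-dimensional spanning tree of \<open>\<Delta>\<close> is a spanning tree of the \<open>k\<close>-skeleton, and so the Betti
  numbers in the face count are those of the \<open>k\<close>-skeleton. For \<open>k < complex_dim \<Delta>\<close> the number
  \<open>betti k \<Delta>\<close> itself would be wrong: it is \<open>0\<close> for a connected graph and \<open>k = 0\<close>, and then no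
  vertex would be a spanning tree.
\<close>

definition spanning_trees :: "int \<Rightarrow> 'v::linorder set set \<Rightarrow> 'v set set set" where
  "spanning_trees k \<Delta> =
     {\<Upsilon>. simplicial_complex \<Upsilon> \<and> \<Upsilon> \<subseteq> \<Delta> \<and> complex_dim \<Upsilon> = k \<and>
        skeleton (k - 1) \<Upsilon> = skeleton (k - 1) \<Delta> \<and>
        trivial_group (reduced_homology k \<Upsilon>) \<and>
        finite (carrier (reduced_homology (k - 1) \<Upsilon>)) \<and>
        int (card (faces k \<Upsilon>)) =
          int (card (faces k \<Delta>)) - int (betti k (skeleton k \<Delta>))
            + int (betti (k - 1) (skeleton k \<Delta>))}"

definition homology_order :: "int \<Rightarrow> 'v::linorder set set \<Rightarrow> nat" where
  "homology_order i \<Delta> = Coset.order (reduced_homology i \<Delta>)"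

definition tree_count :: "int \<Rightarrow> 'v::linorder set set \<Rightarrow> nat" where
  "tree_count k \<Delta> = (\<Sum>\<Upsilon>\<in>spanning_trees k \<Delta>. (homology_order (k - 1) \<Upsilon>)\<^sup>2)"


section \<open>Weighted boundary matrices\<close>

text \<open>
  Rational functions over \<open>\<rat>\<close>. A monomial is a finitely supported exponent function, a polynomial a
  finitely supported function from monomials to coefficients. The indeterminate of a face is indexed
  by the increasing list of its vertices, because the library instance making polynomials an
  integral domain requires linearly ordered indices.
\<close>

type_synonym 'v weight_field = "(('v list \<Rightarrow>\<^sub>0 nat) \<Rightarrow>\<^sub>0 rat) fract"

definition face_var :: "'v::linorder set \<Rightarrow> 'v weight_field" where
  "face_var F =
     Fract (Poly_Mapping.single (Poly_Mapping.single (sorted_list_of_set F) 1) 1) 1"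

definition complex_weight :: "int \<Rightarrow> 'v::linorder set set \<Rightarrow> 'v weight_field" where
  "complex_weight d \<Upsilon> = (\<Prod>F\<in>faces d \<Upsilon>. face_var F)\<^sup>2"

definition weighted_tree_count :: "int \<Rightarrow> 'v::linorder set set \<Rightarrow> 'v weight_field" where
  "weighted_tree_count d \<Delta> =
     (\<Sum>\<Upsilon>\<in>spanning_trees d \<Delta>. of_nat ((homology_order (d - 1) \<Upsilon>)\<^sup>2) * complex_weight d \<Upsilon>)"

text \<open>The \<open>i\<close>-dimensional faces, in the lexicographic order of their increasing vertex lists, index
  the rows and columns of the matrices below.\<close>

definition face_list :: "int \<Rightarrow> 'v::linorder set set \<Rightarrow> 'v set list" where
  "face_list i \<Delta> = map set (sorted_list_of_set (sorted_list_of_set ` faces i \<Delta>))"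

definition boundary_matrix :: "int \<Rightarrow> 'v::linorder set set \<Rightarrow> int mat" where
  "boundary_matrix d \<Delta> =
     mat (length (face_list (d - 1) \<Delta>)) (length (face_list d \<Delta>))
       (\<lambda>(r, c). Poly_Mapping.lookup (boundary (frag_of (face_list d \<Delta> ! c)))
                   (face_list (d - 1) \<Delta> ! r))"

definition weighted_boundary_matrix :: "int \<Rightarrow> 'v::linorder set set \<Rightarrow> 'v weight_field mat" where
  "weighted_boundary_matrix d \<Delta> =
     mat (dim_row (boundary_matrix d \<Delta>)) (dim_col (boundary_matrix d \<Delta>))
       (\<lambda>(r, c). of_int (boundary_matrix d \<Delta> $$ (r, c)) * face_var (face_list d \<Delta> ! c))"

definition weighted_laplacian :: "int \<Rightarrow> 'v::linorder set set \<Rightarrow> 'v weight_field mat" where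
  "weighted_laplacian d \<Delta> =
     weighted_boundary_matrix d \<Delta> * transpose_mat (weighted_boundary_matrix d \<Delta>)"

definition reduced_weighted_laplacian ::
    "int \<Rightarrow> 'v::linorder set set \<Rightarrow> 'v set set \<Rightarrow> 'v weight_field mat" where
  "reduced_weighted_laplacian d \<Delta> U =
     (let I = {i. i < length (face_list (d - 1) \<Delta>) \<and> face_list (d - 1) \<Delta> ! i \<notin> U}
      in submatrix (weighted_laplacian d \<Delta>) I I)"

definition nonzero_eigenvalue_product :: "'k::field mat \<Rightarrow> 'k alg_closure" where
  "nonzero_eigenvalue_product A =
     (let A' = map_mat to_ac A
      in \<Prod>z | eigenvalue A' z \<and> z \<noteq> 0. z ^ Polynomial.order z (char_poly A'))"

definition weighted_pi :: "int \<Rightarrow> 'v::linorder set set \<Rightarrow> 'v weight_field alg_closure" where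
  "weighted_pi d \<Delta> = nonzero_eigenvalue_product (weighted_laplacian d \<Delta>)"

end

theory Submission
  imports Defs "HOL-Computational_Algebra.Polynomial_Factorial"
begin

text \<open>
  By the Cauchy--Binet formula, a principal minor of the weighted Laplacian is a sum of terms
  \<open>(det D)\<^sup>2 * X\<close>, where \<open>D\<close> is a square submatrix of the boundary matrix with columns a set \<open>J\<close> of
  \<open>d\<close>-faces and rows the complement of a set \<open>U\<close> of \<open>(d-1)\<close>-faces. Reading determinants as indices of
  lattices, \<open>\<bar>det D\<bar>\<close> times the order of \<open>H\<^bsub>d-2\<^esub>\<close> of the complex is the product of the orders of \<open>H\<^bsub>d-1\<^esub>\<close> of
  the subcomplex spanned by \<open>J\<close> and \<open>H\<^bsub>d-2\<^esub>\<close> of the one spanned by \<open>U\<close>. This gives the second claim, and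
  the first one follows because the product of the nonzero eigenvalues is, up to sign, the lowest
  nonzero coefficient of the characteristic polynomial, hence the sum of the principal minors of
  maximal rank.
\<close>

section \<open>Minors indexed by finite sets\<close>

text \<open>Infinite indices count as 0, which is the value that \<open>card\<close> gives. The
  identity relating minors to homology orders therefore holds for every \<open>J\<close> and
  \<open>U\<close> of the right sizes, and the terms of a Cauchy--Binet sum that do not come from
  trees vanish by themselves. The sizes fit because of APC: a multiple of every (d-1)-cycle is a
  boundary, so the ranks of the two consecutive boundary maps add up to the number of (d-1)-faces.
  Removing the (d-1)-faces of a tree thus leaves exactly as many rows as a largest nonzero minor
  has. Both claims come from one identity for each \<open>U\<close>: a single tree \<open>U\<close>
  gives the second, and summing over all \<open>U\<close> gives the first. Rows and columns are
  matched by arbitrary bijections; this fixes minors only up to sign, and only their squares occur.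
  The delicate point of the first claim is that the sum of the minors of maximal size must be
  nonzero, as otherwise it is not the lowest nonzero coefficient. It is nonzero because trees exist
  in both dimensions and the terms are squared monomials with nonnegative coefficients, which cannot
  cancel.\<close>

definition minor :: "'a set \<Rightarrow> ('a \<Rightarrow> 'a \<Rightarrow> 'r::comm_ring_1) \<Rightarrow> 'r" where
  "minor S M = (\<Sum>p | p permutes S. of_int (sign p) * (\<Prod>i\<in>S. M i (p i)))"

lemma minor_cong:
  assumes "\<And>i j. i \<in> S \<Longrightarrow> j \<in> S \<Longrightarrow> M i j = N i j"
  shows "minor S M = minor S N"
  unfolding minor_def using assms
  by (intro sum.cong refl arg_cong2[of _ _ _ _ "(*)"] prod.cong) (auto simp: permutes_in_image)

text \<open>Rows and columns share one index set, so renaming along \<open>g\<close> conjugates each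
  permutation and keeps its sign; no order on the indices is involved. This is the passage between
  faces and their positions in a list.\<close>

lemma minor_reindex:
  assumes g: "bij_betw g S' S" and fin: "finite S'"
  shows "minor S' (\<lambda>i j. M (g i) (g j)) = minor S M"
proof -
  have inj: "inj_on g S'" and S: "S = g ` S'"
    using g by (auto simp: bij_betw_def)
  have ginv: "bij_betw (inv_into S' g) S S'"
    by (rule bij_betw_inv_into[OF g])
  have inv1: "map_permutation S (inv_into S' g) (map_permutation S' g p) = p"
    if "p permutes S'" for p
    using g that by (rule map_permutation_compose_inv) (use inj in auto)
  have inv2: "map_permutation S' g (map_permutation S (inv_into S' g) p) = p"
    if "p permutes S" for p
    using ginv that by (rule map_permutation_compose_inv) (auto simp: S f_inv_into_f)
  have *: "(\<Sum>p | p permutes S. of_int (sign p) * (\<Prod>i\<in>S. M i (p i)))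
      = (\<Sum>p | p permutes S'. of_int (sign p) * (\<Prod>i\<in>S'. M (g i) (g (p i))))"
  proof (rule sum.reindex_bij_witness[of _ "map_permutation S' g" "map_permutation S (inv_into S' g)"])
    fix p assume p: "p \<in> {p. p permutes S}"
    let ?q = "map_permutation S (inv_into S' g) p"
    have q: "?q permutes S'" using p ginv by (auto intro: map_permutation_permutes)
    show "?q \<in> {p. p permutes S'}" using q by auto
    show "map_permutation S' g ?q = p" using p inv2 by auto
    have "sign ?q = sign p" using p fin S ginv
      by (intro sign_map_permutation) (auto simp: bij_betw_def)
    moreover have "g (?q i) = p (g i)" if "i \<in> S'" for i
    proof -
      have "map_permutation S' g ?q (g i) = g (?q i)"
        by (rule map_permutation_apply[OF inj that])
      then show ?thesis using inv2 p by simp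
    qed
    moreover have "(\<Prod>i\<in>S. M i (p i)) = (\<Prod>i\<in>S'. M (g i) (p (g i)))"
      unfolding S by (rule prod.reindex[OF inj, unfolded o_def])
    ultimately show "of_int (sign ?q) * (\<Prod>i\<in>S'. M (g i) (g (?q i))) = of_int (sign p) * (\<Prod>i\<in>S. M i (p i))"
      by simp
  next
    fix q assume "q \<in> {p. p permutes S'}"
    then show "map_permutation S' g q \<in> {p. p permutes S}" "map_permutation S (inv_into S' g) (map_permutation S' g q) = q"
      using g inv1 by (auto intro: map_permutation_permutes)
  qed
  then show ?thesis unfolding minor_def by simp
qed

lemma det_eq_minor:
  assumes "A \<in> carrier_mat n n"
  shows "det A = minor {0..<n} (\<lambda>i j. A $$ (i, j))"
  using assms by (simp add: det_def' minor_def)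

lemma minor_eq_det:
  assumes "distinct xs"
  shows "minor (set xs) M = det (mat (length xs) (length xs) (\<lambda>(i, j). M (xs ! i) (xs ! j)))"
proof -
  have "bij_betw ((!) xs) {0..<length xs} (set xs)"
    using bij_betw_nth[OF assms] by (simp add: atLeast0LessThan)
  then have "minor (set xs) M = minor {0..<length xs} (\<lambda>i j. M (xs ! i) (xs ! j))"
    by (rule minor_reindex[symmetric]) auto
  also have "\<dots> = det (mat (length xs) (length xs) (\<lambda>(i, j). M (xs ! i) (xs ! j)))"
    by (subst det_eq_minor) (auto intro!: minor_cong)
  finally show ?thesis .
qed

lemma minor_transpose:
  assumes "finite S"
  shows "minor S (\<lambda>i j. M j i) = minor S M"
proof -
  obtain xs where xs: "distinct xs" "set xs = S"
    using finite_distinct_list[OF assms] by blast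
  have "det (mat (length xs) (length xs) (\<lambda>(i, j). M (xs ! j) (xs ! i)))
    = det (transpose_mat (mat (length xs) (length xs) (\<lambda>(i, j). M (xs ! i) (xs ! j))))"
    by (intro arg_cong[of _ _ det] eq_matI) auto
  also have "\<dots> = det (mat (length xs) (length xs) (\<lambda>(i, j). M (xs ! i) (xs ! j)))"
    by (rule det_transpose) auto
  finally show ?thesis
    using minor_eq_det[OF xs(1), of "\<lambda>i j. M j i"] minor_eq_det[OF xs(1), of M] xs(2) by simp
qed

lemma minor_identical_rows:
  assumes "finite S" "a \<in> S" "b \<in> S" "a \<noteq> b" "\<And>j. j \<in> S \<Longrightarrow> M a j = M b j"
  shows "minor S M = 0"
proof -
  obtain xs where xs: "distinct xs" "set xs = S"
    using finite_distinct_list[OF assms(1)] by blast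
  obtain i j where ij: "i < length xs" "j < length xs" "xs ! i = a" "xs ! j = b"
    using assms(2,3) xs(2) by (metis in_set_conv_nth)
  let ?A = "mat (length xs) (length xs) (\<lambda>(i, j). M (xs ! i) (xs ! j))"
  have "det ?A = 0"
    by (rule det_identical_rows[of ?A "length xs" i j])
      (use ij assms(4,5) xs in \<open>auto intro!: eq_vecI\<close>)
  then show ?thesis using minor_eq_det[OF xs(1), of M] xs(2) by simp
qed

lemma minor_permute_rows:
  assumes "finite S" "q permutes S"
  shows "minor S (\<lambda>i j. M (q i) j) = of_int (sign q) * minor S M"
proof -
  have "minor S (\<lambda>i j. M (q i) j)
      = (\<Sum>p | p permutes S. of_int (sign (p \<circ> q)) * (\<Prod>i\<in>S. M (q i) ((p \<circ> q) i)))"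
    unfolding minor_def by (rule sum_permutations_compose_right[OF assms(2)])
  also have "\<dots> = (\<Sum>p | p permutes S. of_int (sign q) * (of_int (sign p) * (\<Prod>i\<in>S. M i (p i))))"
  proof (rule sum.cong[OF refl])
    fix p assume p: "p \<in> {p. p permutes S}"
    have "sign (p \<circ> q) = sign p * sign q"
      using p assms by (intro sign_compose) (auto simp: permutation_permutes)
    moreover have "(\<Prod>i\<in>S. M (q i) ((p \<circ> q) i)) = (\<Prod>i\<in>S. M i (p i))"
      using prod.permute[OF assms(2), of "\<lambda>i. M i (p i)"] by (simp add: o_def)
    ultimately show "of_int (sign (p \<circ> q)) * (\<Prod>i\<in>S. M (q i) ((p \<circ> q) i))
        = of_int (sign q) * (of_int (sign p) * (\<Prod>i\<in>S. M i (p i)))"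
      by (simp add: mult_ac)
  qed
  finally show ?thesis by (simp add: minor_def sum_distrib_left)
qed

lemma minor_of_int: "minor S (\<lambda>i j. of_int (M i j)) = of_int (minor S M)"
  by (simp add: minor_def)

lemma minor_scale_rows:
  "minor S (\<lambda>i j. c i * M i j) = (\<Prod>i\<in>S. c i) * minor S M"
  by (simp add: minor_def prod.distrib sum_distrib_left mult_ac)

text \<open>A permutation that moves \<open>a\<close> sends some element of \<open>S\<close> to
  \<open>a\<close> and so picks up a zero of column \<open>a\<close>. The remaining permutations are
  those of \<open>S\<close>.\<close>

lemma minor_insert_zero_column:
  assumes fin: "finite S" and a: "a \<notin> S" and zero: "\<And>i. i \<in> S \<Longrightarrow> M i a = 0"
  shows "minor (insert a S) M = M a a * minor S M"
proof -
  let ?f = "\<lambda>p. of_int (sign p) * (\<Prod>i\<in>insert a S. M i (p i))"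
  have "minor (insert a S) M = (\<Sum>p | p permutes S. ?f p)"
    unfolding minor_def
  proof (rule sum.mono_neutral_right)
    show "finite {p. p permutes insert a S}" using fin by (intro finite_permutations) auto
    show "{p. p permutes S} \<subseteq> {p. p permutes insert a S}" by (auto intro: permutes_subset)
    show "\<forall>p\<in>{p. p permutes insert a S} - {p. p permutes S}. ?f p = 0"
    proof
      fix p assume p: "p \<in> {p. p permutes insert a S} - {p. p permutes S}"
      obtain i where i: "p i = a" using p by (metis DiffD1 mem_Collect_eq permutes_surj surj_def)
      have "p a \<noteq> a" using p by (auto intro: permutes_superset)
      then have "i \<noteq> a" using i by auto
      moreover have "i \<in> insert a S" using i p a by (metis DiffD1 insertI1 mem_Collect_eq permutes_in_image)
      ultimately have "i \<in> S" by auto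
      then have "(\<Prod>i\<in>insert a S. M i (p i)) = 0"
        using zero[of i] i fin by (intro prod_zero) auto
      then show "?f p = 0" by simp
    qed
  qed
  also have "\<dots> = (\<Sum>p | p permutes S. M a a * (of_int (sign p) * (\<Prod>i\<in>S. M i (p i))))"
    using fin a by (intro sum.cong) (auto simp: permutes_not_in mult_ac)
  finally show ?thesis by (simp add: minor_def sum_distrib_left)
qed

text \<open>In the expansion of each product, \<open>T\<close> is the set of rows where the entry of
  \<open>M\<close> is chosen. In the other rows \<open>x\<close> survives only if the permutation
  fixes the index, which leaves the permutations of \<open>T\<close>. With \<open>x\<close> a
  polynomial variable this yields the characteristic polynomial.\<close>

lemma minor_diagonal_plus:
  assumes fin: "finite S"
  shows "minor S (\<lambda>i j. (if i = j then x else 0) + M i j)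
    = (\<Sum>T\<in>Pow S. x ^ card (S - T) * minor T M)"
proof -
  have "minor S (\<lambda>i j. (if i = j then x else 0) + M i j)
     = (\<Sum>p | p permutes S. \<Sum>T\<in>Pow S. of_int (sign p) *
         ((\<Prod>i\<in>S - T. if i = p i then x else 0) * (\<Prod>i\<in>T. M i (p i))))"
    unfolding minor_def
  proof (rule sum.cong[OF refl])
    fix p
    have "(\<Prod>i\<in>S. (if i = p i then x else 0) + M i (p i))
      = (\<Prod>i\<in>S. M i (p i) + (if i = p i then x else 0))" by (simp add: add.commute)
    also have "\<dots> = (\<Sum>T\<in>Pow S. (\<Prod>i\<in>T. M i (p i)) * (\<Prod>i\<in>S - T. if i = p i then x else 0))"
      by (rule prod_add[OF fin])
    finally show "of_int (sign p) * (\<Prod>i\<in>S. (if i = p i then x else 0) + M i (p i))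
      = (\<Sum>T\<in>Pow S. of_int (sign p) *
         ((\<Prod>i\<in>S - T. if i = p i then x else 0) * (\<Prod>i\<in>T. M i (p i))))"
      by (simp add: sum_distrib_left mult_ac)
  qed
  also have "\<dots> = (\<Sum>T\<in>Pow S. \<Sum>p | p permutes S. of_int (sign p) *
         ((\<Prod>i\<in>S - T. if i = p i then x else 0) * (\<Prod>i\<in>T. M i (p i))))"
    by (rule sum.swap)
  also have "\<dots> = (\<Sum>T\<in>Pow S. x ^ card (S - T) * minor T M)"
  proof (rule sum.cong[OF refl])
    fix T assume T: "T \<in> Pow S"
    let ?f = "\<lambda>p. of_int (sign p) *
         ((\<Prod>i\<in>S - T. if i = p i then x else 0) * (\<Prod>i\<in>T. M i (p i)))"
    have "(\<Sum>p | p permutes S. ?f p) = (\<Sum>p | p permutes T. ?f p)"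
    proof (rule sum.mono_neutral_right)
      show "finite {p. p permutes S}" using fin by (intro finite_permutations) auto
      show "{p. p permutes T} \<subseteq> {p. p permutes S}" using T by (auto intro: permutes_subset)
      show "\<forall>p\<in>{p. p permutes S} - {p. p permutes T}. ?f p = 0"
      proof
        fix p assume p: "p \<in> {p. p permutes S} - {p. p permutes T}"
        obtain i where "i \<in> S - T" "p i \<noteq> i"
          using p permutes_superset[of p S T] by auto
        then have "(\<Prod>i\<in>S - T. if i = p i then x else 0) = 0"
          using fin by (intro prod_zero bexI[of _ i]) auto
        then show "?f p = 0" by simp
      qed
    qed
    also have "\<dots> = (\<Sum>p | p permutes T. x ^ card (S - T) * (of_int (sign p) * (\<Prod>i\<in>T. M i (p i))))"
    proof (rule sum.cong[OF refl])
      fix p assume p: "p \<in> {p. p permutes T}"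
      have "(\<Prod>i\<in>S - T. if i = p i then x else 0) = (\<Prod>i\<in>S - T. x)"
        using p by (intro prod.cong refl) (auto simp: permutes_not_in)
      then show "?f p = x ^ card (S - T) * (of_int (sign p) * (\<Prod>i\<in>T. M i (p i)))"
        by (simp add: mult_ac)
    qed
    finally show "(\<Sum>p | p permutes S. ?f p) = x ^ card (S - T) * minor T M"
      by (simp add: minor_def sum_distrib_left)
  qed
  finally show ?thesis .
qed

text \<open>The case \<open>x = 1\<close>, \<open>M = 0\<close> of
  \<open>minor_diagonal_plus\<close>, where only the empty minor is nonzero.\<close>

lemma minor_identity:
  assumes fin: "finite S"
  shows "minor S (\<lambda>i j. if i = j then 1 else 0) = (1 :: 'r::comm_ring_1)"
proof -
  have "minor S (\<lambda>i j. (if i = j then 1 else 0 :: 'r) + 0) = 1"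
    unfolding minor_diagonal_plus[OF fin]
  proof -
    have "minor T (\<lambda>i j. 0 :: 'r) = (if T = {} then 1 else 0)" if "T \<in> Pow S" for T
    proof -
      have "finite T" using that fin finite_subset by auto
      then show ?thesis by (cases "T = {}") (simp_all add: minor_def power_0_left)
    qed
    then have "(\<Sum>T\<in>Pow S. 1 ^ card (S - T) * minor T (\<lambda>i j. 0 :: 'r)) = (\<Sum>T\<in>Pow S. if T = {} then 1 else 0)"
      by (intro sum.cong) auto
    then show "(\<Sum>T\<in>Pow S. 1 ^ card (S - T) * minor T (\<lambda>i j. 0 :: 'r)) = 1"
      using fin by (simp add: sum.delta)
  qed
  then show ?thesis by simp
qed

text \<open>Expanding multilinearly gives a sum over all maps \<open>S \<rightarrow> K\<close>; the non-injective ones contribute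
  nothing, and the injective ones with image \<open>J\<close> are the \<open>g J \<circ> q\<close> with \<open>q\<close> a permutation of \<open>S\<close>.\<close>

theorem Cauchy_Binet:
  fixes A B :: "'a \<Rightarrow> 'b \<Rightarrow> 'r::comm_ring_1"
  assumes finS: "finite S" and finK: "finite K"
    and g: "\<And>J. J \<subseteq> K \<Longrightarrow> card J = card S \<Longrightarrow> bij_betw (g J) S J"
  shows "minor S (\<lambda>i j. \<Sum>k\<in>K. A i k * B j k)
    = (\<Sum>J | J \<subseteq> K \<and> card J = card S. minor S (\<lambda>i j. A i (g J j)) * minor S (\<lambda>i j. B i (g J j)))"
proof -
  let ?F = "S \<rightarrow>\<^sub>E K"
  let ?w = "\<lambda>f. (\<Prod>i\<in>S. A i (f i)) * minor S (\<lambda>i j. B j (f i))"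
  let ?J = "{J. J \<subseteq> K \<and> card J = card S}"
  have "minor S (\<lambda>i j. \<Sum>k\<in>K. A i k * B j k)
     = (\<Sum>p | p permutes S. \<Sum>f\<in>?F. of_int (sign p) * (\<Prod>i\<in>S. A i (f i) * B (p i) (f i)))"
    unfolding minor_def using finS finK
    by (intro sum.cong refl) (simp add: prod_sum_PiE sum_distrib_left)
  also have "\<dots> = (\<Sum>f\<in>?F. \<Sum>p | p permutes S. of_int (sign p) * (\<Prod>i\<in>S. A i (f i) * B (p i) (f i)))"
    by (rule sum.swap)
  also have "\<dots> = (\<Sum>f\<in>?F. ?w f)"
    by (intro sum.cong refl) (simp add: minor_def sum_distrib_left prod.distrib mult_ac)
  also have "\<dots> = (\<Sum>f\<in>{f\<in>?F. inj_on f S}. ?w f)"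
  proof (rule sum.mono_neutral_right)
    show "finite ?F" using finS finK by (intro finite_PiE) auto
    show "\<forall>f\<in>?F - {f \<in> ?F. inj_on f S}. ?w f = 0"
    proof
      fix f assume "f \<in> ?F - {f \<in> ?F. inj_on f S}"
      then obtain a b where "a \<in> S" "b \<in> S" "a \<noteq> b" "f a = f b" by (auto simp: inj_on_def)
      then have "minor S (\<lambda>i j. B j (f i)) = 0"
        using finS by (intro minor_identical_rows[of S a b]) auto
      then show "?w f = 0" by simp
    qed
  qed auto
  also have "\<dots> = (\<Sum>J\<in>?J. \<Sum>f\<in>{f\<in>?F. inj_on f S \<and> f ` S = J}. ?w f)"
  proof -
    have *: "{f\<in>{f\<in>?F. inj_on f S}. f ` S = J} = {f\<in>?F. inj_on f S \<and> f ` S = J}" for J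
      by auto
    have "(\<Sum>J\<in>?J. \<Sum>f\<in>{f\<in>{f\<in>?F. inj_on f S}. f ` S = J}. ?w f) = (\<Sum>f\<in>{f\<in>?F. inj_on f S}. ?w f)"
    proof (rule sum.group)
      show "finite {f \<in> ?F. inj_on f S}"
        using finS finK by (intro finite_subset[OF _ finite_PiE[of S "\<lambda>_. K"]]) auto
      show "finite ?J" using finK by auto
      show "(\<lambda>f. f ` S) ` {f \<in> ?F. inj_on f S} \<subseteq> ?J"
        by (auto simp: card_image)
    qed
    then show ?thesis unfolding * by simp
  qed
  also have "\<dots> = (\<Sum>J\<in>?J. minor S (\<lambda>i j. A i (g J j)) * minor S (\<lambda>i j. B i (g J j)))"
  proof (rule sum.cong[OF refl])
    fix J assume J: "J \<in> ?J"
    then have gJ: "bij_betw (g J) S J" by (intro g) auto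
    have inv_g: "inv_into S (g J) x \<in> S" "g J (inv_into S (g J) x) = x" if "x \<in> J" for x
      using gJ that by (auto simp: bij_betw_def inv_into_into f_inv_into_f)
    have g_inv: "inv_into S (g J) (g J i) = i" if "i \<in> S" for i
      using gJ that by (auto simp: bij_betw_def)
    have gmem: "g J i \<in> J" if "i \<in> S" for i
      using gJ that by (auto simp: bij_betw_def)
    have "(\<Sum>f\<in>{f\<in>?F. inj_on f S \<and> f ` S = J}. ?w f)
      = (\<Sum>q | q permutes S. (\<Prod>i\<in>S. A i (g J (q i))) * minor S (\<lambda>i j. B j (g J (q i))))"
    proof (rule sum.reindex_bij_witness[of _
          "\<lambda>q. restrict (\<lambda>i. g J (q i)) S" "\<lambda>f i. if i \<in> S then inv_into S (g J) (f i) else i"])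
      fix f assume f: "f \<in> {f\<in>?F. inj_on f S \<and> f ` S = J}"
      let ?q = "\<lambda>i. if i \<in> S then inv_into S (g J) (f i) else i"
      have "bij_betw f S J" using f by (auto simp: bij_betw_def)
      moreover have "bij_betw (inv_into S (g J)) J S" by (rule bij_betw_inv_into[OF gJ])
      ultimately have "bij_betw (inv_into S (g J) \<circ> f) S S" by (rule bij_betw_trans)
      then have "bij_betw ?q S S" by (rule bij_betw_cong[THEN iffD1, rotated]) auto
      then show "?q \<in> {q. q permutes S}" by (auto intro!: bij_imp_permutes)
      have gq: "g J (?q i) = f i" if "i \<in> S" for i using that f inv_g by auto
      show "restrict (\<lambda>i. g J (?q i)) S = f"
        using f gq by (intro ext) (auto simp: restrict_def PiE_def extensional_def)
      show "(\<Prod>i\<in>S. A i (g J (?q i))) * minor S (\<lambda>i j. B j (g J (?q i))) = ?w f"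
        using gq by (intro arg_cong2[of _ _ _ _ "(*)"] prod.cong minor_cong refl) auto
    next
      fix q assume q: "q \<in> {q. q permutes S}"
      then have q': "q permutes S" by simp
      have qS: "q i \<in> S \<longleftrightarrow> i \<in> S" for i using permutes_in_image[OF q'] .
      show "(\<lambda>i. if i \<in> S then inv_into S (g J) (restrict (\<lambda>i. g J (q i)) S i) else i) = q"
        using q' qS by (intro ext) (auto simp: g_inv permutes_not_in)
      have "bij_betw (g J \<circ> q) S J"
        by (rule bij_betw_trans[OF permutes_imp_bij[OF q'] gJ])
      then have "bij_betw (restrict (\<lambda>i. g J (q i)) S) S J"
        by (rule bij_betw_cong[THEN iffD1, rotated]) auto
      then show "restrict (\<lambda>i. g J (q i)) S \<in> {f\<in>?F. inj_on f S \<and> f ` S = J}"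
        using J qS gmem by (auto simp: bij_betw_def)
    qed
    \<comment> \<open>Undoing \<open>q\<close> in the second factor releases the sign that turns the
      sum over \<open>q\<close> into the first minor. Replacing \<open>g J\<close> by another
      bijection changes both minors by the same sign, so their product does not depend on the
      choice.\<close>
    also have "\<dots> = (\<Sum>q | q permutes S. (\<Prod>i\<in>S. A i (g J (q i))) *
        (of_int (sign q) * minor S (\<lambda>i j. B j (g J i))))"
      using minor_permute_rows[OF finS, of _ "\<lambda>i j. B j (g J i)"] by (intro sum.cong refl) simp
    also have "\<dots> = minor S (\<lambda>i j. A i (g J j)) * minor S (\<lambda>i j. B j (g J i))"
      unfolding minor_def[of S "\<lambda>i j. A i (g J j)"] by (simp add: sum_distrib_left mult_ac)
    also have "minor S (\<lambda>i j. B j (g J i)) = minor S (\<lambda>i j. B i (g J j))"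
      by (rule minor_transpose[OF finS, of "\<lambda>i j. B i (g J j)"])
    finally show "(\<Sum>f\<in>{f\<in>?F. inj_on f S \<and> f ` S = J}. ?w f)
      = minor S (\<lambda>i j. A i (g J j)) * minor S (\<lambda>i j. B i (g J j))" .
  qed
  finally show ?thesis .
qed

lemma minor_mult:
  assumes "finite S"
  shows "minor S (\<lambda>i j. \<Sum>k\<in>S. M i k * N k j) = minor S M * minor S N"
proof -
  have *: "{J. J \<subseteq> S \<and> card J = card S} = {S}"
    using assms card_subset_eq by blast
  have "minor S (\<lambda>i j. \<Sum>k\<in>S. M i k * N k j)
     = (\<Sum>J | J \<subseteq> S \<and> card J = card S. minor S M * minor S (\<lambda>i j. N j i))"
    by (rule Cauchy_Binet[OF assms assms, where g = "\<lambda>_ x. x" and B = "\<lambda>j k. N k j"])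
      (use * in \<open>auto simp: bij_betw_def\<close>)
  then show ?thesis unfolding * using minor_transpose[OF assms, of N] by simp
qed

text \<open>Chio's condensation, in the division-free form needed for elimination over \<open>\<int>\<close>.\<close>

lemma minor_condensation:
  fixes M :: "'a \<Rightarrow> 'a \<Rightarrow> 'r::comm_ring_1"
  assumes fin: "finite S" and a: "a \<notin> S"
  shows "M a a ^ card S * minor (insert a S) M
    = M a a * minor S (\<lambda>i j. M a a * M i j - M i a * M a j)"
proof -
  let ?T = "insert a S"
  \<comment> \<open>Left multiplication by \<open>E\<close> keeps row \<open>a\<close> and replaces
    row \<open>i\<close> by the pivot times row \<open>i\<close> minus \<open>M i a\<close> times
    row \<open>a\<close>, which clears column \<open>a\<close> outside the pivot.\<close>
  define E where "E i k = (if i = a then (if k = a then 1 else 0)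
     else (if k = i then M a a else if k = a then - M i a else 0))" for i k
  \<comment> \<open>Row \<open>a\<close> of \<open>E\<close> is a unit vector while column
    \<open>a\<close> is not, so the expansion along a zero column is applied to the
    transpose.\<close>
  have "minor ?T E = minor ?T (\<lambda>i j. E j i)"
    using fin minor_transpose[of ?T E] by simp
  also have "\<dots> = E a a * minor S (\<lambda>i j. E j i)"
    using a by (intro minor_insert_zero_column fin) (auto simp: E_def)
  also have "minor S (\<lambda>i j. E j i) = minor S (\<lambda>i j. M a a * (if i = j then 1 else 0))"
    using a by (intro minor_cong) (auto simp: E_def)
  also have "\<dots> = M a a ^ card S * minor S (\<lambda>i j. if i = j then 1 else 0)"
    using minor_scale_rows[of S "\<lambda>_. M a a" "\<lambda>i j. if i = j then 1 else 0"] by simp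
  also have "minor S (\<lambda>i j. if i = j then 1 else 0 :: 'r) = 1"
    by (rule minor_identity[OF fin])
  finally have "minor ?T E = E a a * (M a a ^ card S * 1)" .
  moreover have "E a a = 1" by (simp add: E_def)
  ultimately have E: "minor ?T E = M a a ^ card S" by simp
  define N where "N i j = (\<Sum>k\<in>?T. E i k * M k j)" for i j
  have Na: "N a j = M a j" for j
  proof -
    have "N a j = (\<Sum>k\<in>?T. if k = a then M k j else 0)"
      unfolding N_def E_def by (intro sum.cong) auto
    then show ?thesis using fin by (simp add: sum.delta)
  qed
  have Ni: "N i j = M a a * M i j - M i a * M a j" if "i \<in> S" for i j
  proof -
    have ia: "i \<noteq> a" using that a by auto
    have "N i j = (\<Sum>k\<in>?T. (if k = i then M a a * M i j else 0) + (if k = a then - M i a * M a j else 0))"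
      unfolding N_def E_def using ia by (intro sum.cong) auto
    then show ?thesis using fin that by (simp add: sum.distrib sum.delta)
  qed
  have "M a a ^ card S * minor ?T M = minor ?T N"
    using minor_mult[of ?T E M] fin E by (simp add: N_def[abs_def])
  also have "\<dots> = N a a * minor S N"
    using a by (intro minor_insert_zero_column fin) (auto simp: Ni)
  also have "minor S N = minor S (\<lambda>i j. M a a * M i j - M i a * M a j)"
    by (intro minor_cong) (auto simp: Ni)
  finally show ?thesis by (simp add: Na)
qed

section \<open>Indices of subgroups\<close>

definition subgroup_set :: "'g::ab_group_add set \<Rightarrow> bool" where
  "subgroup_set L \<longleftrightarrow> 0 \<in> L \<and> (\<forall>x\<in>L. \<forall>y\<in>L. x - y \<in> L)"

text \<open>The number of cosets of \<open>L\<close> that meet \<open>K\<close>. It is 0 when there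
  are infinitely many, in agreement with \<open>homology_order\<close> on infinite groups.\<close>

definition subgroup_index :: "'g::ab_group_add set \<Rightarrow> 'g set \<Rightarrow> nat" where
  "subgroup_index K L = card ((\<lambda>x. (+) x ` L) ` K)"

lemma subgroup_setD:
  assumes "subgroup_set L"
  shows "0 \<in> L" "x \<in> L \<Longrightarrow> y \<in> L \<Longrightarrow> x - y \<in> L" "x \<in> L \<Longrightarrow> - x \<in> L"
    "x \<in> L \<Longrightarrow> y \<in> L \<Longrightarrow> x + y \<in> L"
proof -
  show d: "x - y \<in> L" if "x \<in> L" "y \<in> L" for x y
    using assms that by (auto simp: subgroup_set_def)
  show m: "- x \<in> L" if "x \<in> L" for x
    using d[of 0 x] assms that by (auto simp: subgroup_set_def)
  show "x + y \<in> L" if "x \<in> L" "y \<in> L" for x y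
    using d[of x "- y"] m that by auto
qed (use assms in \<open>auto simp: subgroup_set_def\<close>)

lemma subgroup_set_sum:
  assumes "subgroup_set L" "\<And>i. i \<in> I \<Longrightarrow> f i \<in> L"
  shows "sum f I \<in> L"
  using assms(2) by (induction I rule: infinite_finite_induct) (auto intro: subgroup_setD[OF assms(1)])

lemma coset_eq_iff:
  assumes "subgroup_set L"
  shows "(+) x ` L = (+) y ` L \<longleftrightarrow> x - y \<in> L"
proof
  assume "(+) x ` L = (+) y ` L"
  moreover have "x \<in> (+) x ` L" using subgroup_setD(1)[OF assms] by force
  ultimately obtain l where "l \<in> L" "x = y + l" by auto
  then show "x - y \<in> L" by simp
next
  have sub: "(+) x ` L \<subseteq> (+) y ` L" if "x - y \<in> L" for x y
  proof
    fix z assume "z \<in> (+) x ` L"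
    then obtain l where l: "l \<in> L" "z = x + l" by auto
    have "x - y + l \<in> L" by (rule subgroup_setD(4)[OF assms that l(1)])
    moreover have "z = y + (x - y + l)" using l by simp
    ultimately show "z \<in> (+) y ` L" by blast
  qed
  assume "x - y \<in> L"
  moreover from this have "y - x \<in> L" using subgroup_setD(3)[OF assms, of "x - y"] by simp
  ultimately show "(+) x ` L = (+) y ` L" using sub by blast
qed

text \<open>Indices are computed through transversals \<open>R\<close>. Since a bijection preserves
  \<open>card\<close> even on infinite sets, the convention that infinite indices are 0 passes
  through the index laws below without case distinctions.\<close>

lemma subgroup_index_eq_card:
  assumes L: "subgroup_set L" and R: "R \<subseteq> K"
    and rep: "\<And>x. x \<in> K \<Longrightarrow> \<exists>y\<in>R. x - y \<in> L"
    and dist: "\<And>x y. x \<in> R \<Longrightarrow> y \<in> R \<Longrightarrow> x - y \<in> L \<Longrightarrow> x = y"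
  shows "subgroup_index K L = card R"
proof -
  have "(\<lambda>x. (+) x ` L) ` K = (\<lambda>x. (+) x ` L) ` R"
  proof
    show "(\<lambda>x. (+) x ` L) ` K \<subseteq> (\<lambda>x. (+) x ` L) ` R"
    proof (rule image_subsetI)
      fix x assume "x \<in> K"
      then obtain y where "y \<in> R" "x - y \<in> L" using rep by blast
      then show "(+) x ` L \<in> (\<lambda>x. (+) x ` L) ` R" using coset_eq_iff[OF L, of x y] by (intro image_eqI[of _ _ y]) auto
    qed
  qed (use R in blast)
  moreover have "inj_on (\<lambda>x. (+) x ` L) R"
    by (intro inj_onI dist) (simp_all add: coset_eq_iff[OF L])
  ultimately show ?thesis unfolding subgroup_index_def by (simp add: card_image)
qed

lemma coset_representatives:
  assumes L: "subgroup_set L"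
  obtains R where "R \<subseteq> K" "\<And>x. x \<in> K \<Longrightarrow> \<exists>y\<in>R. x - y \<in> L"
    "\<And>x y. x \<in> R \<Longrightarrow> y \<in> R \<Longrightarrow> x - y \<in> L \<Longrightarrow> x = y"
proof -
  let ?c = "\<lambda>x. (+) x ` L"
  let ?R = "inv_into K ?c ` (?c ` K)"
  show thesis
  proof
    show "?R \<subseteq> K" by (auto intro: inv_into_into)
    show "\<exists>y\<in>?R. x - y \<in> L" if "x \<in> K" for x
    proof
      show "inv_into K ?c (?c x) \<in> ?R" by (intro imageI that)
      have "?c (inv_into K ?c (?c x)) = ?c x" by (intro f_inv_into_f imageI that)
      then show "x - inv_into K ?c (?c x) \<in> L"
        by (subst coset_eq_iff[OF L, symmetric]) (rule sym)
    qed
    show "x = y" if xR: "x \<in> ?R" and yR: "y \<in> ?R" and xy: "x - y \<in> L" for x y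
    proof -
      obtain C D where CD: "C \<in> ?c ` K" "x = inv_into K ?c C" "D \<in> ?c ` K" "y = inv_into K ?c D"
        using xR yR by (elim imageE) auto
      have "?c x = C" "?c y = D" unfolding CD(2,4) by (rule f_inv_into_f, fact CD)+
      moreover have "?c x = ?c y" using coset_eq_iff[OF L, of x y] xy by simp
      ultimately show ?thesis using CD by simp
    qed
  qed
qed

text \<open>Sums of representatives for \<open>H\<close> modulo \<open>K\<close> and for
  \<open>K\<close> modulo \<open>L\<close> form a transversal for \<open>H\<close> modulo
  \<open>L\<close>. If one of the two sets is infinite, so is their product, and both sides are
  0.\<close>

theorem subgroup_index_tower:
  assumes L: "subgroup_set L" and K: "subgroup_set K" and H: "subgroup_set H"
    and LK: "L \<subseteq> K" and KH: "K \<subseteq> H"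
  shows "subgroup_index H L = subgroup_index H K * subgroup_index K L"
proof -
  obtain R where R: "R \<subseteq> H" "\<And>x. x \<in> H \<Longrightarrow> \<exists>y\<in>R. x - y \<in> K"
    "\<And>x y. x \<in> R \<Longrightarrow> y \<in> R \<Longrightarrow> x - y \<in> K \<Longrightarrow> x = y"
    by (rule coset_representatives[OF K, of H]) (rule that)
  obtain Q where Q: "Q \<subseteq> K" "\<And>x. x \<in> K \<Longrightarrow> \<exists>y\<in>Q. x - y \<in> L"
    "\<And>x y. x \<in> Q \<Longrightarrow> y \<in> Q \<Longrightarrow> x - y \<in> L \<Longrightarrow> x = y"
    by (rule coset_representatives[OF L, of K]) (rule that)
  note Kc = subgroup_setD[OF K]
  have uniq: "r = r' \<and> q = q'"
    if "r \<in> R" "r' \<in> R" "q \<in> Q" "q' \<in> Q" "(r + q) - (r' + q') \<in> L" for r r' q q'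
  proof -
    have "q - q' \<in> K" by (rule Kc(2)) (use that Q(1) in auto)
    then have "(r + q) - (r' + q') - (q - q') \<in> K"
      by (rule Kc(2)[rotated]) (use that LK in auto)
    moreover have "(r + q) - (r' + q') - (q - q') = r - r'" by simp
    ultimately have "r - r' \<in> K" by metis
    then have "r = r'" using R that by blast
    then show ?thesis using that Q(3) by simp
  qed
  let ?P = "(\<lambda>(r, q). r + q) ` (R \<times> Q)"
  have "subgroup_index H L = card ?P"
  proof (rule subgroup_index_eq_card[OF L])
    show "?P \<subseteq> H" using R(1) Q(1) KH by (auto intro!: subgroup_setD(4)[OF H])
    show "\<exists>y\<in>?P. x - y \<in> L" if x: "x \<in> H" for x
    proof -
      obtain r where r: "r \<in> R" "x - r \<in> K" using R x by blast
      then obtain q where q: "q \<in> Q" "x - r - q \<in> L" using Q by blast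
      then have "x - (r + q) \<in> L" by (simp add: algebra_simps)
      then show ?thesis using r q by force
    qed
    show "x = y" if "x \<in> ?P" "y \<in> ?P" "x - y \<in> L" for x y
      using that by (auto dest: uniq)
  qed
  also have "\<dots> = card (R \<times> Q)"
  proof (intro card_image inj_onI)
    fix s t assume st: "s \<in> R \<times> Q" "t \<in> R \<times> Q" "(\<lambda>(r, q). r + q) s = (\<lambda>(r, q). r + q) t"
    then show "s = t"
      using uniq[of "fst s" "fst t" "snd s" "snd t"] subgroup_setD(1)[OF L]
      by (auto simp: case_prod_beta prod_eq_iff)
  qed
  also have "\<dots> = subgroup_index H K * subgroup_index K L"
    using subgroup_index_eq_card[OF K R] subgroup_index_eq_card[OF L Q] by (simp add: card_cartesian_product)
  finally show ?thesis .
qed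

text \<open>The second isomorphism theorem for \<open>K\<close> contained in \<open>K' + L\<close>:
  a transversal of \<open>K'\<close> modulo the intersection also serves for \<open>K\<close> modulo
  \<open>L\<close>.\<close>

lemma subgroup_index_second_iso:
  assumes L: "subgroup_set L" and L': "subgroup_set L'" and K': "subgroup_set K'"
    and sub: "K' \<subseteq> K" and rep: "\<And>x. x \<in> K \<Longrightarrow> \<exists>y\<in>K'. x - y \<in> L" and int: "L \<inter> K' = L'"
  shows "subgroup_index K L = subgroup_index K' L'"
proof -
  obtain R where R: "R \<subseteq> K'" "\<And>x. x \<in> K' \<Longrightarrow> \<exists>y\<in>R. x - y \<in> L'"
    "\<And>x y. x \<in> R \<Longrightarrow> y \<in> R \<Longrightarrow> x - y \<in> L' \<Longrightarrow> x = y"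
    by (rule coset_representatives[OF L', of K']) (rule that)
  have "subgroup_index K L = card R"
  proof (rule subgroup_index_eq_card[OF L])
    show "R \<subseteq> K" using R sub by blast
    show "\<exists>y\<in>R. x - y \<in> L" if "x \<in> K" for x
    proof -
      obtain y where y: "y \<in> K'" "x - y \<in> L" using rep \<open>x \<in> K\<close> by blast
      obtain z where z: "z \<in> R" "y - z \<in> L'" using R y by blast
      have "(x - y) + (y - z) \<in> L"
        by (rule subgroup_setD(4)[OF L]) (use y z int in auto)
      then show ?thesis using z by auto
    qed
    show "x = y" if "x \<in> R" "y \<in> R" "x - y \<in> L" for x y
    proof -
      have "x - y \<in> K'" by (rule subgroup_setD(2)[OF K']) (use that R in auto)
      then show ?thesis using that R(3) int by blast
    qed
  qed
  then show ?thesis using subgroup_index_eq_card[OF L' R] by simp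
qed

text \<open>By \<open>ker\<close>, \<open>L\<close> is the full preimage of its image, so
  \<open>f\<close> neither merges nor splits cosets and carries a transversal to a
  transversal.\<close>

lemma subgroup_index_image:
  assumes f: "\<And>x y. x \<in> K \<Longrightarrow> y \<in> K \<Longrightarrow> f (x - y) = f x - f y"
    and K: "subgroup_set K" and L: "subgroup_set L" and fL: "subgroup_set (f ` L)"
    and LK: "L \<subseteq> K" and ker: "\<And>x. x \<in> K \<Longrightarrow> f x \<in> f ` L \<Longrightarrow> x \<in> L"
  shows "subgroup_index (f ` K) (f ` L) = subgroup_index K L"
proof -
  obtain R where R: "R \<subseteq> K" "\<And>x. x \<in> K \<Longrightarrow> \<exists>y\<in>R. x - y \<in> L"
    "\<And>x y. x \<in> R \<Longrightarrow> y \<in> R \<Longrightarrow> x - y \<in> L \<Longrightarrow> x = y"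
    by (rule coset_representatives[OF L, of K]) (rule that)
  have inj: "x = y" if "x \<in> R" "y \<in> R" "f x - f y \<in> f ` L" for x y
  proof -
    have xy: "x \<in> K" "y \<in> K" using R(1) that by auto
    then have "x - y \<in> L"
      using ker[of "x - y"] f[OF xy] that(3) subgroup_setD(2)[OF K xy] by simp
    then show ?thesis using R that by blast
  qed
  have "subgroup_index (f ` K) (f ` L) = card (f ` R)"
  proof (rule subgroup_index_eq_card[OF fL])
    show "f ` R \<subseteq> f ` K" using R by blast
    show "\<exists>y\<in>f ` R. x - y \<in> f ` L" if x: "x \<in> f ` K" for x
    proof -
      obtain u where u: "u \<in> K" "x = f u" using x by blast
      obtain r where r: "r \<in> R" "u - r \<in> L" using R u by blast
      then have "f u - f r \<in> f ` L" using f[of u r] u R by (metis image_eqI subsetD)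
      then show ?thesis using r u by blast
    qed
    show "x = y" if "x \<in> f ` R" "y \<in> f ` R" "x - y \<in> f ` L" for x y
      using that inj by blast
  qed
  also have "\<dots> = card R"
    using subgroup_setD(1)[OF fL] by (intro card_image inj_onI inj) auto
  finally show ?thesis using subgroup_index_eq_card[OF L R] by simp
qed

lemma subgroup_index_self:
  assumes "subgroup_set L"
  shows "subgroup_index L L = 1"
  using subgroup_index_eq_card[OF assms, of "{0}" L] subgroup_setD[OF assms] by auto

lemma subgroup_index_int: "subgroup_index (UNIV :: int set) (range ((*) p)) = nat \<bar>p\<bar>"
proof -
  have sub: "subgroup_set (range ((*) p))"
    by (auto simp: subgroup_set_def image_iff) (metis right_diff_distrib)
  show ?thesis
  proof (cases "p = 0")
    \<comment> \<open>The multiples of 0 form the trivial subgroup, whose index in the integers is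
      infinite; both sides are 0. Elimination meets this case when a column vanishes.\<close>
    case True
    have "subgroup_index (UNIV :: int set) (range ((*) p)) = card (UNIV :: int set)"
      by (rule subgroup_index_eq_card[OF sub]) (use True in auto)
    then show ?thesis using True by (simp add: infinite_UNIV_int)
  next
    case False
    have "subgroup_index (UNIV :: int set) (range ((*) p)) = card {0..<\<bar>p\<bar>}"
    proof (rule subgroup_index_eq_card[OF sub])
      fix x :: int
      have "x mod \<bar>p\<bar> \<in> {0..<\<bar>p\<bar>}" using False by simp
      moreover have "p dvd x - x mod \<bar>p\<bar>"
        by (metis abs_dvd_iff dvd_minus_mod)
      ultimately show "\<exists>y\<in>{0..<\<bar>p\<bar>}. x - y \<in> range ((*) p)" by (intro bexI[of _ "x mod \<bar>p\<bar>"]) auto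
    next
      fix x y :: int assume xy: "x \<in> {0..<\<bar>p\<bar>}" "y \<in> {0..<\<bar>p\<bar>}" "x - y \<in> range ((*) p)"
      then have "\<bar>p\<bar> dvd x - y" by auto
      then have "x mod \<bar>p\<bar> = y mod \<bar>p\<bar>" by (simp add: mod_eq_dvd_iff)
      then show "x = y" using xy by simp
    qed auto
    then show ?thesis by simp
  qed
qed

section \<open>Lattices in free abelian groups\<close>

definition lincomb :: "'i set \<Rightarrow> ('i \<Rightarrow> int) \<Rightarrow> ('i \<Rightarrow> 'a \<Rightarrow>\<^sub>0 int) \<Rightarrow> 'a \<Rightarrow>\<^sub>0 int" where
  "lincomb S c v = (\<Sum>i\<in>S. frag_cmul (c i) (v i))"

definition lattice_span :: "'i set \<Rightarrow> ('i \<Rightarrow> 'a \<Rightarrow>\<^sub>0 int) \<Rightarrow> ('a \<Rightarrow>\<^sub>0 int) set" where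
  "lattice_span S v = range (\<lambda>c. lincomb S c v)"

text \<open>Coefficients belong to indices and not to values, so a family with repeated members,
  such as a matrix with equal rows, counts as dependent.\<close>

definition independent_family :: "'i set \<Rightarrow> ('i \<Rightarrow> 'a \<Rightarrow>\<^sub>0 int) \<Rightarrow> bool" where
  "independent_family S v \<longleftrightarrow> (\<forall>c. lincomb S c v = 0 \<longrightarrow> (\<forall>i\<in>S. c i = 0))"

definition free_part :: "'a set \<Rightarrow> ('a \<Rightarrow>\<^sub>0 int) set" where
  "free_part S = {x. Poly_Mapping.keys x \<subseteq> S}"

text \<open>Containment of the rational spans, expressed without leaving the integers. It stands in
  for all linear algebra over the rationals.\<close>

definition torsion_over :: "('a \<Rightarrow>\<^sub>0 int) set \<Rightarrow> ('a \<Rightarrow>\<^sub>0 int) set \<Rightarrow> bool" where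
  "torsion_over K L \<longleftrightarrow> (\<forall>x\<in>K. \<exists>k. k \<noteq> 0 \<and> frag_cmul k x \<in> L)"

lemma lincomb_cong:
  "(\<And>i. i \<in> S \<Longrightarrow> c i = d i) \<Longrightarrow> (\<And>i. i \<in> S \<Longrightarrow> v i = w i) \<Longrightarrow> lincomb S c v = lincomb S d w"
  by (auto simp: lincomb_def intro: sum.cong)

lemma lincomb_diff: "lincomb S (\<lambda>i. c i - d i) v = lincomb S c v - lincomb S d v"
  by (simp add: lincomb_def frag_cmul_diff_distrib sum_subtractf)

lemma lincomb_zero [simp]: "lincomb S (\<lambda>i. 0) v = 0"
  by (simp add: lincomb_def)

lemma lincomb_single:
  assumes "finite S" "a \<in> S"
  shows "lincomb S (\<lambda>i. if i = a then k else 0) v = frag_cmul k (v a)"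
proof -
  have "lincomb S (\<lambda>i. if i = a then k else 0) v = (\<Sum>i\<in>S. if i = a then frag_cmul k (v i) else 0)"
    unfolding lincomb_def by (intro sum.cong) auto
  then show ?thesis using assms by (simp add: sum.delta)
qed

lemma lincomb_insert:
  "finite S \<Longrightarrow> a \<notin> S \<Longrightarrow> lincomb (insert a S) c v = frag_cmul (c a) (v a) + lincomb S c v"
  by (simp add: lincomb_def)

lemma frag_extend_lincomb:
  "frag_extend g (lincomb S c v) = lincomb S c (\<lambda>i. frag_extend g (v i))"
  unfolding lincomb_def by (induction S rule: infinite_finite_induct) (auto simp: frag_extend_add frag_extend_cmul)

lemma lookup_lincomb: "Poly_Mapping.lookup (lincomb S c v) a = (\<Sum>i\<in>S. c i * Poly_Mapping.lookup (v i) a)"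
  by (simp add: lincomb_def lookup_sum)

lemma lookup_lincomb_frag_of:
  assumes "finite S"
  shows "Poly_Mapping.lookup (lincomb S c frag_of) a = (if a \<in> S then c a else 0)"
proof -
  have "Poly_Mapping.lookup (lincomb S c frag_of) a = (\<Sum>i\<in>S. if i = a then c i else 0)"
    unfolding lookup_lincomb by (intro sum.cong) auto
  then show ?thesis using assms by (simp add: sum.delta)
qed

lemma free_part_expansion:
  assumes "finite S" "x \<in> free_part S"
  shows "x = lincomb S (Poly_Mapping.lookup x) frag_of"
proof (rule poly_mapping_eqI)
  fix a show "Poly_Mapping.lookup x a = Poly_Mapping.lookup (lincomb S (Poly_Mapping.lookup x) frag_of) a"
    using assms by (auto simp: lookup_lincomb_frag_of free_part_def in_keys_iff)
qed

lemma free_part_iff: "x \<in> free_part S \<longleftrightarrow> (\<forall>a. a \<notin> S \<longrightarrow> Poly_Mapping.lookup x a = 0)"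
  by (auto simp: free_part_def in_keys_iff)

lemma free_part_subgroup: "subgroup_set (free_part S)"
  by (auto simp: subgroup_set_def free_part_iff lookup_minus)

lemma free_part_mono: "S \<subseteq> T \<Longrightarrow> free_part S \<subseteq> free_part T"
  by (auto simp: free_part_def)

lemma lattice_span_subgroup: "subgroup_set (lattice_span S v)"
proof -
  have "0 \<in> lattice_span S v"
    unfolding lattice_span_def by (rule image_eqI[of _ _ "\<lambda>_. 0"]) simp_all
  then show ?thesis
    unfolding subgroup_set_def lattice_span_def by (auto simp flip: lincomb_diff)
qed

lemma subgroup_set_cmul:
  fixes L :: "('a \<Rightarrow>\<^sub>0 int) set"
  assumes L: "subgroup_set L" and x: "x \<in> L"
  shows "frag_cmul k x \<in> L"
proof -
  have nat: "frag_cmul (int n) x \<in> L" for n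
  proof (induction n)
    case (Suc n)
    have "frag_cmul (int (Suc n)) x = x + frag_cmul (int n) x"
      using frag_cmul_distrib[of 1 "int n" x] by simp
    then show ?case using subgroup_setD(4)[OF L x Suc] by (simp only:)
  qed (use subgroup_setD(1)[OF L] in simp)
  show ?thesis
  proof (cases k rule: int_cases2)
    case (nonpos n)
    then show ?thesis using subgroup_setD(3)[OF L nat[of n]] by simp
  qed (use nat in simp)
qed

lemma subgroup_set_lincomb:
  assumes "subgroup_set L" "\<And>i. i \<in> S \<Longrightarrow> v i \<in> L"
  shows "lincomb S c v \<in> L"
  unfolding lincomb_def using assms by (intro subgroup_set_sum subgroup_set_cmul) auto

lemma lattice_span_least:
  assumes "subgroup_set L" "\<And>i. i \<in> S \<Longrightarrow> v i \<in> L"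
  shows "lattice_span S v \<subseteq> L"
  unfolding lattice_span_def by (rule image_subsetI) (rule subgroup_set_lincomb[OF assms])

lemma lattice_span_base:
  assumes "finite S" "i \<in> S"
  shows "v i \<in> lattice_span S v"
  unfolding lattice_span_def
  by (rule image_eqI[of _ _ "\<lambda>j. if j = i then 1 else 0"]) (simp_all add: lincomb_single assms)

lemma lattice_span_cong: "(\<And>i. i \<in> S \<Longrightarrow> v i = w i) \<Longrightarrow> lattice_span S v = lattice_span S w"
  unfolding lattice_span_def by (intro arg_cong[of _ _ range] ext lincomb_cong) auto

lemma lattice_span_mono:
  assumes "finite T" "S \<subseteq> T"
  shows "lattice_span S v \<subseteq> lattice_span T v"
  using assms by (intro lattice_span_least lattice_span_subgroup) (auto intro: lattice_span_base)

lemma lattice_span_insertE: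
  assumes "finite S" "a \<notin> S" "x \<in> lattice_span (insert a S) v"
  obtains k y where "y \<in> lattice_span S v" "x = frag_cmul k (v a) + y"
  using assms by (auto simp: lattice_span_def lincomb_insert)

lemma lattice_span_frag_of: "finite S \<Longrightarrow> lattice_span S frag_of = free_part S"
proof
  assume S: "finite S"
  show "lattice_span S frag_of \<subseteq> free_part S"
    by (rule lattice_span_least[OF free_part_subgroup]) (auto simp: free_part_def)
  show "free_part S \<subseteq> lattice_span S frag_of"
    using free_part_expansion[OF S] unfolding lattice_span_def by blast
qed

lemma frag_extend_lattice_span:
  "frag_extend g ` lattice_span S v = lattice_span S (\<lambda>i. frag_extend g (v i))"
  unfolding lattice_span_def by (auto simp: image_image frag_extend_lincomb)

lemma frag_extend_free_part:
  "finite S \<Longrightarrow> frag_extend v ` free_part S = lattice_span S v"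
  using frag_extend_lattice_span[of v S frag_of] by (simp add: lattice_span_frag_of)

lemma frag_extend_image_subgroup:
  assumes "subgroup_set L"
  shows "subgroup_set (frag_extend g ` L)"
  using assms unfolding subgroup_set_def
  by (auto simp flip: frag_extend_diff) (metis frag_extend_0 image_eqI)

lemma independent_family_empty: "independent_family {} v"
  by (simp add: independent_family_def)

lemma independent_family_kernel:
  assumes "finite S"
  shows "independent_family S v \<longleftrightarrow> (\<forall>x\<in>free_part S. frag_extend v x = 0 \<longrightarrow> x = 0)"
proof
  assume ind: "independent_family S v"
  show "\<forall>x\<in>free_part S. frag_extend v x = 0 \<longrightarrow> x = 0"
  proof (intro ballI impI)
    fix x assume x: "x \<in> free_part S" "frag_extend v x = 0"
    then have "lincomb S (Poly_Mapping.lookup x) v = 0"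
      using free_part_expansion[OF assms x(1)] frag_extend_lincomb[of v S "Poly_Mapping.lookup x" frag_of]
      by simp
    then have "\<forall>i\<in>S. Poly_Mapping.lookup x i = 0" using ind by (auto simp: independent_family_def)
    then show "x = 0" using x by (intro poly_mapping_eqI) (auto simp: free_part_iff)
  qed
next
  assume *: "\<forall>x\<in>free_part S. frag_extend v x = 0 \<longrightarrow> x = 0"
  show "independent_family S v"
    unfolding independent_family_def
  proof (intro allI impI ballI)
    fix c i assume c: "lincomb S c v = 0" and i: "i \<in> S"
    have "lincomb S c frag_of \<in> free_part S"
      using assms by (auto simp: free_part_iff lookup_lincomb_frag_of)
    moreover have "frag_extend v (lincomb S c frag_of) = 0" using c by (simp add: frag_extend_lincomb)
    ultimately have "lincomb S c frag_of = 0" using * by blast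
    then show "c i = 0" using lookup_lincomb_frag_of[OF assms, of c i] i by simp
  qed
qed

lemma independent_family_inj:
  assumes "finite S" "independent_family S v"
  shows "inj_on v S"
proof (rule inj_onI)
  fix i j assume ij: "i \<in> S" "j \<in> S" "v i = v j"
  show "i = j"
  proof (rule ccontr)
    assume ne: "i \<noteq> j"
    let ?c = "\<lambda>k. (if k = i then 1 else 0) - (if k = j then 1 else 0) :: int"
    have "lincomb S ?c v = 0" using ij assms(1) by (simp add: lincomb_diff lincomb_single)
    then have "\<forall>k\<in>S. ?c k = 0" using assms(2) unfolding independent_family_def by (elim allE impE)
    then show False using ne ij by (auto dest: bspec[of _ _ i])
  qed
qed

lemma independent_family_image:
  assumes "finite S" "independent_family S v"
  shows "independent_family (v ` S) (\<lambda>x. x)"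
  unfolding independent_family_def
proof (intro allI impI ballI)
  fix c x assume c: "lincomb (v ` S) c (\<lambda>x. x) = 0" and x: "x \<in> v ` S"
  have "lincomb S (\<lambda>i. c (v i)) v = 0"
    using c unfolding lincomb_def by (subst (asm) sum.reindex[OF independent_family_inj[OF assms]]) simp
  then show "c x = 0" using assms(2) x by (auto simp: independent_family_def)
qed

text \<open>Steinitz exchange without division, by induction on the generators. If some
  \<open>w t0\<close> involves the generator \<open>a\<close>, cross-multiplication with it removes
  \<open>a\<close> from all other members, at the cost of one generator and one member.\<close>

theorem independent_family_card_le:
  assumes "finite S" "finite T" "\<And>t. t \<in> T \<Longrightarrow> w t \<in> lattice_span S v" "independent_family T w"
  shows "card T \<le> card S"
  using assms
proof (induction S arbitrary: T w rule: finite_induct)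
  case empty
  have "T = {}"
  proof (rule ccontr)
    assume "T \<noteq> {}"
    then obtain t where t: "t \<in> T" by auto
    have "lincomb T (\<lambda>_. 1) w = 0"
      unfolding lincomb_def by (rule sum.neutral) (use empty in \<open>auto simp: lattice_span_def lincomb_def\<close>)
    then show False using empty.prems(3) t unfolding independent_family_def by fastforce
  qed
  then show ?case by simp
next
  case (insert a S)
  have "\<exists>k y. y \<in> lattice_span S v \<and> w t = frag_cmul k (v a) + y" if "t \<in> T" for t
    using insert.prems(2)[OF that] lattice_span_insertE[OF insert.hyps(1,2)] by metis
  then obtain \<alpha> y where \<alpha>: "\<And>t. t \<in> T \<Longrightarrow> y t \<in> lattice_span S v"
    "\<And>t. t \<in> T \<Longrightarrow> w t = frag_cmul (\<alpha> t) (v a) + y t"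
    by metis
  show ?case
  proof (cases "\<exists>t\<in>T. \<alpha> t \<noteq> 0")
    case False
    then have "w t \<in> lattice_span S v" if "t \<in> T" for t using \<alpha>[OF that] that by simp
    then have "card T \<le> card S" using insert.prems(1,3) by (intro insert.IH)
    then show ?thesis using insert.hyps by simp
  next
    case True
    then obtain t0 where t0: "t0 \<in> T" "\<alpha> t0 \<noteq> 0" by blast
    let ?T = "T - {t0}"
    define w' where "w' t = frag_cmul (\<alpha> t0) (w t) - frag_cmul (\<alpha> t) (w t0)" for t
    have "w' t \<in> lattice_span S v" if "t \<in> ?T" for t
    proof -
      have "w' t = frag_cmul (\<alpha> t0) (y t) - frag_cmul (\<alpha> t) (y t0)"
        using \<alpha>(2)[of t] \<alpha>(2)[of t0] that t0 by (simp add: w'_def frag_cmul_distrib2 mult.commute)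
      then show ?thesis using \<alpha>(1) that t0
        by (auto intro!: subgroup_setD(2)[OF lattice_span_subgroup]
            subgroup_set_cmul[OF lattice_span_subgroup])
    qed
    moreover have "independent_family ?T w'"
      unfolding independent_family_def
    proof (intro allI impI ballI)
      fix c t assume c: "lincomb ?T c w' = 0" and t: "t \<in> ?T"
      \<comment> \<open>The coefficients that a relation \<open>c\<close> between the
        \<open>w'\<close> acquires when it is rewritten in terms of the \<open>w\<close>.\<close>
      let ?d = "\<lambda>t. if t = t0 then - (\<Sum>t\<in>?T. c t * \<alpha> t) else c t * \<alpha> t0"
      have "lincomb T ?d w = frag_cmul (?d t0) (w t0) + lincomb ?T ?d w"
        using lincomb_insert[of ?T t0 ?d w] insert.prems(1) t0 by (simp add: insert_absorb)
      also have "lincomb ?T ?d w = lincomb ?T (\<lambda>t. c t * \<alpha> t0) w"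
        by (intro lincomb_cong) auto
      also have "frag_cmul (?d t0) (w t0) + \<dots> = lincomb ?T c w'"
        unfolding lincomb_def w'_def
        by (rule poly_mapping_eqI)
          (simp add: lookup_add lookup_minus lookup_sum right_diff_distrib sum_subtractf sum_distrib_right mult.assoc)
      finally have "lincomb T ?d w = 0" using c by simp
      then have "?d t = 0" using insert.prems(3) t unfolding independent_family_def by blast
      then show "c t = 0" using t t0 by auto
    qed
    ultimately have "card ?T \<le> card S" using insert.prems(1) by (intro insert.IH) auto
    then show ?thesis using insert.hyps insert.prems(1) t0 by simp
  qed
qed

lemma independent_family_scale:
  assumes "independent_family T w" "\<And>t. t \<in> T \<Longrightarrow> k t \<noteq> 0"
  shows "independent_family T (\<lambda>t. frag_cmul (k t) (w t))"
  unfolding independent_family_def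
proof (intro allI impI ballI)
  fix c t assume c: "lincomb T c (\<lambda>t. frag_cmul (k t) (w t)) = 0" and t: "t \<in> T"
  then have "lincomb T (\<lambda>t. c t * k t) w = 0" by (simp add: lincomb_def)
  then have "c t * k t = 0" using assms(1) t unfolding independent_family_def by blast
  then show "c t = 0" using assms(2)[OF t] by simp
qed

lemma independent_family_card_le_torsion:
  assumes "finite S" "finite T" "torsion_over K (lattice_span S v)" "\<And>t. t \<in> T \<Longrightarrow> w t \<in> K"
    "independent_family T w"
  shows "card T \<le> card S"
proof -
  have "\<exists>k. k \<noteq> 0 \<and> frag_cmul k (w t) \<in> lattice_span S v" if "t \<in> T" for t
    using assms(3) assms(4)[OF that] by (auto simp: torsion_over_def)
  then obtain k where k: "\<And>t. t \<in> T \<Longrightarrow> k t \<noteq> 0 \<and> frag_cmul (k t) (w t) \<in> lattice_span S v"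
    by metis
  show ?thesis
    by (rule independent_family_card_le[OF assms(1,2) _ independent_family_scale[OF assms(5)]])
      (use k in auto)
qed

text \<open>Closure comes from the product of the two multipliers. Because the saturation is a
  subgroup, \<open>torsion_over\<close> can be checked on generators alone.\<close>

lemma saturation_subgroup:
  fixes L :: "('a \<Rightarrow>\<^sub>0 int) set"
  assumes L: "subgroup_set L"
  shows "subgroup_set {x. \<exists>k. k \<noteq> 0 \<and> frag_cmul k x \<in> L}"
  unfolding subgroup_set_def
proof (intro conjI ballI)
  show "0 \<in> {x. \<exists>k. k \<noteq> 0 \<and> frag_cmul k x \<in> L}"
    using subgroup_setD(1)[OF L] by (auto intro: exI[of _ 1])
  fix x y assume "x \<in> {x. \<exists>k. k \<noteq> 0 \<and> frag_cmul k x \<in> L}" "y \<in> {x. \<exists>k. k \<noteq> 0 \<and> frag_cmul k x \<in> L}"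
  then obtain k l where kl: "k \<noteq> 0" "frag_cmul k x \<in> L" "l \<noteq> 0" "frag_cmul l y \<in> L" by auto
  have "frag_cmul (k * l) (x - y) = frag_cmul l (frag_cmul k x) - frag_cmul k (frag_cmul l y)"
    by (rule poly_mapping_eqI) (simp add: lookup_minus algebra_simps)
  moreover have "\<dots> \<in> L"
    by (rule subgroup_setD(2)[OF L subgroup_set_cmul[OF L kl(2)] subgroup_set_cmul[OF L kl(4)]])
  ultimately show "x - y \<in> {x. \<exists>k. k \<noteq> 0 \<and> frag_cmul k x \<in> L}"
    using kl by (auto intro!: exI[of _ "k * l"])
qed

lemma torsion_over_lattice_span:
  assumes "subgroup_set L" "\<And>i. i \<in> S \<Longrightarrow> \<exists>k. k \<noteq> 0 \<and> frag_cmul k (v i) \<in> L"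
  shows "torsion_over (lattice_span S v) L"
  using lattice_span_least[OF saturation_subgroup[OF assms(1)], of S v] assms(2)
  unfolding torsion_over_def by blast

lemma torsion_over_trans:
  assumes "torsion_over K L" "torsion_over L H"
  shows "torsion_over K H"
  unfolding torsion_over_def
proof
  fix x assume "x \<in> K"
  then obtain k where k: "k \<noteq> 0" "frag_cmul k x \<in> L" using assms(1) by (auto simp: torsion_over_def)
  then obtain l where "l \<noteq> 0" "frag_cmul l (frag_cmul k x) \<in> H" using assms(2) by (auto simp: torsion_over_def)
  then show "\<exists>k. k \<noteq> 0 \<and> frag_cmul k x \<in> H" using k by (intro exI[of _ "l * k"]) auto
qed

lemma torsion_over_mono: "K \<subseteq> K' \<Longrightarrow> torsion_over K' L \<Longrightarrow> torsion_over K L"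
  by (auto simp: torsion_over_def)

text \<open>Basis extension in the matroid of a family of integer vectors: adding any
  \<open>i\<close> to a maximal independent \<open>J\<close> creates a relation with nonzero
  coefficient at \<open>i\<close>, which puts a multiple of \<open>v i\<close> into the span of
  \<open>J\<close>.\<close>

lemma maximal_independent_subfamily:
  assumes fin: "finite S" and J0: "J0 \<subseteq> S" "independent_family J0 v"
  obtains J where "J0 \<subseteq> J" "J \<subseteq> S" "independent_family J v"
    "torsion_over (lattice_span S v) (lattice_span J v)"
proof -
  let ?P = "{J. J0 \<subseteq> J \<and> J \<subseteq> S \<and> independent_family J v}"
  have "finite ?P" using fin by (auto intro: finite_subset[of _ "Pow S"])
  moreover have "J0 \<in> ?P" using J0 by auto
  ultimately obtain J where J: "J \<in> ?P" "\<forall>J'\<in>?P. J \<subseteq> J' \<longrightarrow> J = J'"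
    using finite_has_maximal[of ?P] by blast
  have finJ: "finite J" using J(1) fin finite_subset by auto
  have "\<exists>k. k \<noteq> 0 \<and> frag_cmul k (v i) \<in> lattice_span J v" if i: "i \<in> S" for i
  proof (cases "i \<in> J")
    case True
    then show ?thesis using lattice_span_base[OF finJ True, of v] by (intro exI[of _ 1]) auto
  next
    case False
    then have "\<not> independent_family (insert i J) v" using J i by blast
    then obtain c where c: "lincomb (insert i J) c v = 0" "\<exists>j\<in>insert i J. c j \<noteq> 0"
      by (auto simp: independent_family_def)
    have eq: "frag_cmul (c i) (v i) + lincomb J c v = 0" using c(1) lincomb_insert[OF finJ False] by metis
    have "c i \<noteq> 0"
    proof
      assume ci: "c i = 0"
      then have "lincomb J c v = 0" using eq by simp
      then have "\<forall>j\<in>J. c j = 0" using J(1) by (auto simp: independent_family_def)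
      then show False using ci c(2) by auto
    qed
    moreover have "frag_cmul (c i) (v i) = - lincomb J c v"
      using eq by (simp add: eq_neg_iff_add_eq_0)
    moreover have "- lincomb J c v \<in> lattice_span J v"
      by (intro subgroup_setD(3)[OF lattice_span_subgroup]) (auto simp: lattice_span_def)
    ultimately show ?thesis by (intro exI[of _ "c i"]) simp
  qed
  then have "torsion_over (lattice_span S v) (lattice_span J v)"
    by (intro torsion_over_lattice_span lattice_span_subgroup)
  then show thesis using J(1) that by auto
qed

section \<open>Ranks of subgroups and the rank-nullity theorem\<close>

definition has_rank :: "('a \<Rightarrow>\<^sub>0 int) set \<Rightarrow> nat \<Rightarrow> bool" where
  "has_rank K n \<longleftrightarrow>
     (\<exists>C. finite C \<and> C \<subseteq> K \<and> independent_family C (\<lambda>x. x) \<and> card C = n) \<and>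
     (\<forall>C. finite C \<longrightarrow> C \<subseteq> K \<longrightarrow> independent_family C (\<lambda>x. x) \<longrightarrow> card C \<le> n)"

lemma has_rank_unique: "has_rank K m \<Longrightarrow> has_rank K n \<Longrightarrow> m = n"
  unfolding has_rank_def by (metis le_antisym)

lemma has_rank_torsion_over:
  assumes "finite J" "independent_family J v" "lattice_span J v \<subseteq> K" "torsion_over K (lattice_span J v)"
  shows "has_rank K (card J)"
  unfolding has_rank_def
proof (intro conjI allI impI exI[of _ "v ` J"])
  show "v ` J \<subseteq> K" using assms(3) lattice_span_base[OF assms(1)] by auto
  show "card (v ` J) = card J" by (rule card_image[OF independent_family_inj[OF assms(1,2)]])
  fix C assume C: "finite C" "C \<subseteq> K" "independent_family C (\<lambda>x. x)"
  then show "card C \<le> card J"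
    by (intro independent_family_card_le_torsion[OF assms(1) C(1) assms(4) _ C(3)]) auto
qed (use assms independent_family_image in auto)

text \<open>For each \<open>i\<close> outside \<open>J\<close>, the relation expressing a multiple
  of \<open>v i\<close> through \<open>J\<close> is a kernel element \<open>z i\<close>. These are
  independent, since among them only \<open>z i\<close> involves coordinate \<open>i\<close>.
  Conversely, forgetting the coordinates in \<open>J\<close> is injective on the kernel because
  \<open>J\<close> is independent, which bounds the rank from above.\<close>

lemma has_rank_kernel:
  assumes fin: "finite S" and J: "J \<subseteq> S" "independent_family J v"
    and tor: "torsion_over (lattice_span S v) (lattice_span J v)"
  shows "has_rank {x \<in> free_part S. frag_extend v x = 0} (card S - card J)"
proof -
  let ?K = "{x \<in> free_part S. frag_extend v x = 0}"
  have finJ: "finite J" using J fin finite_subset by auto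
  have card: "card (S - J) = card S - card J" using finJ J by (intro card_Diff_subset)
  have "\<exists>k b. k \<noteq> 0 \<and> frag_cmul k (v i) = lincomb J b v" if "i \<in> S" for i
    using tor lattice_span_base[OF fin that, of v] unfolding torsion_over_def lattice_span_def by blast
  then obtain k b where kb: "\<And>i. i \<in> S \<Longrightarrow> k i \<noteq> 0"
    "\<And>i. i \<in> S \<Longrightarrow> frag_cmul (k i) (v i) = lincomb J (b i) v"
    by metis
  define z where "z i = frag_cmul (k i) (frag_of i) - lincomb J (b i) frag_of" for i
  have zK: "z i \<in> ?K" if "i \<in> S" for i
  proof -
    have "z i \<in> free_part S"
      unfolding z_def
      by (intro subgroup_setD(2)[OF free_part_subgroup] subgroup_set_cmul[OF free_part_subgroup]
          subgroup_set_lincomb[OF free_part_subgroup])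
        (use that J in \<open>auto simp: free_part_def\<close>)
    moreover have "frag_extend v (z i) = 0"
      unfolding z_def using kb(2)[OF that] by (simp add: frag_extend_diff frag_extend_cmul frag_extend_lincomb)
    ultimately show ?thesis by simp
  qed
  have ind: "independent_family (S - J) z"
    unfolding independent_family_def
  proof (intro allI impI ballI)
    fix c i assume c: "lincomb (S - J) c z = 0" and i: "i \<in> S - J"
    have "0 = (\<Sum>j\<in>S - J. c j * Poly_Mapping.lookup (z j) i)"
      using arg_cong[OF c, of "\<lambda>x. Poly_Mapping.lookup x i"] by (simp add: lookup_lincomb)
    also have "\<dots> = (\<Sum>j\<in>S - J. if j = i then c j * k j else 0)"
      using i finJ by (intro sum.cong) (auto simp: z_def lookup_minus lookup_lincomb_frag_of)
    also have "\<dots> = c i * k i" using i fin by (simp add: sum.delta)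
    finally show "c i = 0" using kb(1) i by auto
  qed
  have upper: "card C \<le> card (S - J)"
    if C: "finite C" "C \<subseteq> ?K" "independent_family C (\<lambda>x. x)" for C
  proof -
    \<comment> \<open>The projection that forgets the coordinates in \<open>J\<close>.\<close>
    let ?p = "frag_extend (\<lambda>i. if i \<in> S - J then frag_of i else 0)"
    have p: "Poly_Mapping.lookup (?p x) i = (if i \<in> S - J then Poly_Mapping.lookup x i else 0)"
      if "x \<in> free_part S" for x i
    proof -
      have "?p x = lincomb S (Poly_Mapping.lookup x) (\<lambda>i. if i \<in> S - J then frag_of i else 0)"
        by (subst free_part_expansion[OF fin that], subst frag_extend_lincomb) simp
      also have "\<dots> = lincomb (S - J) (Poly_Mapping.lookup x) frag_of"
        unfolding lincomb_def using fin by (intro sum.mono_neutral_cong_right) auto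
      finally show ?thesis using fin by (simp add: lookup_lincomb_frag_of)
    qed
    have "independent_family C ?p"
      unfolding independent_family_def
    proof (intro allI impI ballI)
      fix c x assume c: "lincomb C c ?p = 0" and x: "x \<in> C"
      let ?y = "lincomb C c (\<lambda>x. x)"
      have py: "?p ?y = 0" using c by (simp add: frag_extend_lincomb)
      have y: "?y \<in> free_part S"
        using C(2) by (intro subgroup_set_lincomb free_part_subgroup) auto
      have "frag_extend v ?y = 0"
        by (subst frag_extend_lincomb, unfold lincomb_def, rule sum.neutral) (use C(2) in auto)
      moreover have "?y \<in> free_part J"
        using y p[OF y] py by (auto simp: free_part_iff) (metis lookup_zero)
      ultimately have "?y = 0" using J(2) independent_family_kernel[OF finJ] by blast
      then show "c x = 0" using C(3) x by (auto simp: independent_family_def)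
    qed
    moreover have "?p x \<in> lattice_span (S - J) frag_of" if "x \<in> C" for x
      using that C(2) p fin by (subst lattice_span_frag_of) (auto simp: free_part_iff)
    ultimately show ?thesis using C(1) fin by (intro independent_family_card_le) auto
  qed
  show ?thesis
    unfolding has_rank_def card[symmetric]
  proof (intro conjI allI impI exI[of _ "z ` (S - J)"])
    show "card (z ` (S - J)) = card (S - J)"
      by (rule card_image[OF independent_family_inj[OF _ ind]]) (use fin in auto)
  qed (use fin zK ind upper independent_family_image[OF _ ind] in auto)
qed

section \<open>Determinants as lattice indices\<close>

text \<open>If \<open>k i\<close> times the generator \<open>v i\<close> lies in \<open>L\<close>,
  then coefficients can be reduced modulo \<open>k i\<close>, so finitely many combinations meet
  every coset.\<close>

lemma subgroup_index_nonzero: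
  assumes fin: "finite S" and L: "subgroup_set L"
    and tor: "torsion_over (lattice_span S v) L"
  shows "subgroup_index (lattice_span S v) L \<noteq> 0"
proof -
  let ?c = "\<lambda>x. (+) x ` L"
  have "\<exists>k. k > 0 \<and> frag_cmul k (v i) \<in> L" if i: "i \<in> S" for i
  proof -
    obtain k where k: "k \<noteq> 0" "frag_cmul k (v i) \<in> L"
      using tor lattice_span_base[OF fin i, of v] unfolding torsion_over_def by auto
    have "frag_cmul \<bar>k\<bar> (v i) \<in> L"
      using k subgroup_setD(3)[OF L k(2)] by (cases "k > 0") simp_all
    then show ?thesis using k by (intro exI[of _ "\<bar>k\<bar>"]) auto
  qed
  then obtain k where k: "\<And>i. i \<in> S \<Longrightarrow> k i > 0" "\<And>i. i \<in> S \<Longrightarrow> frag_cmul (k i) (v i) \<in> L"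
    by metis
  let ?P = "PiE S (\<lambda>i. {0..<k i})"
  have "?c ` lattice_span S v \<subseteq> (\<lambda>c. ?c (lincomb S c v)) ` ?P"
  proof (rule image_subsetI)
    fix x assume "x \<in> lattice_span S v"
    then obtain c where x: "x = lincomb S c v" by (auto simp: lattice_span_def)
    let ?r = "restrict (\<lambda>i. c i mod k i) S"
    have "x - lincomb S ?r v = lincomb S (\<lambda>i. c i - ?r i) v" unfolding x lincomb_diff ..
    also have "\<dots> = lincomb S (\<lambda>i. c i div k i) (\<lambda>i. frag_cmul (k i) (v i))"
      unfolding lincomb_def by (intro sum.cong) (auto simp: minus_mod_eq_div_mult)
    also have "\<dots> \<in> L" by (rule subgroup_set_lincomb[OF L k(2)])
    finally have "?c x = ?c (lincomb S ?r v)" using coset_eq_iff[OF L] by simp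
    moreover have "?r \<in> ?P" using k(1) by auto
    ultimately show "?c x \<in> (\<lambda>c. ?c (lincomb S c v)) ` ?P" by (rule image_eqI)
  qed
  moreover have "finite ?P" using fin by (intro finite_PiE) auto
  ultimately have "finite (?c ` lattice_span S v)" by (meson finite_imageI finite_subset)
  moreover have "?c ` lattice_span S v \<noteq> {}"
    using subgroup_setD(1)[OF lattice_span_subgroup] by blast
  ultimately show ?thesis by (simp add: subgroup_index_def)
qed

text \<open>Pigeonhole: with finitely many cosets, two different multiples of \<open>x\<close> share
  one, and their difference lies in \<open>L\<close>.\<close>

lemma torsion_over_of_index:
  assumes K: "subgroup_set K" and L: "subgroup_set L" and ind: "subgroup_index K L \<noteq> 0"
  shows "torsion_over K L"
  unfolding torsion_over_def
proof
  fix x assume x: "x \<in> K"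
  let ?f = "\<lambda>n :: nat. (+) (frag_cmul (int n) x) ` L"
  have "finite ((\<lambda>x. (+) x ` L) ` K)" using ind unfolding subgroup_index_def by (meson card.infinite)
  moreover have "range ?f \<subseteq> (\<lambda>x. (+) x ` L) ` K"
    using subgroup_set_cmul[OF K x] by auto
  ultimately have "finite (range ?f)" using finite_subset by blast
  then have "\<not> inj ?f" using finite_imageD by fastforce
  then obtain m n where mn: "m \<noteq> n" "?f m = ?f n" by (auto simp: inj_def)
  then have "frag_cmul (int m - int n) x \<in> L"
    using coset_eq_iff[OF L, of "frag_cmul (int m) x" "frag_cmul (int n) x"] by (simp add: frag_cmul_diff_distrib)
  then show "\<exists>k. k \<noteq> 0 \<and> frag_cmul k x \<in> L" using mn by (intro exI[of _ "int m - int n"]) auto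
qed

text \<open>Induction on the coordinates. An element \<open>x0\<close> whose coordinate at
  \<open>a\<close> has the least nonzero absolute value divides out that coordinate: the remainder
  is smaller, hence 0, and what is left lies in the part covered by the induction
  hypothesis.\<close>

lemma subgroup_finitely_generated:
  assumes "finite S" "subgroup_set K" "K \<subseteq> free_part S"
  shows "\<exists>V. finite V \<and> K = lattice_span V (\<lambda>x. x)"
  using assms
proof (induction S arbitrary: K rule: finite_induct)
  case empty
  have "K = {0}" using empty subgroup_setD(1)[OF empty(1)] by (auto simp: free_part_def)
  then show ?case by (intro exI[of _ "{}"]) (auto simp: lattice_span_def lincomb_def)
next
  case (insert a S)
  note Kc = subgroup_setD[OF insert.prems(1)]
  let ?K = "K \<inter> free_part S"
  have K': "subgroup_set ?K"
    using insert.prems(1) free_part_subgroup[of S] by (auto simp: subgroup_set_def)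
  then obtain V where V: "finite V" "?K = lattice_span V (\<lambda>x. x)" using insert.IH by blast
  show ?case
  proof (cases "\<exists>x\<in>K. Poly_Mapping.lookup x a \<noteq> 0")
    case False
    then have "K \<subseteq> free_part S" using insert.prems(2) unfolding subset_iff free_part_iff by (metis insert_iff)
    then have "?K = K" by auto
    then show ?thesis using V by auto
  next
    case True
    then obtain x1 where "x1 \<in> K \<and> Poly_Mapping.lookup x1 a \<noteq> 0" by blast
    then obtain x0 where x0: "x0 \<in> K" "Poly_Mapping.lookup x0 a \<noteq> 0"
      "\<And>x. x \<in> K \<Longrightarrow> Poly_Mapping.lookup x a \<noteq> 0 \<Longrightarrow> \<bar>Poly_Mapping.lookup x0 a\<bar> \<le> \<bar>Poly_Mapping.lookup x a\<bar>"
      using ex_has_least_nat[of "\<lambda>x. x \<in> K \<and> Poly_Mapping.lookup x a \<noteq> 0" x1 "\<lambda>x. nat \<bar>Poly_Mapping.lookup x a\<bar>"]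
      by (auto simp: nat_le_eq_zle)
    let ?g = "Poly_Mapping.lookup x0 a"
    have "K = lattice_span (insert x0 V) (\<lambda>x. x)"
    proof
      have "V \<subseteq> K" using lattice_span_base[OF V(1), of _ "\<lambda>x. x"] V(2) by auto
      then show "lattice_span (insert x0 V) (\<lambda>x. x) \<subseteq> K"
        using x0 by (intro lattice_span_least insert.prems) auto
      show "K \<subseteq> lattice_span (insert x0 V) (\<lambda>x. x)"
      proof
        fix x assume x: "x \<in> K"
        define q where "q = Poly_Mapping.lookup x a div ?g"
        define y where "y = x - frag_cmul q x0"
        have yK: "y \<in> K" unfolding y_def using x x0 by (intro Kc(2) subgroup_set_cmul[OF insert.prems(1)])
        have "Poly_Mapping.lookup y a = Poly_Mapping.lookup x a mod ?g"
          by (simp add: y_def q_def lookup_minus minus_div_mult_eq_mod)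
        moreover have "\<bar>Poly_Mapping.lookup x a mod ?g\<bar> < \<bar>?g\<bar>" using x0(2) by (rule abs_mod_less)
        ultimately have "Poly_Mapping.lookup y a = 0" using x0(3)[OF yK] by linarith
        moreover have "y \<in> free_part (insert a S)" using yK insert.prems(2) by blast
        ultimately have "y \<in> ?K" using yK by (auto simp: free_part_iff)
        then have "y \<in> lattice_span (insert x0 V) (\<lambda>x. x)"
          using V lattice_span_mono[of "insert x0 V" V "\<lambda>x. x"] by auto
        moreover have "x0 \<in> lattice_span (insert x0 V) (\<lambda>x. x)"
          using lattice_span_base[of "insert x0 V" x0 "\<lambda>x. x"] V by auto
        ultimately have "y + frag_cmul q x0 \<in> lattice_span (insert x0 V) (\<lambda>x. x)"
          by (intro subgroup_setD(4)[OF lattice_span_subgroup] subgroup_set_cmul[OF lattice_span_subgroup])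
        then show "x \<in> lattice_span (insert x0 V) (\<lambda>x. x)" by (simp add: y_def)
      qed
    qed
    then show ?thesis using V(1) by (intro exI[of _ "insert x0 V"]) simp
  qed
qed

lemma subgroup_index_nonzero_iff:
  assumes "finite S" "subgroup_set K" "K \<subseteq> free_part S" "subgroup_set L"
  shows "subgroup_index K L \<noteq> 0 \<longleftrightarrow> torsion_over K L"
proof
  assume "torsion_over K L"
  then show "subgroup_index K L \<noteq> 0"
    using subgroup_finitely_generated[OF assms(1-3)] subgroup_index_nonzero[OF _ assms(4)] by auto
qed (rule torsion_over_of_index[OF assms(2,4)])

text \<open>As \<open>K\<close> contains \<open>frag_of a\<close>, the coordinate at
  \<open>a\<close> maps \<open>K\<close> onto the integers, and \<open>L\<close> is the preimage of
  the multiples of \<open>p\<close>. For \<open>p = 0\<close> this reads: a vanishing coordinate has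
  infinite index.\<close>

lemma subgroup_index_coordinate:
  fixes K L :: "('a \<Rightarrow>\<^sub>0 int) set"
  assumes K: "subgroup_set K" and a: "frag_of a \<in> K"
    and L: "L = {x\<in>K. p dvd Poly_Mapping.lookup x a}"
  shows "subgroup_set L" "subgroup_index K L = nat \<bar>p\<bar>"
proof -
  let ?f = "\<lambda>x :: 'a \<Rightarrow>\<^sub>0 int. Poly_Mapping.lookup x a"
  show Ls: "subgroup_set L"
    unfolding L using K by (auto simp: subgroup_set_def lookup_minus)
  have ak: "frag_cmul k (frag_of a) \<in> K" for k by (rule subgroup_set_cmul[OF K a])
  have fK: "?f ` K = UNIV"
  proof -
    have "k \<in> ?f ` K" for k by (rule image_eqI[OF _ ak[of k]]) simp
    then show ?thesis by auto
  qed
  have fL: "?f ` L = range ((*) p)"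
  proof
    show "?f ` L \<subseteq> range ((*) p)" by (auto simp: L)
    have "p * k \<in> ?f ` L" for k
      by (rule image_eqI[of _ _ "frag_cmul (p * k) (frag_of a)"]) (auto simp: L ak)
    then show "range ((*) p) \<subseteq> ?f ` L" by auto
  qed
  have "subgroup_index K L = subgroup_index (?f ` K) (?f ` L)"
  proof (rule subgroup_index_image[symmetric])
    show "subgroup_set (?f ` L)"
      unfolding fL by (auto simp: subgroup_set_def image_iff) (metis right_diff_distrib)
    show "x \<in> L" if "x \<in> K" "?f x \<in> ?f ` L" for x
      using that unfolding fL by (auto simp: L)
  qed (use K Ls in \<open>auto simp: L lookup_minus\<close>)
  then show "subgroup_index K L = nat \<bar>p\<bar>" unfolding fK fL by (simp add: subgroup_index_int)
qed

lemma subgroup_index_divisible_coordinates: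
  assumes fin: "finite Q" and Q: "Q \<subseteq> T"
  shows "subgroup_set {x \<in> free_part T. \<forall>i\<in>Q. p dvd Poly_Mapping.lookup x i} \<and>
    subgroup_index (free_part T) {x \<in> free_part T. \<forall>i\<in>Q. p dvd Poly_Mapping.lookup x i} = nat \<bar>p\<bar> ^ card Q"
  using fin Q
proof (induction Q rule: finite_induct)
  case empty
  then show ?case using subgroup_index_self[OF free_part_subgroup, of T] free_part_subgroup[of T] by simp
next
  case (insert a Q)
  let ?H = "\<lambda>Q. {x \<in> free_part T. \<forall>i\<in>Q. p dvd Poly_Mapping.lookup x i}"
  have IH: "subgroup_set (?H Q)" "subgroup_index (free_part T) (?H Q) = nat \<bar>p\<bar> ^ card Q"
    using insert by auto
  have eq: "?H (insert a Q) = {x \<in> ?H Q. p dvd Poly_Mapping.lookup x a}" by auto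
  have "frag_of a \<in> ?H Q" using insert by (auto simp: free_part_def)
  note step = subgroup_index_coordinate[OF IH(1) this eq]
  have "subgroup_index (free_part T) (?H (insert a Q))
      = subgroup_index (free_part T) (?H Q) * subgroup_index (?H Q) (?H (insert a Q))"
    by (rule subgroup_index_tower[OF step(1) IH(1) free_part_subgroup]) auto
  then show ?case using step IH insert.hyps by simp
qed

text \<open>Independence makes \<open>frag_extend v\<close> an isomorphism from
  \<open>free_part T\<close> onto the span, so the claim reduces to unit vectors. There, scaling
  those in \<open>Q\<close> by \<open>p\<close> asks the coordinates in \<open>Q\<close> to be
  divisible by \<open>p\<close>.\<close>

lemma subgroup_index_scaled_span:
  assumes fin: "finite T" and ind: "independent_family T v" and Q: "Q \<subseteq> T"
  shows "subgroup_index (lattice_span T v) (lattice_span T (\<lambda>i. if i \<in> Q then frag_cmul p (v i) else v i))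
    = nat \<bar>p\<bar> ^ card Q"
proof -
  let ?H = "{x \<in> free_part T. \<forall>i\<in>Q. p dvd Poly_Mapping.lookup x i}"
  let ?w = "\<lambda>i. if i \<in> Q then frag_cmul p (frag_of i) else frag_of i"
  have H: "subgroup_set ?H" "subgroup_index (free_part T) ?H = nat \<bar>p\<bar> ^ card Q"
    using subgroup_index_divisible_coordinates[of Q T p] fin Q finite_subset by auto
  have "?H = lattice_span T ?w"
  proof
    show "lattice_span T ?w \<subseteq> ?H"
      by (rule lattice_span_least[OF H(1)]) (auto simp: free_part_iff)
    show "?H \<subseteq> lattice_span T ?w"
    proof
      fix x assume x: "x \<in> ?H"
      then have "x = lincomb T (Poly_Mapping.lookup x) frag_of" using free_part_expansion[OF fin] by simp
      \<comment> \<open>For \<open>p = 0\<close> divisibility says that the coordinate is 0, so the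
        default value of \<open>div\<close> does no harm.\<close>
      also have "\<dots> = lincomb T (\<lambda>i. if i \<in> Q then Poly_Mapping.lookup x i div p else Poly_Mapping.lookup x i) ?w"
        unfolding lincomb_def using x by (intro sum.cong) auto
      finally show "x \<in> lattice_span T ?w" unfolding lattice_span_def by (rule ssubst) (rule rangeI)
    qed
  qed
  then have "frag_extend v ` ?H = lattice_span T (\<lambda>i. frag_extend v (?w i))"
    by (simp only: frag_extend_lattice_span)
  also have "\<dots> = lattice_span T (\<lambda>i. if i \<in> Q then frag_cmul p (v i) else v i)"
    by (rule lattice_span_cong) (simp add: frag_extend_cmul)
  finally have img: "frag_extend v ` ?H = lattice_span T (\<lambda>i. if i \<in> Q then frag_cmul p (v i) else v i)" .
  have "subgroup_index (frag_extend v ` free_part T) (frag_extend v ` ?H) = subgroup_index (free_part T) ?H"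
  proof (rule subgroup_index_image)
    show "frag_extend v (x - y) = frag_extend v x - frag_extend v y" for x y by (rule frag_extend_diff)
    show "x \<in> ?H" if x: "x \<in> free_part T" and fx: "frag_extend v x \<in> frag_extend v ` ?H" for x
    proof -
      obtain y where y: "y \<in> ?H" "frag_extend v x = frag_extend v y" using fx by (rule imageE) auto
      then have "frag_extend v (x - y) = 0" by (simp add: frag_extend_diff)
      moreover have "x - y \<in> free_part T" using x y subgroup_setD(2)[OF free_part_subgroup] by blast
      ultimately have "x - y = 0" using ind independent_family_kernel[OF fin] by blast
      then show ?thesis using y by simp
    qed
  qed (use H free_part_subgroup frag_extend_image_subgroup[OF H(1)] in auto)
  then show ?thesis using H(2) unfolding img frag_extend_free_part[OF fin] by simp
qed

text \<open>Let \<open>E\<close> be the identity with row \<open>a\<close> replaced by a relation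
  \<open>c\<close> between the rows of \<open>M\<close>. Then \<open>E\<close> times
  \<open>M\<close> has a zero row, so its determinant, \<open>c a\<close> times that of
  \<open>M\<close>, vanishes.\<close>

lemma independent_rows:
  fixes M :: "'a \<Rightarrow> 'a \<Rightarrow> int"
  assumes fin: "finite S" and nz: "minor S M \<noteq> 0"
  shows "independent_family S (\<lambda>i. lincomb S (M i) frag_of)"
  unfolding independent_family_def
proof (intro allI impI ballI)
  fix c a assume c: "lincomb S c (\<lambda>i. lincomb S (M i) frag_of) = 0" and a: "a \<in> S"
  define E :: "'a \<Rightarrow> 'a \<Rightarrow> int" where "E i j = (if i = a then c j else if i = j then 1 else 0)" for i j
  have rel: "(\<Sum>i\<in>S. c i * M i j) = 0" if "j \<in> S" for j
    using arg_cong[OF c, of "\<lambda>x. Poly_Mapping.lookup x j"] that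
    by (simp add: lookup_lincomb[of S c] lookup_lincomb_frag_of[OF fin])
  have "minor S E * minor S M = minor S (\<lambda>i j. \<Sum>k\<in>S. E i k * M k j)"
    by (rule minor_mult[OF fin, symmetric])
  also have "\<dots> = 0"
    unfolding minor_def
  proof (intro sum.neutral ballI)
    fix p assume "p \<in> {p. p permutes S}"
    then have "p a \<in> S" using a by (simp add: permutes_in_image)
    then have "(\<Sum>k\<in>S. E a k * M k (p a)) = 0" using rel by (simp add: E_def)
    then have "(\<Prod>i\<in>S. \<Sum>k\<in>S. E i k * M k (p i)) = 0" using a fin by (intro prod_zero) auto
    then show "of_int (sign p) * (\<Prod>i\<in>S. \<Sum>k\<in>S. E i k * M k (p i)) = 0" by simp
  qed
  finally have "minor S E = 0" using nz by simp
  moreover have "minor (insert a (S - {a})) E = E a a * minor (S - {a}) E"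
    using fin by (intro minor_insert_zero_column) (auto simp: E_def)
  moreover have "minor (S - {a}) E = 1"
  proof -
    have "minor (S - {a}) E = minor (S - {a}) (\<lambda>i j. if i = j then 1 else 0)"
      by (rule minor_cong) (auto simp: E_def)
    then show ?thesis using minor_identity[of "S - {a}"] fin by simp
  qed
  ultimately show "c a = 0" using a by (simp add: insert_absorb E_def)
qed

lemma lattice_span_permute:
  assumes "finite S" "q permutes S"
  shows "lattice_span S (\<lambda>i. v (q i)) = lattice_span S v"
proof -
  have sub: "lattice_span S (\<lambda>i. v (q i)) \<subseteq> lattice_span S v" if "q permutes S" for q and v :: "'a \<Rightarrow> 'b \<Rightarrow>\<^sub>0 int"
    using that by (intro lattice_span_least lattice_span_subgroup lattice_span_base assms(1)) (simp add: permutes_in_image)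
  have "lattice_span S (\<lambda>i. v (q (inv_into UNIV q i))) \<subseteq> lattice_span S (\<lambda>i. v (q i))"
    using sub[OF permutes_inv[OF assms(2)], of "\<lambda>i. v (q i)"] .
  then show ?thesis using sub[OF assms(2), of v] by (simp add: permutes_inverses[OF assms(2)])
qed

text \<open>Both sides vanish when the rows are dependent, because \<open>subgroup_index\<close> is \<open>0\<close> for infinite
  indices. Condensation on a nonzero pivot \<open>p\<close> multiplies both sides by \<open>p ^ card S\<close>, so no
  Euclidean algorithm is needed.\<close>

theorem subgroup_index_row_lattice:
  fixes M :: "'a \<Rightarrow> 'a \<Rightarrow> int"
  assumes "finite S"
  shows "subgroup_index (free_part S) (lattice_span S (\<lambda>i. lincomb S (M i) frag_of)) = nat \<bar>minor S M\<bar>"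
  using assms
proof (induction S arbitrary: M rule: finite_induct)
  case empty
  have "free_part {} = {0 :: 'a \<Rightarrow>\<^sub>0 int}" by (auto simp: free_part_def)
  moreover have "lattice_span {} (\<lambda>i. lincomb {} (M i) frag_of) = {0 :: 'a \<Rightarrow>\<^sub>0 int}"
    by (auto simp: lattice_span_def lincomb_def)
  moreover have "subgroup_set {0 :: 'a \<Rightarrow>\<^sub>0 int}" by (simp add: subgroup_set_def)
  ultimately show ?case using subgroup_index_self by (simp add: minor_def)
next
  case (insert a S)
  let ?T = "insert a S"
  have finT: "finite ?T" using insert by simp
  have rows_in: "lattice_span ?T (\<lambda>i. lincomb ?T (N i) frag_of) \<subseteq> free_part ?T" for N :: "'a \<Rightarrow> 'a \<Rightarrow> int"
    using finT by (intro lattice_span_least free_part_subgroup) (auto simp: free_part_iff lookup_lincomb_frag_of)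
  have pivot: "subgroup_index (free_part ?T) (lattice_span ?T (\<lambda>i. lincomb ?T (M i) frag_of)) = nat \<bar>minor ?T M\<bar>"
    if p: "M a a \<noteq> 0" for M
  proof -
    let ?p = "M a a"
    let ?v = "\<lambda>i. lincomb ?T (M i) frag_of"
    let ?N = "\<lambda>i j. ?p * M i j - M i a * M a j"
    let ?u = "\<lambda>i. lincomb S (?N i) frag_of"
    let ?w = "\<lambda>i. if i = a then ?v a else ?u i"
    let ?s = "\<lambda>i. if i \<in> S then frag_cmul ?p (?v i) else ?v i"
    \<comment> \<open>\<open>?L2\<close> is generated by row \<open>a\<close> and the condensed rows
      \<open>?u\<close>. Its index is computed twice: through \<open>?H\<close>, where the
      coordinate at \<open>a\<close> is a multiple of the pivot, and through \<open>?L\<close>, in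
      which \<open>?L2\<close> is generated by row \<open>a\<close> and the pivot multiples of the
      other rows.\<close>
    let ?L = "lattice_span ?T ?v" and ?L2 = "lattice_span ?T ?w"
    let ?H = "{x \<in> free_part ?T. ?p dvd Poly_Mapping.lookup x a}"
    note H = subgroup_index_coordinate[OF free_part_subgroup[of ?T], of a ?H ?p]
    have aT: "frag_of a \<in> free_part ?T" by (simp add: free_part_def)
    have lv: "Poly_Mapping.lookup (?v i) j = (if j \<in> ?T then M i j else 0)" for i j
      by (rule lookup_lincomb_frag_of[OF finT])
    have lu: "Poly_Mapping.lookup (?u i) j = (if j \<in> S then ?N i j else 0)" for i j
      by (rule lookup_lincomb_frag_of[OF insert.hyps(1)])
    have u: "?u i = frag_cmul ?p (?v i) - frag_cmul (M i a) (?v a)" for i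
      by (rule poly_mapping_eqI) (auto simp: lookup_minus lv lu)
    have L2E: "\<exists>k y. y \<in> lattice_span S ?u \<and> x = frag_cmul k (?v a) + y" if x: "x \<in> ?L2" for x
    proof -
      obtain k y where ky: "y \<in> lattice_span S ?w" "x = frag_cmul k (?w a) + y"
        using lattice_span_insertE[OF insert.hyps x] .
      moreover have "lattice_span S ?w = lattice_span S ?u"
        using insert.hyps by (intro lattice_span_cong) auto
      ultimately show ?thesis by (intro exI[of _ k] exI[of _ y]) simp
    qed
    have va: "?v a \<in> ?L2" using lattice_span_base[OF finT, of a ?w] by simp
    have uL2: "lattice_span S ?u \<subseteq> ?L2"
    proof (rule lattice_span_least[OF lattice_span_subgroup])
      fix i assume i: "i \<in> S"
      then have "?w i \<in> ?L2" by (intro lattice_span_base[OF finT]) simp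
      moreover have "?w i = ?u i" using i insert.hyps by auto
      ultimately show "?u i \<in> ?L2" by (simp only:)
    qed
    have uS: "lattice_span S ?u \<subseteq> free_part S"
      by (rule lattice_span_least[OF free_part_subgroup]) (simp add: free_part_iff lu)
    have "?L2 \<subseteq> ?H"
      by (rule lattice_span_least[OF H(1)[OF aT refl]]) (use insert.hyps in \<open>auto simp: free_part_iff lv lu\<close>)
    then have "subgroup_index (free_part ?T) ?L2 = subgroup_index (free_part ?T) ?H * subgroup_index ?H ?L2"
      by (intro subgroup_index_tower[OF lattice_span_subgroup H(1)[OF aT refl] free_part_subgroup]) auto
    \<comment> \<open>Subtracting a multiple of row \<open>a\<close> clears the coordinate at
      \<open>a\<close>. Conversely, an element of \<open>?L2\<close> with that coordinate 0 uses row
      \<open>a\<close> with coefficient 0, since the pivot is nonzero.\<close>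
    also have "subgroup_index ?H ?L2 = subgroup_index (free_part S) (lattice_span S ?u)"
    proof (rule subgroup_index_second_iso[OF lattice_span_subgroup lattice_span_subgroup free_part_subgroup])
      show "free_part S \<subseteq> ?H" using insert.hyps by (auto simp: free_part_iff)
      show "\<exists>y\<in>free_part S. x - y \<in> ?L2" if x: "x \<in> ?H" for x
      proof -
        obtain k where k: "Poly_Mapping.lookup x a = ?p * k" using x by auto
        have "x - frag_cmul k (?v a) \<in> free_part S"
          using x k by (auto simp: free_part_iff lookup_minus lv)
        moreover have "x - (x - frag_cmul k (?v a)) \<in> ?L2"
          using subgroup_set_cmul[OF lattice_span_subgroup va] by simp
        ultimately show ?thesis by blast
      qed
      show "?L2 \<inter> free_part S = lattice_span S ?u"
      proof
        show "?L2 \<inter> free_part S \<subseteq> lattice_span S ?u"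
        proof
          fix x assume x: "x \<in> ?L2 \<inter> free_part S"
          then obtain k y where ky: "y \<in> lattice_span S ?u" "x = frag_cmul k (?v a) + y" using L2E by blast
          have "Poly_Mapping.lookup x a = 0" "Poly_Mapping.lookup y a = 0"
            using x ky uS insert.hyps by (auto simp: free_part_iff)
          then have "k * ?p = 0" using ky(2) by (simp add: lookup_add lv)
          then show "x \<in> lattice_span S ?u" using ky p by simp
        qed
      qed (use uL2 uS in auto)
    qed
    also have "\<dots> = nat \<bar>minor S ?N\<bar>" by (rule insert.IH)
    also have "subgroup_index (free_part ?T) ?H = nat \<bar>?p\<bar>" by (rule H(2)[OF aT refl])
    also have "nat \<bar>?p\<bar> * nat \<bar>minor S ?N\<bar> = nat \<bar>?p * minor S ?N\<bar>" by (simp add: abs_mult nat_mult_distrib)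
    also have "?p * minor S ?N = ?p ^ card S * minor ?T M" by (rule minor_condensation[OF insert.hyps, symmetric])
    also have "nat \<bar>\<dots>\<bar> = nat \<bar>?p\<bar> ^ card S * nat \<bar>minor ?T M\<bar>"
      by (simp add: abs_mult nat_mult_distrib power_abs nat_power_eq)
    finally have 1: "subgroup_index (free_part ?T) ?L2 = nat \<bar>?p\<bar> ^ card S * nat \<bar>minor ?T M\<bar>" .
    have "?L2 = lattice_span ?T ?s"
    proof
      have s: "?s i \<in> lattice_span ?T ?s" if "i \<in> ?T" for i by (rule lattice_span_base[OF finT that])
      have sa: "?v a \<in> lattice_span ?T ?s" using s[of a] insert.hyps by simp
      show "?L2 \<subseteq> lattice_span ?T ?s"
      proof (rule lattice_span_least[OF lattice_span_subgroup])
        fix i assume i: "i \<in> ?T"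
        show "?w i \<in> lattice_span ?T ?s"
        proof (cases "i = a")
          case False
          then have "frag_cmul ?p (?v i) \<in> lattice_span ?T ?s" using s[OF i] i by simp
          then have "?u i \<in> lattice_span ?T ?s"
            unfolding u by (intro subgroup_setD(2)[OF lattice_span_subgroup]
                subgroup_set_cmul[OF lattice_span_subgroup sa])
          then show ?thesis using False by simp
        qed (use sa in simp)
      qed
      show "lattice_span ?T ?s \<subseteq> ?L2"
      proof (rule lattice_span_least[OF lattice_span_subgroup])
        fix i assume i: "i \<in> ?T"
        show "?s i \<in> ?L2"
        proof (cases "i = a")
          case False
          then have "i \<in> S" using i by simp
          then have "?u i \<in> ?L2" using uL2 lattice_span_base[OF insert.hyps(1), of i ?u] by blast
          then have "?u i + frag_cmul (M i a) (?v a) \<in> ?L2"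
            by (intro subgroup_setD(4)[OF lattice_span_subgroup]
                subgroup_set_cmul[OF lattice_span_subgroup va])
          then have "frag_cmul ?p (?v i) \<in> ?L2" unfolding u by simp
          then show ?thesis using \<open>i \<in> S\<close> by simp
        qed (use va insert.hyps in simp)
      qed
    qed
    note L2s = this
    have sL: "lattice_span ?T ?s \<subseteq> ?L"
    proof (rule lattice_span_least[OF lattice_span_subgroup])
      fix i assume i: "i \<in> ?T"
      have "?v i \<in> ?L" by (rule lattice_span_base[OF finT i])
      then show "?s i \<in> ?L" using subgroup_set_cmul[OF lattice_span_subgroup, of "?v i" ?T ?v ?p] by simp
    qed
    have 2: "subgroup_index (free_part ?T) ?L2 = subgroup_index (free_part ?T) ?L * subgroup_index ?L ?L2"
      by (rule subgroup_index_tower[OF lattice_span_subgroup lattice_span_subgroup free_part_subgroup])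
        (use sL L2s rows_in in auto)
    show ?thesis
    proof (cases "minor ?T M = 0")
      \<comment> \<open>Here \<open>?L2\<close> has infinite index. Since its index in
        \<open>?L\<close> is finite, that of \<open>?L\<close> must be infinite as well; only
        torsion is needed, which dependent rows still provide.\<close>
      case True
      have "torsion_over ?L (lattice_span ?T ?s)"
      proof (rule torsion_over_lattice_span[OF lattice_span_subgroup])
        fix i assume i: "i \<in> ?T"
        have si: "?s i \<in> lattice_span ?T ?s" by (rule lattice_span_base[OF finT i])
        show "\<exists>k. k \<noteq> 0 \<and> frag_cmul k (?v i) \<in> lattice_span ?T ?s"
        proof (cases "i \<in> S")
          case True
          then show ?thesis using si p by (intro exI[of _ ?p]) simp
        next
          case False
          then show ?thesis using si by (intro exI[of _ 1]) simp
        qed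
      qed
      then have "subgroup_index ?L ?L2 \<noteq> 0"
        unfolding L2s by (rule subgroup_index_nonzero[OF finT lattice_span_subgroup])
      then show ?thesis using 1 2 True by simp
    next
      case False
      have "subgroup_index ?L ?L2 = nat \<bar>?p\<bar> ^ card S"
        unfolding L2s using independent_rows[OF finT False]
        by (intro subgroup_index_scaled_span[OF finT]) auto
      then show ?thesis using 1 2 p by simp
    qed
  qed
  show ?case
  proof (cases "\<exists>i\<in>?T. M i a \<noteq> 0")
    case True
    then obtain i where i: "i \<in> ?T" "M i a \<noteq> 0" by blast
    \<comment> \<open>Exchanging two rows moves a nonzero entry of column \<open>a\<close> to the
      pivot position; the lattice and the absolute value of the minor are unchanged.\<close>
    let ?q = "Transposition.transpose a i"
    have q: "?q permutes ?T" using i by (intro permutes_swap_id) auto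
    have "\<bar>minor ?T (\<lambda>i j. M (?q i) j)\<bar> = \<bar>minor ?T M\<bar>"
      unfolding minor_permute_rows[OF finT q] by (simp add: abs_mult sign_def)
    moreover have "lattice_span ?T (\<lambda>i. lincomb ?T (M (?q i)) frag_of) = lattice_span ?T (\<lambda>i. lincomb ?T (M i) frag_of)"
      by (rule lattice_span_permute[OF finT q])
    ultimately show ?thesis using pivot[of "\<lambda>i. M (?q i)"] i(2) by simp
  next
    case False
    let ?L = "lattice_span ?T (\<lambda>i. lincomb ?T (M i) frag_of)"
    \<comment> \<open>Divisibility by 0 states that the coordinate vanishes, so \<open>?H\<close>
      has infinite index and the lattice inside it does too.\<close>
    let ?H = "{x \<in> free_part ?T. 0 dvd Poly_Mapping.lookup x a}"
    have aT: "frag_of a \<in> free_part ?T" by (simp add: free_part_def)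
    note H = subgroup_index_coordinate[OF free_part_subgroup aT, of ?H 0]
    have "?L \<subseteq> ?H"
      by (rule lattice_span_least[OF H(1)[OF refl]]) (use finT False in \<open>auto simp: free_part_iff lookup_lincomb_frag_of\<close>)
    then have "subgroup_index (free_part ?T) ?L = subgroup_index (free_part ?T) ?H * subgroup_index ?H ?L"
      by (intro subgroup_index_tower[OF lattice_span_subgroup H(1)[OF refl] free_part_subgroup]) auto
    moreover have "minor ?T M = 0"
      using minor_insert_zero_column[OF insert.hyps, of M] False by auto
    ultimately show ?thesis using H(2)[OF refl] by simp
  qed
qed

section \<open>Homology of simplicial complexes\<close>

lemma simplicial_complexD:
  assumes "simplicial_complex \<Delta>"
  shows "finite \<Delta>" "F \<in> \<Delta> \<Longrightarrow> finite F" "F \<in> \<Delta> \<Longrightarrow> G \<subseteq> F \<Longrightarrow> G \<in> \<Delta>" "finite (faces i \<Delta>)"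
  using assms by (auto simp: simplicial_complex_def faces_def)

section \<open>The boundary of a boundary is zero\<close>

definition vertex_sign :: "'v::linorder set \<Rightarrow> 'v \<Rightarrow> int" where
  "vertex_sign F v = (-1) ^ (card {u \<in> F. u \<le> v} + 1)"

lemma face_boundary_altdef:
  "face_boundary F = (\<Sum>v\<in>F. frag_cmul (vertex_sign F v) (frag_of (F - {v})))"
  by (simp add: face_boundary_def vertex_sign_def)

text \<open>Deleting the smaller vertex \<open>u\<close> moves \<open>v\<close> down by one position
  and flips its sign; deleting the larger \<open>v\<close> leaves the position of \<open>u\<close>
  alone.\<close>

lemma vertex_sign_swap:
  assumes "finite F" "u \<in> F" "v \<in> F" "u < v"
  shows "vertex_sign F u * vertex_sign (F - {u}) v = - (vertex_sign F v * vertex_sign (F - {v}) u)"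
proof -
  have "{x \<in> F - {v}. x \<le> u} = {x \<in> F. x \<le> u}"
    using \<open>u < v\<close> by (auto dest: leD)
  then have 1: "vertex_sign (F - {v}) u = vertex_sign F u" by (simp add: vertex_sign_def)
  have "{x \<in> F. x \<le> v} = insert u {x \<in> F - {u}. x \<le> v}"
    using \<open>u \<in> F\<close> less_imp_le[OF \<open>u < v\<close>] by auto
  then have "card {x \<in> F. x \<le> v} = Suc (card {x \<in> F - {u}. x \<le> v})" using assms by simp
  then have 2: "vertex_sign (F - {u}) v = - vertex_sign F v" by (simp add: vertex_sign_def)
  show ?thesis unfolding 1 2 by simp
qed

theorem boundary_face_boundary:
  fixes F :: "'v::linorder set"
  assumes fin: "finite F"
  shows "boundary (face_boundary F) = 0"
proof -
  let ?P = "{(v, u). v \<in> F \<and> u \<in> F \<and> u \<noteq> v}"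
  let ?t = "\<lambda>(v, u). frag_cmul (vertex_sign F v * vertex_sign (F - {v}) u) (frag_of (F - {v} - {u}))"
  have finP: "finite ?P" by (rule finite_subset[of _ "F \<times> F"]) (use fin in auto)
  have "boundary (face_boundary F) = (\<Sum>v\<in>F. frag_cmul (vertex_sign F v) (face_boundary (F - {v})))"
    unfolding boundary_def face_boundary_altdef[of F] by (simp add: frag_extend_sum[OF fin] frag_extend_cmul o_def)
  also have "\<dots> = (\<Sum>v\<in>F. \<Sum>u\<in>F - {v}. ?t (v, u))"
    unfolding face_boundary_altdef by (simp add: frag_cmul_sum)
  also have "\<dots> = (\<Sum>x\<in>(SIGMA v:F. F - {v}). ?t x)"
    by (subst sum.Sigma) (use fin in \<open>auto simp: case_prod_unfold\<close>)
  also have "(SIGMA v:F. F - {v}) = ?P" by auto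
  finally have eq: "boundary (face_boundary F) = (\<Sum>x\<in>?P. ?t x)" .
  \<comment> \<open>Exchanging the order of the two deletions is an involution of \<open>?P\<close>
    that reverses every sign. The sum equals its own negative, so its integer coefficients are
    0.\<close>
  have "(\<Sum>x\<in>?P. ?t x) = (\<Sum>x\<in>?P. - ?t x)"
  proof (rule sum.reindex_bij_witness[of _ prod.swap prod.swap])
    fix x assume x: "x \<in> ?P"
    obtain v u where vu: "x = (v, u)" "v \<in> F" "u \<in> F" "u \<noteq> v" using x by auto
    have set: "F - {u} - {v} = F - {v} - {u}" by auto
    have "vertex_sign F u * vertex_sign (F - {u}) v = - (vertex_sign F v * vertex_sign (F - {v}) u)"
      using vertex_sign_swap[OF fin vu(3,2)] vertex_sign_swap[OF fin vu(2,3)] vu(4)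
      by (cases u v rule: linorder_cases) simp_all
    then show "- ?t (prod.swap x) = ?t x" using vu(1) set by simp
  qed auto
  then have zero: "(\<Sum>x\<in>?P. ?t x) = - (\<Sum>x\<in>?P. ?t x)" by (simp add: sum_negf)
  have "x = 0" if "x = - x" for x :: "'v set \<Rightarrow>\<^sub>0 int"
  proof (rule poly_mapping_eqI)
    fix k show "Poly_Mapping.lookup x k = Poly_Mapping.lookup 0 k"
      using arg_cong[OF that, of "\<lambda>x. Poly_Mapping.lookup x k"] by simp
  qed
  from this[OF zero] show ?thesis using eq by simp
qed

lemma face_boundary_in_free_part:
  assumes \<Delta>: "simplicial_complex \<Delta>" and F: "F \<in> faces i \<Delta>"
  shows "face_boundary F \<in> free_part (faces (i - 1) \<Delta>)"
  unfolding face_boundary_altdef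
proof (intro subgroup_set_sum free_part_subgroup subgroup_set_cmul)
  fix v assume v: "v \<in> F"
  have "finite F" using F simplicial_complexD[OF \<Delta>] by (auto simp: faces_def)
  then have "card F = Suc (card (F - {v}))" using v by (rule card.remove)
  moreover have "F - {v} \<in> \<Delta>" using F simplicial_complexD(3)[OF \<Delta>] by (auto simp: faces_def)
  ultimately show "frag_of (F - {v}) \<in> free_part (faces (i - 1) \<Delta>)"
    using F by (auto simp: free_part_def faces_def face_dim_def)
qed

section \<open>Cycles, boundaries and homology groups as additive sets\<close>

definition cycles :: "int \<Rightarrow> 'v::linorder set set \<Rightarrow> ('v set \<Rightarrow>\<^sub>0 int) set" where
  "cycles i \<Delta> = {x \<in> free_part (faces i \<Delta>). boundary x = 0}"

text \<open>Written as a span and not as an image, so that for a subcomplex with the same lower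
  skeleton only the set of generating faces changes.\<close>

definition boundaries :: "int \<Rightarrow> 'v::linorder set set \<Rightarrow> ('v set \<Rightarrow>\<^sub>0 int) set" where
  "boundaries i \<Delta> = lattice_span (faces (i + 1) \<Delta>) face_boundary"

lemma cycles_subset: "cycles i \<Delta> \<subseteq> free_part (faces i \<Delta>)"
  by (auto simp: cycles_def)

lemma boundary_diff: "boundary (x - y) = boundary x - boundary y"
  by (simp add: boundary_def frag_extend_diff)

lemma boundary_add: "boundary (x + y) = boundary x + boundary y"
  by (simp add: boundary_def frag_extend_add)

lemma boundary_frag_of [simp]: "boundary (frag_of F) = face_boundary F"
  by (simp add: boundary_def)

lemma cycles_subgroup: "subgroup_set (cycles i \<Delta>)"
  using free_part_subgroup[of "faces i \<Delta>"]
  by (auto simp: subgroup_set_def cycles_def boundary_diff) (simp add: boundary_def)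

lemma boundaries_subgroup: "subgroup_set (boundaries i \<Delta>)"
  unfolding boundaries_def by (rule lattice_span_subgroup)

lemma boundary_image_free_part:
  assumes "simplicial_complex \<Delta>"
  shows "boundary ` free_part (faces (i + 1) \<Delta>) = boundaries i \<Delta>"
  unfolding boundaries_def boundary_def
  by (rule frag_extend_free_part[OF simplicial_complexD(4)[OF assms]])

lemma face_boundary_in_cycles:
  assumes "simplicial_complex \<Delta>" "F \<in> faces (i + 1) \<Delta>"
  shows "face_boundary F \<in> cycles i \<Delta>"
  using face_boundary_in_free_part[OF assms] boundary_face_boundary[of F] assms simplicial_complexD(2)
  by (auto simp: cycles_def faces_def)

lemma boundaries_subset_cycles:
  assumes "simplicial_complex \<Delta>"
  shows "boundaries i \<Delta> \<subseteq> cycles i \<Delta>"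
  unfolding boundaries_def
  by (rule lattice_span_least[OF cycles_subgroup face_boundary_in_cycles[OF assms]])

lemma cycle_group_structure:
  assumes \<Delta>: "simplicial_complex \<Delta>"
  shows "carrier (cycle_group i \<Delta>) = cycles i \<Delta>"
    and "comm_group (cycle_group i \<Delta>)"
    and "\<And>x y. x \<otimes>\<^bsub>cycle_group i \<Delta>\<^esub> y = x + y" and "\<one>\<^bsub>cycle_group i \<Delta>\<^esub> = 0"
    and "subgroup (boundaries i \<Delta>) (cycle_group i \<Delta>)"
proof -
  let ?G = "chain_group i \<Delta>" and ?H = "chain_group (i - 1) \<Delta>"
  interpret G: comm_group ?G unfolding chain_group_def by (rule abelian_free_Abelian_group)
  interpret H: comm_group ?H unfolding chain_group_def by (rule abelian_free_Abelian_group)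
  have "boundary x \<in> free_part (faces (i - 1) \<Delta>)" if "x \<in> free_part (faces i \<Delta>)" for x
  proof -
    have "boundary x \<in> boundaries (i - 1) \<Delta>"
      using boundary_image_free_part[OF \<Delta>, of "i - 1"] that by auto
    then show ?thesis using boundaries_subset_cycles[OF \<Delta>, of "i - 1"] by (auto simp: cycles_def)
  qed
  then have "boundary \<in> hom ?G ?H"
    by (intro homI) (auto simp: chain_group_def boundary_add free_part_def)
  then interpret h: group_hom ?G ?H boundary by unfold_locales
  have ker: "kernel ?G ?H boundary = cycles i \<Delta>"
    by (auto simp: kernel_def cycles_def chain_group_def free_part_def)
  have sub: "subgroup (cycles i \<Delta>) ?G" using h.subgroup_kernel unfolding ker .
  then show carr: "carrier (cycle_group i \<Delta>) = cycles i \<Delta>"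
    unfolding cycle_group_def ker by (rule subgroup.carrier_subgroup_generated_subgroup)
  show comm: "comm_group (cycle_group i \<Delta>)"
    unfolding cycle_group_def by (rule G.abelian_subgroup_generated) (rule G.comm_group_axioms)
  show mult: "x \<otimes>\<^bsub>cycle_group i \<Delta>\<^esub> y = x + y" and one: "\<one>\<^bsub>cycle_group i \<Delta>\<^esub> = 0" for x y
    by (simp_all add: cycle_group_def chain_group_def)
  interpret C: comm_group "cycle_group i \<Delta>" by (rule comm)
  show "subgroup (boundaries i \<Delta>) (cycle_group i \<Delta>)"
  proof (rule C.subgroupI)
    fix x assume x: "x \<in> boundaries i \<Delta>"
    then have "- x \<in> cycles i \<Delta>" "x \<in> cycles i \<Delta>"
      using boundaries_subset_cycles[OF \<Delta>, of i] subgroup_setD(3)[OF cycles_subgroup] by auto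
    then have "inv\<^bsub>cycle_group i \<Delta>\<^esub> x = - x" by (intro C.inv_equality) (simp_all add: mult one carr)
    then show "inv\<^bsub>cycle_group i \<Delta>\<^esub> x \<in> boundaries i \<Delta>"
      using subgroup_setD(3)[OF boundaries_subgroup x] by simp
  qed (use boundaries_subset_cycles[OF \<Delta>, of i] subgroup_setD[OF boundaries_subgroup[of i \<Delta>]] in
      \<open>auto simp: carr mult\<close>)
qed

lemma reduced_homology_altdef:
  assumes "simplicial_complex \<Delta>"
  shows "reduced_homology i \<Delta> = cycle_group i \<Delta> Mod boundaries i \<Delta>"
proof -
  have "carrier (chain_group (i + 1) \<Delta>) = free_part (faces (i + 1) \<Delta>)"
    by (auto simp: chain_group_def free_part_def)
  then show ?thesis by (simp add: reduced_homology_def boundary_image_free_part[OF assms])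
qed

lemma reduced_homology_comm_group:
  assumes "simplicial_complex \<Delta>"
  shows "comm_group (reduced_homology i \<Delta>)"
  unfolding reduced_homology_altdef[OF assms]
  using cycle_group_structure[OF assms, of i] by (intro comm_group.abelian_FactGroup)

definition homology_class :: "int \<Rightarrow> 'v::linorder set set \<Rightarrow> ('v set \<Rightarrow>\<^sub>0 int) \<Rightarrow> ('v set \<Rightarrow>\<^sub>0 int) set" where
  "homology_class i \<Delta> x = (+) x ` boundaries i \<Delta>"

lemma homology_class_eq_coset:
  assumes "simplicial_complex \<Delta>"
  shows "homology_class i \<Delta> x = boundaries i \<Delta> #>\<^bsub>cycle_group i \<Delta>\<^esub> x"
  by (auto simp: homology_class_def r_coset_def cycle_group_structure(3)[OF assms] add.commute)

lemma carrier_reduced_homology: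
  assumes "simplicial_complex \<Delta>"
  shows "carrier (reduced_homology i \<Delta>) = homology_class i \<Delta> ` cycles i \<Delta>"
  unfolding reduced_homology_altdef[OF assms]
  by (auto simp: carrier_FactGroup homology_class_eq_coset[OF assms] cycle_group_structure(1)[OF assms])

lemma homology_order_eq_index:
  assumes "simplicial_complex \<Delta>"
  shows "homology_order i \<Delta> = subgroup_index (cycles i \<Delta>) (boundaries i \<Delta>)"
  unfolding homology_order_def Coset.order_def carrier_reduced_homology[OF assms] subgroup_index_def
  by (simp add: homology_class_def)

text \<open>The group is not empty, so its \<open>card\<close> can be 0 only by being
  infinite.\<close>

lemma finite_carrier_reduced_homology_iff:
  assumes "simplicial_complex \<Delta>"
  shows "finite (carrier (reduced_homology i \<Delta>)) \<longleftrightarrow> homology_order i \<Delta> \<noteq> 0"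
  using subgroup_setD(1)[OF cycles_subgroup[of i \<Delta>]]
  by (auto simp: homology_order_def Coset.order_def carrier_reduced_homology[OF assms] card_eq_0_iff)

lemma homology_class_eq_iff: "homology_class i \<Delta> x = homology_class i \<Delta> y \<longleftrightarrow> x - y \<in> boundaries i \<Delta>"
  unfolding homology_class_def by (rule coset_eq_iff[OF boundaries_subgroup])

lemma independent_of_independent_mod:
  assumes "\<forall>c. lincomb C c (\<lambda>x. x) \<in> boundaries i \<Delta> \<longrightarrow> (\<forall>x\<in>C. c x = 0)"
  shows "independent_family C (\<lambda>x. x)"
  using assms subgroup_setD(1)[OF boundaries_subgroup[of i \<Delta>]] by (auto simp: independent_family_def)

section \<open>Betti numbers through cycles independent modulo boundaries\<close>

context
  fixes \<Delta> :: "'v::linorder set set" and i :: int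
  assumes \<Delta>: "simplicial_complex \<Delta>"
begin

interpretation C: comm_group "cycle_group i \<Delta>" by (rule cycle_group_structure(2)[OF \<Delta>])
interpretation H: comm_group "reduced_homology i \<Delta>" by (rule reduced_homology_comm_group[OF \<Delta>])
interpretation N: normal "boundaries i \<Delta>" "cycle_group i \<Delta>"
  by (rule C.subgroup_imp_normal[OF cycle_group_structure(5)[OF \<Delta>]])

lemma homology_class_closed: "x \<in> cycles i \<Delta> \<Longrightarrow> homology_class i \<Delta> x \<in> carrier (reduced_homology i \<Delta>)"
  by (simp add: carrier_reduced_homology[OF \<Delta>])

lemma homology_class_mult:
  assumes "x \<in> cycles i \<Delta>" "y \<in> cycles i \<Delta>"
  shows "homology_class i \<Delta> x \<otimes>\<^bsub>reduced_homology i \<Delta>\<^esub> homology_class i \<Delta> y = homology_class i \<Delta> (x + y)"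
  using N.rcos_sum[of x y] assms
  by (simp add: reduced_homology_altdef[OF \<Delta>] homology_class_eq_coset[OF \<Delta>] cycle_group_structure[OF \<Delta>])

lemma one_reduced_homology: "\<one>\<^bsub>reduced_homology i \<Delta>\<^esub> = homology_class i \<Delta> 0"
  by (simp add: reduced_homology_altdef[OF \<Delta>] homology_class_def)

lemma homology_class_eq_one_iff:
  "homology_class i \<Delta> x = \<one>\<^bsub>reduced_homology i \<Delta>\<^esub> \<longleftrightarrow> x \<in> boundaries i \<Delta>"
  by (simp add: one_reduced_homology homology_class_eq_iff)

lemma homology_class_pow:
  assumes "x \<in> cycles i \<Delta>"
  shows "homology_class i \<Delta> x [^]\<^bsub>reduced_homology i \<Delta>\<^esub> (k :: int) = homology_class i \<Delta> (frag_cmul k x)"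
proof -
  have nat: "homology_class i \<Delta> x [^]\<^bsub>reduced_homology i \<Delta>\<^esub> n = homology_class i \<Delta> (frag_cmul (int n) x)" for n :: nat
  proof (induction n)
    case (Suc n)
    have "frag_cmul (int (Suc n)) x = frag_cmul (int n) x + x"
      using frag_cmul_distrib[of "int n" 1 x] by (simp add: add.commute)
    then show ?case
      using Suc homology_class_mult[OF subgroup_set_cmul[OF cycles_subgroup assms] assms, of "int n"] by simp
  qed (simp add: one_reduced_homology)
  show ?thesis
  proof (cases "k \<ge> 0")
    case True
    then show ?thesis using nat[of "nat k"] int_pow_int[of "reduced_homology i \<Delta>" "homology_class i \<Delta> x" "nat k"] by simp
  next
    case False
    let ?y = "frag_cmul (- k) x"
    have y: "?y \<in> cycles i \<Delta>" "- ?y \<in> cycles i \<Delta>"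
      using subgroup_set_cmul[OF cycles_subgroup assms] by simp_all
    have "homology_class i \<Delta> x [^]\<^bsub>reduced_homology i \<Delta>\<^esub> k
       = inv\<^bsub>reduced_homology i \<Delta>\<^esub> (homology_class i \<Delta> x [^]\<^bsub>reduced_homology i \<Delta>\<^esub> (- k))"
      using H.int_pow_neg[OF homology_class_closed[OF assms], of "- k"] by simp
    also have "homology_class i \<Delta> x [^]\<^bsub>reduced_homology i \<Delta>\<^esub> (- k) = homology_class i \<Delta> ?y"
      using nat[of "nat (- k)"] int_pow_int[of "reduced_homology i \<Delta>" "homology_class i \<Delta> x" "nat (- k)"] False by simp
    also have "inv\<^bsub>reduced_homology i \<Delta>\<^esub> \<dots> = homology_class i \<Delta> (- ?y)"
      using y homology_class_mult[OF y(2,1)]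
      by (intro H.inv_equality homology_class_closed) (simp_all only: one_reduced_homology add.left_inverse)
    finally show ?thesis by simp
  qed
qed

lemma finprod_homology_class:
  assumes "finite I" "\<And>j. j \<in> I \<Longrightarrow> f j \<in> cycles i \<Delta>"
  shows "finprod (reduced_homology i \<Delta>) (\<lambda>j. homology_class i \<Delta> (f j)) I = homology_class i \<Delta> (\<Sum>j\<in>I. f j)"
  using assms
proof (induction I rule: finite_induct)
  case (insert a I)
  then have "finprod (reduced_homology i \<Delta>) (\<lambda>j. homology_class i \<Delta> (f j)) (insert a I)
     = homology_class i \<Delta> (f a) \<otimes>\<^bsub>reduced_homology i \<Delta>\<^esub> homology_class i \<Delta> (\<Sum>j\<in>I. f j)"
    by (subst H.finprod_insert) (auto intro: homology_class_closed)
  also have "\<dots> = homology_class i \<Delta> (f a + (\<Sum>j\<in>I. f j))"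
    using insert.prems by (intro homology_class_mult subgroup_set_sum[OF cycles_subgroup]) auto
  finally show ?case using insert.hyps by simp
qed (simp add: one_reduced_homology)

text \<open>Sets of classes are traded for sets of representing cycles of the same size;
  group-theoretic independence becomes independence modulo boundaries. This makes
  \<open>abelian_rank\<close> accessible to the lattice lemmas.\<close>

lemma int_independent_cards:
  "{card B |B. int_independent (reduced_homology i \<Delta>) B} =
   {card C |C. finite C \<and> C \<subseteq> cycles i \<Delta> \<and>
      (\<forall>c. lincomb C c (\<lambda>x. x) \<in> boundaries i \<Delta> \<longrightarrow> (\<forall>x\<in>C. c x = 0))}"
  (is "?L = ?R")
proof -
  have transfer: "int_independent (reduced_homology i \<Delta>) (homology_class i \<Delta> ` C) \<longleftrightarrow>
      (\<forall>c. lincomb C c (\<lambda>x. x) \<in> boundaries i \<Delta> \<longrightarrow> (\<forall>x\<in>C. c x = 0))"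
    if C: "finite C" "C \<subseteq> cycles i \<Delta>" and inj: "inj_on (homology_class i \<Delta>) C" for C
  proof -
    have prod: "finprod (reduced_homology i \<Delta>) (\<lambda>b. b [^]\<^bsub>reduced_homology i \<Delta>\<^esub> a b) (homology_class i \<Delta> ` C)
        = homology_class i \<Delta> (lincomb C (\<lambda>x. a (homology_class i \<Delta> x)) (\<lambda>x. x))" for a :: "_ \<Rightarrow> int"
    proof -
      have "finprod (reduced_homology i \<Delta>) (\<lambda>b. b [^]\<^bsub>reduced_homology i \<Delta>\<^esub> a b) (homology_class i \<Delta> ` C)
         = finprod (reduced_homology i \<Delta>) (\<lambda>x. homology_class i \<Delta> x [^]\<^bsub>reduced_homology i \<Delta>\<^esub> a (homology_class i \<Delta> x)) C"
        using C by (intro H.finprod_reindex[OF _ inj]) (auto intro!: H.int_pow_closed homology_class_closed)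
      also have "\<dots> = finprod (reduced_homology i \<Delta>) (\<lambda>x. homology_class i \<Delta> (frag_cmul (a (homology_class i \<Delta> x)) x)) C"
        using C by (intro H.finprod_cong') (auto simp: homology_class_pow intro!: homology_class_closed subgroup_set_cmul[OF cycles_subgroup])
      also have "\<dots> = homology_class i \<Delta> (lincomb C (\<lambda>x. a (homology_class i \<Delta> x)) (\<lambda>x. x))"
        unfolding lincomb_def using C by (intro finprod_homology_class) (auto intro!: subgroup_set_cmul[OF cycles_subgroup])
      finally show ?thesis .
    qed
    have closed: "finite (homology_class i \<Delta> ` C)" "homology_class i \<Delta> ` C \<subseteq> carrier (reduced_homology i \<Delta>)"
      using C homology_class_closed by auto
    show ?thesis
    proof
      assume ind: "int_independent (reduced_homology i \<Delta>) (homology_class i \<Delta> ` C)"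
      show "\<forall>c. lincomb C c (\<lambda>x. x) \<in> boundaries i \<Delta> \<longrightarrow> (\<forall>x\<in>C. c x = 0)"
      proof (intro allI impI ballI)
        fix c x assume c: "lincomb C c (\<lambda>x. x) \<in> boundaries i \<Delta>" and x: "x \<in> C"
        let ?a = "\<lambda>b. c (inv_into C (homology_class i \<Delta>) b)"
        have ac: "?a (homology_class i \<Delta> x) = c x" if "x \<in> C" for x using that inj by simp
        then have "lincomb C (\<lambda>x. ?a (homology_class i \<Delta> x)) (\<lambda>x. x) = lincomb C c (\<lambda>x. x)"
          by (intro lincomb_cong) auto
        then have "finprod (reduced_homology i \<Delta>) (\<lambda>b. b [^]\<^bsub>reduced_homology i \<Delta>\<^esub> ?a b) (homology_class i \<Delta> ` C)
          = \<one>\<^bsub>reduced_homology i \<Delta>\<^esub>"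
          unfolding prod homology_class_eq_one_iff using c by simp
        then have "\<forall>b\<in>homology_class i \<Delta> ` C. ?a b = 0"
          using ind unfolding int_independent_def by (elim conjE allE impE)
        then show "c x = 0" using ac[OF x] x by auto
      qed
    next
      assume *: "\<forall>c. lincomb C c (\<lambda>x. x) \<in> boundaries i \<Delta> \<longrightarrow> (\<forall>x\<in>C. c x = 0)"
      show "int_independent (reduced_homology i \<Delta>) (homology_class i \<Delta> ` C)"
        unfolding int_independent_def prod homology_class_eq_one_iff
      proof (intro conjI allI impI closed)
        fix a assume "lincomb C (\<lambda>x. a (homology_class i \<Delta> x)) (\<lambda>x. x) \<in> boundaries i \<Delta>"
        then show "\<forall>b\<in>homology_class i \<Delta> ` C. a b = 0"
          using *[THEN spec, of "\<lambda>x. a (homology_class i \<Delta> x)"] by auto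
      qed
    qed
  qed
  show "?L = ?R"
  proof
    show "?L \<subseteq> ?R"
    proof
      fix n assume "n \<in> ?L"
      then obtain B where B: "int_independent (reduced_homology i \<Delta>) B" "n = card B" by blast
      have fB: "finite B" "B \<subseteq> homology_class i \<Delta> ` cycles i \<Delta>"
        using B(1) by (auto simp: int_independent_def carrier_reduced_homology[OF \<Delta>])
      obtain C where C: "C \<subseteq> cycles i \<Delta>" "B = homology_class i \<Delta> ` C" "inj_on (homology_class i \<Delta>) C"
        using fB(2) subset_image_inj[of B "homology_class i \<Delta>" "cycles i \<Delta>"] by auto
      have "finite C" using fB(1) C(2,3) finite_imageD by blast
      then show "n \<in> ?R"
        using transfer[of C] C B card_image[OF C(3)] by auto
    qed
    show "?R \<subseteq> ?L"
    proof
      fix n assume "n \<in> ?R"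
      then obtain C where C: "finite C" "C \<subseteq> cycles i \<Delta>" "n = card C"
        "\<forall>c. lincomb C c (\<lambda>x. x) \<in> boundaries i \<Delta> \<longrightarrow> (\<forall>x\<in>C. c x = 0)" by blast
      \<comment> \<open>Two cycles in one class would give a relation modulo boundaries with
        coefficients 1 and -1. Hence no element is lost in passing to classes.\<close>
      have inj: "inj_on (homology_class i \<Delta>) C"
      proof (rule inj_onI, rule ccontr)
        fix x y assume xy: "x \<in> C" "y \<in> C" "homology_class i \<Delta> x = homology_class i \<Delta> y" "x \<noteq> y"
        let ?c = "\<lambda>z. (if z = x then 1 else 0) - (if z = y then 1 else 0) :: int"
        have "lincomb C ?c (\<lambda>x. x) \<in> boundaries i \<Delta>"
          using xy C(1) by (simp add: lincomb_diff lincomb_single homology_class_eq_iff)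
        then have "\<forall>z\<in>C. ?c z = 0" using C(4) by (elim allE impE)
        then show False using xy by (auto dest: bspec[of _ _ x])
      qed
      show "n \<in> ?L"
        using transfer[OF C(1,2) inj] C(4) card_image[OF inj] C(3)
        by (intro CollectI exI[of _ "homology_class i \<Delta> ` C"]) simp
    qed
  qed
qed

text \<open>\<open>abelian_rank\<close> is a \<open>Max\<close>, which says something only about a
  finite set; the number of faces supplies the bound.\<close>

lemma betti_bounded:
  assumes "finite C" "C \<subseteq> cycles i \<Delta>"
    "\<forall>c. lincomb C c (\<lambda>x. x) \<in> boundaries i \<Delta> \<longrightarrow> (\<forall>x\<in>C. c x = 0)"
  shows "card C \<le> card (faces i \<Delta>)" "card C \<le> betti i \<Delta>"
proof -
  have bound: "card C \<le> card (faces i \<Delta>)"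
    if C: "finite C" "C \<subseteq> cycles i \<Delta>"
      "\<forall>c. lincomb C c (\<lambda>x. x) \<in> boundaries i \<Delta> \<longrightarrow> (\<forall>x\<in>C. c x = 0)" for C
  proof (rule independent_family_card_le[OF simplicial_complexD(4)[OF \<Delta>] C(1) _ independent_of_independent_mod[OF C(3)]])
    show "x \<in> lattice_span (faces i \<Delta>) frag_of" if "x \<in> C" for x
      using that C(2) unfolding lattice_span_frag_of[OF simplicial_complexD(4)[OF \<Delta>]] by (auto simp: cycles_def)
  qed
  then show "card C \<le> card (faces i \<Delta>)" using assms .
  let ?R = "{card C |C. finite C \<and> C \<subseteq> cycles i \<Delta> \<and>
      (\<forall>c. lincomb C c (\<lambda>x. x) \<in> boundaries i \<Delta> \<longrightarrow> (\<forall>x\<in>C. c x = 0))}"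
  have "finite ?R" by (rule finite_subset[of _ "{..card (faces i \<Delta>)}"]) (use bound in auto)
  moreover have "card C \<in> ?R" using assms by blast
  ultimately show "card C \<le> betti i \<Delta>"
    unfolding betti_def abelian_rank_def int_independent_cards by (rule Max_ge)
qed

text \<open>A cycle none of whose nonzero multiples bounds would by itself be an independent family
  of size 1.\<close>

lemma betti_zero_imp_torsion:
  assumes "betti i \<Delta> = 0"
  shows "torsion_over (cycles i \<Delta>) (boundaries i \<Delta>)"
  unfolding torsion_over_def
proof (intro ballI, rule ccontr)
  fix x assume x: "x \<in> cycles i \<Delta>" and no: "\<not> (\<exists>k. k \<noteq> 0 \<and> frag_cmul k x \<in> boundaries i \<Delta>)"
  have "card {x} \<le> betti i \<Delta>"
    by (rule betti_bounded(2)) (use x no in \<open>auto simp: lincomb_def\<close>)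
  then show False using assms by simp
qed

lemma betti_eq_rank:
  assumes "boundaries i \<Delta> = {0}" "has_rank (cycles i \<Delta>) n"
  shows "betti i \<Delta> = n"
  unfolding betti_def abelian_rank_def int_independent_cards assms(1)
proof (rule Max_eqI)
  let ?R = "{card C |C. finite C \<and> C \<subseteq> cycles i \<Delta> \<and>
      (\<forall>c. lincomb C c (\<lambda>x. x) \<in> {0} \<longrightarrow> (\<forall>x\<in>C. c x = 0))}"
  show le: "k \<le> n" if "k \<in> ?R" for k
    using that assms(2) by (auto simp: has_rank_def independent_family_def)
  show "finite ?R" by (rule finite_subset[of _ "{..n}"]) (use le in auto)
  show "n \<in> ?R" using assms(2) by (auto simp: has_rank_def independent_family_def)
qed

end

section \<open>Spanning trees and minors of the boundary map\<close>

lemma faces_skeleton: "faces i (skeleton k \<Delta>) = (if i \<le> k then faces i \<Delta> else {})"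
  by (auto simp: faces_def skeleton_def)

lemma simplicial_complex_skeleton:
  assumes "simplicial_complex \<Delta>"
  shows "simplicial_complex (skeleton k \<Delta>)"
  unfolding simplicial_complex_def
proof (intro conjI ballI allI impI)
  show "finite (skeleton k \<Delta>)"
    by (rule finite_subset[OF _ simplicial_complexD(1)[OF assms]]) (auto simp: skeleton_def)
  fix F assume F: "F \<in> skeleton k \<Delta>"
  then have F': "F \<in> \<Delta>" "face_dim F \<le> k" by (auto simp: skeleton_def)
  show fin: "finite F" by (rule simplicial_complexD(2)[OF assms F'(1)])
  fix G assume G: "G \<subseteq> F"
  have "card G \<le> card F" by (rule card_mono[OF fin G])
  then show "G \<in> skeleton k \<Delta>"
    using F' simplicial_complexD(3)[OF assms F'(1) G] by (simp add: skeleton_def face_dim_def)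
qed

lemma faces_union_skeleton:
  assumes "J \<subseteq> faces k \<Delta>"
  shows "faces i (J \<union> skeleton (k - 1) \<Delta>) = (if i < k then faces i \<Delta> else if i = k then J else {})"
  using assms by (auto simp: faces_def skeleton_def)

lemma simplicial_complex_union_skeleton:
  assumes \<Delta>: "simplicial_complex \<Delta>" and J: "J \<subseteq> faces k \<Delta>"
  shows "simplicial_complex (J \<union> skeleton (k - 1) \<Delta>)"
  unfolding simplicial_complex_def
proof (intro conjI ballI allI impI)
  note skel = simplicial_complex_skeleton[OF \<Delta>, of "k - 1"]
  show "finite (J \<union> skeleton (k - 1) \<Delta>)"
    using finite_subset[OF J simplicial_complexD(4)[OF \<Delta>]] simplicial_complexD(1)[OF skel] by simp
  fix F assume F: "F \<in> J \<union> skeleton (k - 1) \<Delta>"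
  have F': "F \<in> \<Delta>" "face_dim F \<le> k" using F J by (auto simp: skeleton_def faces_def)
  show fin: "finite F" by (rule simplicial_complexD(2)[OF \<Delta> F'(1)])
  fix G assume G: "G \<subseteq> F"
  show "G \<in> J \<union> skeleton (k - 1) \<Delta>"
  proof (cases "G = F")
    case False
    then have "card G < card F" using G fin by (intro psubset_card_mono) auto
    then have "face_dim G \<le> k - 1" using F'(2) by (simp add: face_dim_def)
    then show ?thesis using simplicial_complexD(3)[OF \<Delta> F'(1) G] by (simp add: skeleton_def)
  qed (use F in simp)
qed

lemma reduced_homology_cong:
  assumes "faces (i - 1) \<Delta> = faces (i - 1) \<Delta>'" "faces i \<Delta> = faces i \<Delta>'" "faces (i + 1) \<Delta> = faces (i + 1) \<Delta>'"
  shows "reduced_homology i \<Delta> = reduced_homology i \<Delta>'"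
  unfolding reduced_homology_def cycle_group_def chain_group_def assms ..

text \<open>Up to dimension k-1 the complex has all faces of \<open>\<Delta>\<close>, hence the same
  (k-1)-cycles; only its boundaries are reduced to those of \<open>J\<close>.\<close>

lemma homology_order_union_skeleton:
  assumes \<Delta>: "simplicial_complex \<Delta>" and J: "J \<subseteq> faces k \<Delta>"
  shows "homology_order (k - 1) (J \<union> skeleton (k - 1) \<Delta>)
    = subgroup_index (cycles (k - 1) \<Delta>) (lattice_span J face_boundary)"
  unfolding homology_order_eq_index[OF simplicial_complex_union_skeleton[OF assms]]
  by (simp add: cycles_def boundaries_def faces_union_skeleton[OF J])

text \<open>The rank of the boundary map on k-faces. The k-skeleton has no (k+1)-faces, so its k-th
  Betti number is the rank of the group of k-cycles. When \<open>betti (k - 1)\<close> vanishes,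
  this is the number of k-faces that a tree must have.\<close>

definition face_rank :: "int \<Rightarrow> 'v::linorder set set \<Rightarrow> nat" where
  "face_rank k \<Delta> = card (faces k \<Delta>) - betti k (skeleton k \<Delta>)"

section \<open>Ranks of the boundary maps and spanning trees\<close>

context
  fixes \<Delta> :: "'v::linorder set set"
  assumes \<Delta>: "simplicial_complex \<Delta>"
begin

lemma betti_skeleton:
  assumes "J \<subseteq> faces k \<Delta>" "independent_family J face_boundary"
    "torsion_over (boundaries (k - 1) \<Delta>) (lattice_span J face_boundary)"
  shows "betti k (skeleton k \<Delta>) = card (faces k \<Delta>) - card J"
proof (rule betti_eq_rank[OF simplicial_complex_skeleton[OF \<Delta>]])
  show "boundaries k (skeleton k \<Delta>) = {0}"
    by (auto simp: boundaries_def faces_skeleton lattice_span_def lincomb_def)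
  have "has_rank {x \<in> free_part (faces k \<Delta>). frag_extend face_boundary x = 0} (card (faces k \<Delta>) - card J)"
    using assms by (intro has_rank_kernel simplicial_complexD(4)[OF \<Delta>]) (auto simp: boundaries_def)
  then show "has_rank (cycles k (skeleton k \<Delta>)) (card (faces k \<Delta>) - card J)"
    by (simp add: cycles_def faces_skeleton boundary_def)
qed

lemma face_rank_eq:
  assumes "J \<subseteq> faces k \<Delta>" "independent_family J face_boundary"
    "torsion_over (boundaries (k - 1) \<Delta>) (lattice_span J face_boundary)"
  shows "face_rank k \<Delta> = card J"
  unfolding face_rank_def betti_skeleton[OF assms]
  using card_mono[OF simplicial_complexD(4)[OF \<Delta>] assms(1)] by simp

lemma maximal_independent_faces:
  assumes "J0 \<subseteq> faces k \<Delta>" "independent_family J0 face_boundary"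
  obtains J where "J0 \<subseteq> J" "J \<subseteq> faces k \<Delta>" "independent_family J face_boundary"
    "torsion_over (boundaries (k - 1) \<Delta>) (lattice_span J face_boundary)" "card J = face_rank k \<Delta>"
proof -
  obtain J where J: "J0 \<subseteq> J" "J \<subseteq> faces k \<Delta>" "independent_family J face_boundary"
    "torsion_over (boundaries (k - 1) \<Delta>) (lattice_span J face_boundary)"
    using maximal_independent_subfamily[OF simplicial_complexD(4)[OF \<Delta>] assms] unfolding boundaries_def
    by auto
  then show thesis using that face_rank_eq[OF J(2-4)] by simp
qed

text \<open>The subtraction of naturals in \<open>face_rank\<close> is never truncated, so it agrees
  with the integer count demanded of trees.\<close>

lemma face_rank_int:
  "int (face_rank k \<Delta>) = int (card (faces k \<Delta>)) - int (betti k (skeleton k \<Delta>))"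
proof -
  obtain J where J: "J \<subseteq> faces k \<Delta>" "independent_family J face_boundary"
    "torsion_over (boundaries (k - 1) \<Delta>) (lattice_span J face_boundary)"
    using maximal_independent_faces[OF empty_subsetI independent_family_empty] by metis
  then show ?thesis unfolding face_rank_def betti_skeleton[OF J] by auto
qed

lemma independent_card_le_face_rank:
  assumes "J \<subseteq> faces k \<Delta>" "independent_family J face_boundary"
  shows "card J \<le> face_rank k \<Delta>"
proof -
  obtain J' where J': "J \<subseteq> J'" "J' \<subseteq> faces k \<Delta>" "card J' = face_rank k \<Delta>"
    using maximal_independent_faces[OF assms] by metis
  then show ?thesis using card_mono[OF finite_subset[OF J'(2) simplicial_complexD(4)[OF \<Delta>]] J'(1)] by simp
qed

text \<open>A maximal independent subset of \<open>J\<close> already has the rank as its size, so it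
  is all of \<open>J\<close>.\<close>

lemma independent_of_torsion:
  assumes J: "J \<subseteq> faces k \<Delta>" "card J = face_rank k \<Delta>"
    and tor: "torsion_over (boundaries (k - 1) \<Delta>) (lattice_span J face_boundary)"
  shows "independent_family J face_boundary"
proof -
  have finJ: "finite J" using J(1) simplicial_complexD(4)[OF \<Delta>] finite_subset by blast
  obtain J' where J': "J' \<subseteq> J" "independent_family J' face_boundary"
    "torsion_over (lattice_span J face_boundary) (lattice_span J' face_boundary)"
    using maximal_independent_subfamily[OF finJ empty_subsetI independent_family_empty] by metis
  have "card J' = face_rank k \<Delta>"
    using J' J(1) torsion_over_trans[OF tor J'(3)] by (intro face_rank_eq[symmetric]) auto
  then have "J' = J" using J' J(2) finJ by (intro card_subset_eq) auto
  then show ?thesis using J' by simp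
qed

text \<open>The rank of the (k-1)-cycles is computed twice: as the rank of the boundaries, which
  contain a multiple of each cycle, and as a kernel by rank-nullity. This is why complements of
  trees have the size of maximal minors.\<close>

lemma face_rank_sum:
  assumes tor: "torsion_over (cycles (k - 1) \<Delta>) (boundaries (k - 1) \<Delta>)"
  shows "face_rank k \<Delta> + face_rank (k - 1) \<Delta> = card (faces (k - 1) \<Delta>)"
proof -
  obtain J where J: "J \<subseteq> faces k \<Delta>" "independent_family J face_boundary"
    "torsion_over (boundaries (k - 1) \<Delta>) (lattice_span J face_boundary)" "card J = face_rank k \<Delta>"
    using maximal_independent_faces[OF empty_subsetI independent_family_empty] by metis
  obtain U where U: "U \<subseteq> faces (k - 1) \<Delta>" "independent_family U face_boundary"
    "torsion_over (boundaries (k - 1 - 1) \<Delta>) (lattice_span U face_boundary)" "card U = face_rank (k - 1) \<Delta>"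
    using maximal_independent_faces[OF empty_subsetI independent_family_empty] by metis
  have finJ: "finite J" using J(1) simplicial_complexD(4)[OF \<Delta>] finite_subset by blast
  have "has_rank (cycles (k - 1) \<Delta>) (card J)"
  proof (rule has_rank_torsion_over[OF finJ J(2)])
    have "lattice_span J face_boundary \<subseteq> boundaries (k - 1) \<Delta>"
      unfolding boundaries_def using J(1) simplicial_complexD(4)[OF \<Delta>] by (intro lattice_span_mono) auto
    then show "lattice_span J face_boundary \<subseteq> cycles (k - 1) \<Delta>"
      using boundaries_subset_cycles[OF \<Delta>, of "k - 1"] by simp
  qed (rule torsion_over_trans[OF tor J(3)])
  moreover have "has_rank (cycles (k - 1) \<Delta>) (card (faces (k - 1) \<Delta>) - card U)"
    using has_rank_kernel[OF simplicial_complexD(4)[OF \<Delta>] U(1,2)] U(3)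
    by (simp add: cycles_def boundaries_def boundary_def)
  ultimately have "card J = card (faces (k - 1) \<Delta>) - card U" by (rule has_rank_unique)
  then show ?thesis using J(4) U(4) card_mono[OF simplicial_complexD(4)[OF \<Delta>] U(1)] by simp
qed

lemma face_boundary_nonzero:
  assumes F: "F \<in> faces k \<Delta>" and k: "k \<ge> 0"
  shows "face_boundary F \<noteq> 0"
proof -
  have fin: "finite F" using F simplicial_complexD(2)[OF \<Delta>] by (auto simp: faces_def)
  have "card F > 0" using F k by (auto simp: faces_def face_dim_def)
  then obtain v where v: "v \<in> F" by (metis card_gt_0_iff ex_in_conv)
  have "Poly_Mapping.lookup (face_boundary F) (F - {v}) = (\<Sum>u\<in>F. if u = v then vertex_sign F u else 0)"
    unfolding face_boundary_altdef lookup_sum using v by (intro sum.cong) auto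
  also have "\<dots> \<noteq> 0" using fin v by (simp add: sum.delta vertex_sign_def)
  finally show ?thesis by auto
qed

text \<open>Guarantees that a tree of dimension at least 0 has a top face, so that
  \<open>complex_dim\<close> takes the required value on it.\<close>

lemma face_rank_pos:
  assumes "F \<in> faces k \<Delta>" "k \<ge> 0"
  shows "face_rank k \<Delta> > 0"
proof -
  have "independent_family {F} face_boundary"
    using face_boundary_nonzero[OF assms] by (auto simp: independent_family_def lincomb_def)
  then show ?thesis using independent_card_le_face_rank[of "{F}" k] assms by simp
qed

text \<open>Brings trees into the form in which Cauchy--Binet supplies them: sets of faces of fixed
  size, singled out by a nonzero homology order.\<close>

lemma spanning_trees_eq:
  assumes betti: "betti (k - 1) \<Delta> = 0" and k: "k \<ge> -1" and ne: "k \<ge> 0 \<longrightarrow> faces k \<Delta> \<noteq> {}"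
  shows "spanning_trees k \<Delta> = (\<lambda>J. J \<union> skeleton (k - 1) \<Delta>) `
    {J. J \<subseteq> faces k \<Delta> \<and> card J = face_rank k \<Delta> \<and> homology_order (k - 1) (J \<union> skeleton (k - 1) \<Delta>) \<noteq> 0}"
    (is "_ = ?u ` ?S")
proof -
  have betti': "betti (k - 1) (skeleton k \<Delta>) = 0"
    unfolding betti[symmetric] betti_def
    by (intro arg_cong[of _ _ abelian_rank] reduced_homology_cong) (simp_all add: faces_skeleton)
  show ?thesis
  proof (intro equalityI subsetI)
    fix \<Upsilon> assume \<Upsilon>: "\<Upsilon> \<in> spanning_trees k \<Delta>"
    then have s: "simplicial_complex \<Upsilon>" "\<Upsilon> \<subseteq> \<Delta>" "complex_dim \<Upsilon> = k" "skeleton (k - 1) \<Upsilon> = skeleton (k - 1) \<Delta>"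
      "finite (carrier (reduced_homology (k - 1) \<Upsilon>))"
      "int (card (faces k \<Upsilon>)) = int (card (faces k \<Delta>)) - int (betti k (skeleton k \<Delta>))"
      by (auto simp: spanning_trees_def betti')
    have "face_dim F \<le> k" if "F \<in> \<Upsilon>" for F
      using that s(3) simplicial_complexD(1)[OF s(1)] unfolding complex_dim_def by (metis Max_ge finite_imageI finite_insert imageI insertCI)
    then have "\<Upsilon> = faces k \<Upsilon> \<union> skeleton (k - 1) \<Upsilon>" by (fastforce simp: faces_def skeleton_def)
    then have eq: "\<Upsilon> = ?u (faces k \<Upsilon>)" using s(4) by simp
    moreover have "faces k \<Upsilon> \<in> ?S"
      using s eq finite_carrier_reduced_homology_iff[OF s(1), of "k - 1"] face_rank_int[of k]
      by (auto simp: faces_def)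
    ultimately show "\<Upsilon> \<in> ?u ` ?S" by (rule image_eqI)
  next
    fix \<Upsilon> assume "\<Upsilon> \<in> ?u ` ?S"
    then obtain J where J: "J \<subseteq> faces k \<Delta>" "card J = face_rank k \<Delta>" "homology_order (k - 1) (?u J) \<noteq> 0"
      "\<Upsilon> = ?u J" by auto
    note sc = simplicial_complex_union_skeleton[OF \<Delta> J(1)]
    \<comment> \<open>Finite homology in degree k-1 makes the boundaries of \<open>J\<close> span
      rationally; having as many generators as the rank, they are independent, so \<open>J\<close>
      supports no nonzero k-cycle and the top homology is trivial.\<close>
    have "torsion_over (cycles (k - 1) \<Delta>) (lattice_span J face_boundary)"
      using J(3) unfolding homology_order_union_skeleton[OF \<Delta> J(1)]
      by (intro torsion_over_of_index cycles_subgroup lattice_span_subgroup)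
    then have "independent_family J face_boundary"
      using J(1,2) torsion_over_mono[OF boundaries_subset_cycles[OF \<Delta>]] by (intro independent_of_torsion)
    then have "cycles k (?u J) = {0}"
      using independent_family_kernel[OF finite_subset[OF J(1) simplicial_complexD(4)[OF \<Delta>]], of face_boundary]
        subgroup_setD(1)[OF cycles_subgroup[of k "?u J"]]
      by (auto simp: cycles_def faces_union_skeleton[OF J(1)] boundary_def)
    then have triv: "trivial_group (reduced_homology k (?u J))"
      using comm_group.axioms(2)[OF reduced_homology_comm_group[OF sc]]
      by (simp add: trivial_group_def carrier_reduced_homology[OF sc] one_reduced_homology[OF sc])
    have dim: "complex_dim (?u J) = k"
      unfolding complex_dim_def
    proof (rule Max_eqI)
      show "finite (insert (-1) (face_dim ` ?u J))" using simplicial_complexD(1)[OF sc] by simp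
      show "y \<le> k" if "y \<in> insert (-1) (face_dim ` ?u J)" for y
        using that k J(1) by (auto simp: faces_def skeleton_def)
      show "k \<in> insert (-1) (face_dim ` ?u J)"
      \<comment> \<open>For \<open>k = -1\<close> the tree is the void complex, whose dimension is
        the inserted -1.\<close>
      proof (cases "k \<ge> 0")
        case True
        then have "card J > 0" using ne face_rank_pos J(2) by fastforce
        then obtain F where "F \<in> J" by (metis card_gt_0_iff ex_in_conv)
        then have "face_dim F = k" "F \<in> ?u J" using J(1) by (auto simp: faces_def)
        then show ?thesis by force
      qed (use k in simp)
    qed
    have "skeleton (k - 1) (?u J) = skeleton (k - 1) \<Delta>"
      using J(1) by (auto simp: skeleton_def faces_def)
    moreover have "?u J \<subseteq> \<Delta>" using J(1) by (auto simp: faces_def skeleton_def)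
    ultimately show "\<Upsilon> \<in> spanning_trees k \<Delta>"
      using sc triv dim J finite_carrier_reduced_homology_iff[OF sc, of "k - 1"] face_rank_int[of k]
      by (simp add: spanning_trees_def betti' faces_union_skeleton[OF J(1)])
  qed
qed

text \<open>The sum may run over all face sets of the right size, since those that are not trees
  have infinite homology and weight 0.\<close>

lemma sum_spanning_trees:
  fixes w :: "'v set set \<Rightarrow> 'r::semiring_1"
  assumes "betti (k - 1) \<Delta> = 0" "k \<ge> -1" "k \<ge> 0 \<longrightarrow> faces k \<Delta> \<noteq> {}"
  shows "(\<Sum>\<Upsilon>\<in>spanning_trees k \<Delta>. of_nat ((homology_order (k - 1) \<Upsilon>)\<^sup>2) * w (faces k \<Upsilon>))
    = (\<Sum>J | J \<subseteq> faces k \<Delta> \<and> card J = face_rank k \<Delta>.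
        of_nat ((homology_order (k - 1) (J \<union> skeleton (k - 1) \<Delta>))\<^sup>2) * w J)"
proof -
  let ?u = "\<lambda>J. J \<union> skeleton (k - 1) \<Delta>"
  let ?S = "{J. J \<subseteq> faces k \<Delta> \<and> card J = face_rank k \<Delta> \<and> homology_order (k - 1) (?u J) \<noteq> 0}"
  have f: "faces k (?u J) = J" if "J \<in> ?S" for J
    using that by (simp add: faces_union_skeleton)
  have "inj_on ?u ?S" by (rule inj_on_inverseI[of _ "faces k"]) (rule f)
  then have "(\<Sum>\<Upsilon>\<in>spanning_trees k \<Delta>. of_nat ((homology_order (k - 1) \<Upsilon>)\<^sup>2) * w (faces k \<Upsilon>))
    = (\<Sum>J\<in>?S. of_nat ((homology_order (k - 1) (?u J))\<^sup>2) * w (faces k (?u J)))"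
    unfolding spanning_trees_eq[OF assms] by (rule sum.reindex[unfolded o_def])
  also have "\<dots> = (\<Sum>J\<in>?S. of_nat ((homology_order (k - 1) (?u J))\<^sup>2) * w J)"
    using f by (intro sum.cong) auto
  also have "\<dots> = (\<Sum>J | J \<subseteq> faces k \<Delta> \<and> card J = face_rank k \<Delta>.
        of_nat ((homology_order (k - 1) (?u J))\<^sup>2) * w J)"
    by (rule sum.mono_neutral_left) (use simplicial_complexD(4)[OF \<Delta>] in auto)
  finally show ?thesis .
qed

text \<open>The minor is the index, in the chain group, of the lattice generated by the boundaries of \<open>J\<close> and
  the faces in \<open>U\<close>. The intermediate lattice generated by all cycles and the faces in \<open>U\<close> splits it
  into an index of cycles modulo boundaries of \<open>J\<close> and, applying the boundary map, one of boundaries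
  modulo boundaries of \<open>U\<close>. If \<open>J\<close> or \<open>U\<close> is not a spanning tree, both sides are \<open>0\<close>, since orders of
  infinite groups are.\<close>

theorem minor_boundary_homology_orders:
  assumes J: "J \<subseteq> faces k \<Delta>" and U: "U \<subseteq> faces (k - 1) \<Delta>" "card U = face_rank (k - 1) \<Delta>"
    and g: "bij_betw g (faces (k - 1) \<Delta> - U) J"
  shows "nat \<bar>minor (faces (k - 1) \<Delta> - U) (\<lambda>i j. Poly_Mapping.lookup (face_boundary (g i)) j)\<bar>
      * homology_order (k - 2) \<Delta>
    = homology_order (k - 1) (J \<union> skeleton (k - 1) \<Delta>) * homology_order (k - 2) (U \<union> skeleton (k - 2) \<Delta>)"
proof -
  let ?N = "faces (k - 1) \<Delta>"
  let ?I = "?N - U"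
  let ?A = "lattice_span J face_boundary" and ?Z = "cycles (k - 1) \<Delta>" and ?P = "free_part U"
  let ?BU = "lattice_span U face_boundary"
  define AP where "AP = {a + p |a p. a \<in> ?A \<and> p \<in> ?P}"
  define ZP where "ZP = {z + p |z p. z \<in> ?Z \<and> p \<in> ?P}"
  have finN: "finite ?N" and finI: "finite ?I" and finU: "finite U" and finJ: "finite J"
    using simplicial_complexD(4)[OF \<Delta>] finite_subset[OF U(1)] finite_subset[OF J] by auto
  have sub: "subgroup_set {a + p |a p. a \<in> K \<and> p \<in> L}" if K: "subgroup_set K" and L: "subgroup_set L"
    for K L :: "('v set \<Rightarrow>\<^sub>0 int) set"
    unfolding subgroup_set_def
  proof (intro conjI ballI)
    show "0 \<in> {a + p |a p. a \<in> K \<and> p \<in> L}"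
      using subgroup_setD(1)[OF K] subgroup_setD(1)[OF L] by (intro CollectI exI[of _ 0]) simp
    fix x y assume "x \<in> {a + p |a p. a \<in> K \<and> p \<in> L}" "y \<in> {a + p |a p. a \<in> K \<and> p \<in> L}"
    then obtain a p b q where "x = a + p" "y = b + q" "a \<in> K" "b \<in> K" "p \<in> L" "q \<in> L" by auto
    moreover from this have "a - b \<in> K" "p - q \<in> L"
      by (auto intro: subgroup_setD(2)[OF K] subgroup_setD(2)[OF L])
    ultimately show "x - y \<in> {a + p |a p. a \<in> K \<and> p \<in> L}"
      by (intro CollectI exI[of _ "a - b"] exI[of _ "p - q"]) simp
  qed
  have APs: "subgroup_set AP" unfolding AP_def by (intro sub lattice_span_subgroup free_part_subgroup)
  have ZPs: "subgroup_set ZP" unfolding ZP_def by (intro sub cycles_subgroup free_part_subgroup)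
  have fbJ: "face_boundary F \<in> ?Z" if "F \<in> J" for F
    using face_boundary_in_cycles[OF \<Delta>, of F "k - 1"] that J by auto
  have AZ: "?A \<subseteq> ?Z" by (rule lattice_span_least[OF cycles_subgroup fbJ])
  have ZN: "?Z \<subseteq> free_part ?N" by (auto simp: cycles_def)
  have PN: "?P \<subseteq> free_part ?N" by (rule free_part_mono[OF U(1)])
  have APZP: "AP \<subseteq> ZP" using AZ by (auto simp: AP_def ZP_def)
  have ZPN: "ZP \<subseteq> free_part ?N"
    using ZN PN by (auto simp: ZP_def intro!: subgroup_setD(4)[OF free_part_subgroup])
  have PAP: "p \<in> AP" if "p \<in> ?P" for p
    using that subgroup_setD(1)[OF lattice_span_subgroup] unfolding AP_def
    by (intro CollectI exI[of _ 0] exI[of _ p]) simp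
  have AAP: "a \<in> AP" if "a \<in> ?A" for a
    using that subgroup_setD(1)[OF free_part_subgroup] unfolding AP_def
    by (intro CollectI exI[of _ a] exI[of _ 0]) simp

  have "subgroup_index (free_part ?N) AP
      = nat \<bar>minor ?I (\<lambda>i j. Poly_Mapping.lookup (face_boundary (g i)) j)\<bar>"
  proof -
    \<comment> \<open>Forgetting the coordinates in \<open>U\<close> has kernel \<open>?P\<close>,
      which lies in \<open>AP\<close>, so the index is preserved. The image of \<open>AP\<close> is
      the row lattice of the square matrix whose minor is wanted.\<close>
    let ?\<pi> = "\<lambda>x. lincomb ?I (Poly_Mapping.lookup x) frag_of"
    have l\<pi>: "Poly_Mapping.lookup (?\<pi> x) i = (if i \<in> ?I then Poly_Mapping.lookup x i else 0)"
      for x :: "'v set \<Rightarrow>\<^sub>0 int" and i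
      by (rule lookup_lincomb_frag_of[OF finI])
    have \<pi>diff: "?\<pi> (x - y) = ?\<pi> x - ?\<pi> y" and \<pi>add: "?\<pi> (x + y) = ?\<pi> x + ?\<pi> y" for x y :: "'v set \<Rightarrow>\<^sub>0 int"
      by (rule poly_mapping_eqI, simp add: l\<pi> lookup_minus lookup_add)+
    have \<pi>P: "?\<pi> p = 0" if "p \<in> ?P" for p
      by (rule poly_mapping_eqI) (use that in \<open>auto simp: l\<pi> free_part_iff\<close>)
    have imN: "?\<pi> ` free_part ?N = free_part ?I"
    proof
      show "?\<pi> ` free_part ?N \<subseteq> free_part ?I" by (auto simp: free_part_iff l\<pi>)
      show "free_part ?I \<subseteq> ?\<pi> ` free_part ?N"
      proof
        fix x assume x: "x \<in> free_part ?I"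
        have "x = ?\<pi> x" by (rule free_part_expansion[OF finI x])
        moreover have "x \<in> free_part ?N" using x free_part_mono[of ?I ?N] by auto
        ultimately show "x \<in> ?\<pi> ` free_part ?N" by (rule image_eqI)
      qed
    qed
    have imAP: "?\<pi> ` AP = lattice_span ?I (\<lambda>i. ?\<pi> (face_boundary (g i)))"
    proof -
      have \<pi>lin: "?\<pi> (lincomb J c face_boundary) = lincomb ?I (\<lambda>i. c (g i)) (\<lambda>i. ?\<pi> (face_boundary (g i)))" for c
      proof -
        have "?\<pi> (lincomb J c face_boundary) = lincomb J c (\<lambda>j. ?\<pi> (face_boundary j))"
          by (rule poly_mapping_eqI) (auto simp: l\<pi> lookup_lincomb[of J] intro!: sum.neutral[symmetric])
        also have "\<dots> = lincomb ?I (\<lambda>i. c (g i)) (\<lambda>i. ?\<pi> (face_boundary (g i)))"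
          unfolding lincomb_def[of J] lincomb_def[of ?I "\<lambda>i. c (g i)"] by (rule sum.reindex_bij_betw[OF g, symmetric])
        finally show ?thesis .
      qed
      show ?thesis
      proof
        show "?\<pi> ` AP \<subseteq> lattice_span ?I (\<lambda>i. ?\<pi> (face_boundary (g i)))"
        proof (rule image_subsetI)
          fix x assume "x \<in> AP"
          then obtain c p where "x = lincomb J c face_boundary + p" "p \<in> ?P"
            by (auto simp: AP_def lattice_span_def)
          then have "?\<pi> x = lincomb ?I (\<lambda>i. c (g i)) (\<lambda>i. ?\<pi> (face_boundary (g i)))"
            by (simp only: \<pi>add \<pi>P \<pi>lin add_0_right)
          then show "?\<pi> x \<in> lattice_span ?I (\<lambda>i. ?\<pi> (face_boundary (g i)))"
            unfolding lattice_span_def by (rule ssubst) (rule rangeI)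
        qed
        show "lattice_span ?I (\<lambda>i. ?\<pi> (face_boundary (g i))) \<subseteq> ?\<pi> ` AP"
        proof
          fix y assume "y \<in> lattice_span ?I (\<lambda>i. ?\<pi> (face_boundary (g i)))"
          then obtain c where y: "y = lincomb ?I c (\<lambda>i. ?\<pi> (face_boundary (g i)))" unfolding lattice_span_def by (rule rangeE)
          let ?c = "\<lambda>j. c (inv_into ?I g j)"
          have "y = lincomb ?I (\<lambda>i. ?c (g i)) (\<lambda>i. ?\<pi> (face_boundary (g i)))"
            unfolding y by (rule lincomb_cong) (simp_all add: inv_into_f_f[OF bij_betw_imp_inj_on[OF g]])
          then have "y = ?\<pi> (lincomb J ?c face_boundary)" using \<pi>lin[of ?c] by simp
          moreover have "lincomb J ?c face_boundary \<in> AP" by (rule AAP) (simp add: lattice_span_def)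
          ultimately show "y \<in> ?\<pi> ` AP" by (rule image_eqI)
        qed
      qed
    qed
    have "subgroup_index (?\<pi> ` free_part ?N) (?\<pi> ` AP) = subgroup_index (free_part ?N) AP"
    proof (rule subgroup_index_image[OF \<pi>diff free_part_subgroup APs])
      show "subgroup_set (?\<pi> ` AP)" unfolding imAP by (rule lattice_span_subgroup)
      show "AP \<subseteq> free_part ?N" using APZP ZPN by simp
      fix x assume x: "x \<in> free_part ?N" "?\<pi> x \<in> ?\<pi> ` AP"
      then obtain y where y: "y \<in> AP" "?\<pi> x = ?\<pi> y" by (elim imageE)
      have "x - y \<in> free_part ?N" using x(1) y(1) APZP ZPN by (intro subgroup_setD(2)[OF free_part_subgroup]) auto
      moreover have "Poly_Mapping.lookup (x - y) i = 0" if "i \<in> ?I" for i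
        using arg_cong[OF y(2), of "\<lambda>x. Poly_Mapping.lookup x i"] that by (simp add: l\<pi> lookup_minus)
      ultimately have "x - y \<in> ?P" unfolding free_part_iff by blast
      then have "x - y + y \<in> AP" by (intro subgroup_setD(4)[OF APs PAP y(1)])
      then show "x \<in> AP" by simp
    qed
    then show ?thesis
      unfolding imN imAP using subgroup_index_row_lattice[OF finI, of "\<lambda>i. Poly_Mapping.lookup (face_boundary (g i))"]
      by simp
  qed
  moreover have "subgroup_index (free_part ?N) AP = subgroup_index (free_part ?N) ZP * subgroup_index ZP AP"
    by (rule subgroup_index_tower[OF APs ZPs free_part_subgroup APZP ZPN])
  moreover have ZPidx: "subgroup_index (free_part ?N) ZP = subgroup_index (boundaries (k - 2) \<Delta>) ?BU"
  proof -
    have imN: "boundary ` free_part ?N = boundaries (k - 2) \<Delta>"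
      using boundary_image_free_part[OF \<Delta>, of "k - 2"] by (simp add: algebra_simps)
    have imP: "boundary ` ?P = ?BU" unfolding boundary_def by (rule frag_extend_free_part[OF finU])
    have "boundary ` ZP = boundary ` ?P"
    proof
      show "boundary ` ZP \<subseteq> boundary ` ?P"
        by (auto simp: ZP_def boundary_add cycles_def)
      have "?P \<subseteq> ZP"
      proof
        fix p assume "p \<in> ?P"
        then show "p \<in> ZP" using PAP APZP by blast
      qed
      then show "boundary ` ?P \<subseteq> boundary ` ZP" by (rule image_mono)
    qed
    then have imZP: "boundary ` ZP = ?BU" using imP by simp
    have "subgroup_index (boundary ` free_part ?N) (boundary ` ZP) = subgroup_index (free_part ?N) ZP"
    proof (rule subgroup_index_image[OF boundary_diff free_part_subgroup ZPs])
      show "subgroup_set (boundary ` ZP)" unfolding imZP by (rule lattice_span_subgroup)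
      fix x assume x: "x \<in> free_part ?N" "boundary x \<in> boundary ` ZP"
      have "boundary x \<in> boundary ` ?P" using x(2) unfolding imZP imP .
      then obtain p where p: "p \<in> ?P" "boundary x = boundary p" by (elim imageE)
      have "x - p \<in> ?Z"
        using subgroup_setD(2)[OF free_part_subgroup x(1)] p PN by (auto simp: cycles_def boundary_diff)
      then show "x \<in> ZP" using p(1) unfolding ZP_def by (intro CollectI exI[of _ "x - p"] exI[of _ p]) simp
    qed (rule ZPN)
    then show ?thesis unfolding imN imZP by simp
  qed
  \<comment> \<open>The common factor stays on both sides. If it is nonzero, then \<open>U\<close>
    is independent, no nonzero chain on \<open>U\<close> is a cycle, and \<open>ZP\<close> modulo
    \<open>AP\<close> has the same index as \<open>?Z\<close> modulo \<open>?A\<close>; if it is 0,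
    nothing has to be compared.\<close>
  moreover have "subgroup_index (boundaries (k - 2) \<Delta>) ?BU * subgroup_index ZP AP
     = subgroup_index (boundaries (k - 2) \<Delta>) ?BU * subgroup_index ?Z ?A"
  proof (cases "subgroup_index (boundaries (k - 2) \<Delta>) ?BU = 0")
    case False
    then have "torsion_over (boundaries (k - 2) \<Delta>) ?BU"
      by (intro torsion_over_of_index boundaries_subgroup lattice_span_subgroup)
    then have "independent_family U face_boundary"
      using independent_of_torsion[OF U] by (simp add: algebra_simps)
    then have PZ: "p = 0" if "p \<in> ?P" "boundary p = 0" for p
      using that independent_family_kernel[OF finU, of face_boundary] by (simp add: boundary_def)
    have "subgroup_index ZP AP = subgroup_index ?Z ?A"
    proof (rule subgroup_index_second_iso[OF APs lattice_span_subgroup cycles_subgroup])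
      show "?Z \<subseteq> ZP"
        using subgroup_setD(1)[OF free_part_subgroup[of U]] unfolding ZP_def by (force intro: exI[of _ 0])
      show "\<exists>y\<in>?Z. x - y \<in> AP" if "x \<in> ZP" for x
        using that PAP by (auto simp: ZP_def intro!: bexI)
      show "AP \<inter> ?Z = ?A"
      proof
        show "AP \<inter> ?Z \<subseteq> ?A"
        proof
          fix x assume x: "x \<in> AP \<inter> ?Z"
          then obtain a p where ap: "x = a + p" "a \<in> ?A" "p \<in> ?P" by (auto simp: AP_def)
          have "boundary p = 0" using x ap AZ by (auto simp: cycles_def boundary_add)
          then show "x \<in> ?A" using PZ[OF ap(3)] ap by simp
        qed
        show "?A \<subseteq> AP \<inter> ?Z" using AAP AZ by auto
      qed
    qed
    then show ?thesis by simp
  qed simp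
  ultimately have det: "nat \<bar>minor ?I (\<lambda>i j. Poly_Mapping.lookup (face_boundary (g i)) j)\<bar>
     = subgroup_index (boundaries (k - 2) \<Delta>) ?BU * subgroup_index ?Z ?A" by simp
  have BU: "?BU \<subseteq> boundaries (k - 2) \<Delta>"
    unfolding boundaries_def using finN U(1) by (intro lattice_span_mono) (simp_all add: algebra_simps)
  \<comment> \<open>Here the homology of the whole complex enters: the minor sees the boundaries of
    \<open>U\<close> only relative to all boundaries, whereas the homology of the subcomplex
    compares them with all cycles.\<close>
  have "homology_order (k - 2) (U \<union> skeleton (k - 2) \<Delta>) = subgroup_index (cycles (k - 2) \<Delta>) ?BU"
    using homology_order_union_skeleton[OF \<Delta> U(1)] by (simp add: algebra_simps)
  also have "\<dots> = homology_order (k - 2) \<Delta> * subgroup_index (boundaries (k - 2) \<Delta>) ?BU"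
    unfolding homology_order_eq_index[OF \<Delta>]
    by (rule subgroup_index_tower[OF lattice_span_subgroup boundaries_subgroup cycles_subgroup BU
          boundaries_subset_cycles[OF \<Delta>]])
  finally show ?thesis unfolding det homology_order_union_skeleton[OF \<Delta> J] by simp
qed

end

section \<open>The weighted Laplacian\<close>

lemma minor_hom:
  fixes h :: "'r::comm_ring_1 \<Rightarrow> 's::comm_ring_1" and M :: "'a \<Rightarrow> 'a \<Rightarrow> 'r"
  assumes "\<And>x y. h (x + y) = h x + h y" "\<And>x y. h (x * y) = h x * h y" "h 0 = 0" "h 1 = 1" "\<And>x. h (- x) = - h x"
  shows "minor S (\<lambda>i j. h (M i j)) = h (minor S M)"
proof -
  have sum: "h (sum f A) = (\<Sum>x\<in>A. h (f x))" for f and A :: "('a \<Rightarrow> 'a) set"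
    by (induction A rule: infinite_finite_induct) (simp_all add: assms)
  have prod: "h (prod f A) = (\<Prod>x\<in>A. h (f x))" for f and A :: "'a set"
    by (induction A rule: infinite_finite_induct) (simp_all add: assms)
  have sign: "h (of_int (sign p)) = of_int (sign p)" for p :: "'a \<Rightarrow> 'a"
    by (simp add: sign_def assms)
  show ?thesis unfolding minor_def by (simp add: sum prod assms(2) sign)
qed

lemma char_poly_eq_sum_minors:
  fixes A :: "'r::comm_ring_1 mat"
  assumes A: "A \<in> carrier_mat n n"
  shows "char_poly A
    = (\<Sum>T\<in>Pow {0..<n}. monom ((-1) ^ card T * minor T (\<lambda>i j. A $$ (i, j))) (n - card T))"
proof -
  have "char_poly A = minor {0..<n} (\<lambda>i j. char_poly_matrix A $$ (i, j))"
    unfolding char_poly_def by (rule det_eq_minor) (use A in simp)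
  also have "\<dots> = minor {0..<n} (\<lambda>i j. (if i = j then [:0, 1:] else 0) + [:- A $$ (i, j):])"
    using A by (intro minor_cong) (auto simp: char_poly_matrix_def)
  also have "\<dots> = (\<Sum>T\<in>Pow {0..<n}. [:0, 1:] ^ card ({0..<n} - T) * minor T (\<lambda>i j. [:- A $$ (i, j):]))"
    by (rule minor_diagonal_plus) simp
  also have "\<dots> = (\<Sum>T\<in>Pow {0..<n}. monom ((-1) ^ card T * minor T (\<lambda>i j. A $$ (i, j))) (n - card T))"
  proof (rule sum.cong[OF refl])
    fix T assume T: "T \<in> Pow {0..<n}"
    have "card ({0..<n} - T) = n - card T" using T finite_subset[of T "{0..<n}"] by (simp add: card_Diff_subset)
    moreover have "[:0, 1:] ^ m = (monom 1 m :: 'r poly)" for m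
      by (induction m) (simp_all add: monom_Suc)
    moreover have "minor T (\<lambda>i j. [:- A $$ (i, j):]) = [:minor T (\<lambda>i j. (-1) * A $$ (i, j)):]"
      by (subst minor_hom[where h = "\<lambda>x. [:x:]", symmetric]) simp_all
    moreover have "minor T (\<lambda>i j. (-1) * A $$ (i, j)) = (-1) ^ card T * minor T (\<lambda>i j. A $$ (i, j))"
      by (subst minor_scale_rows) simp
    ultimately show "[:0, 1:] ^ card ({0..<n} - T) * minor T (\<lambda>i j. [:- A $$ (i, j):])
      = monom ((-1) ^ card T * minor T (\<lambda>i j. A $$ (i, j))) (n - card T)"
      by (simp add: smult_monom)
  qed
  finally show ?thesis .
qed

lemma coeff_char_poly:
  assumes "A \<in> carrier_mat n n" "m \<le> n"
  shows "coeff (char_poly A) (n - m)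
    = (-1) ^ m * (\<Sum>T | T \<subseteq> {0..<n} \<and> card T = m. minor T (\<lambda>i j. A $$ (i, j)))"
proof -
  have le: "card T \<le> n" if "T \<in> Pow {0..<n}" for T
    using that card_mono[of "{0..<n}" T] by simp
  have "coeff (char_poly A) (n - m)
     = (\<Sum>T\<in>Pow {0..<n}. if card T = m then (-1) ^ m * minor T (\<lambda>i j. A $$ (i, j)) else 0)"
    unfolding char_poly_eq_sum_minors[OF assms(1)] coeff_sum
  proof (intro sum.cong refl)
    fix T assume "T \<in> Pow {0..<n}"
    then have "n - card T = n - m \<longleftrightarrow> card T = m" using le[of T] assms(2) by linarith
    then show "coeff (monom ((-1) ^ card T * minor T (\<lambda>i j. A $$ (i, j))) (n - card T)) (n - m)
      = (if card T = m then (-1) ^ m * minor T (\<lambda>i j. A $$ (i, j)) else 0)"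
      by (simp add: coeff_monom)
  qed
  also have "\<dots> = (\<Sum>T\<in>{T \<in> Pow {0..<n}. card T = m}. (-1) ^ m * minor T (\<lambda>i j. A $$ (i, j)))"
    by (rule sum.inter_filter[symmetric]) simp
  also have "{T \<in> Pow {0..<n}. card T = m} = {T. T \<subseteq> {0..<n} \<and> card T = m}" by auto
  finally show ?thesis by (simp add: sum_distrib_left)
qed

text \<open>Vieta's formula after splitting off the roots equal to 0: these contribute a power of
  the variable whose exponent must be \<open>m\<close>, and the cofactor has constant term equal, up
  to sign, to the product of the other roots.\<close>

lemma prod_nonzero_roots:
  fixes p :: "'k::alg_closed_field poly"
  assumes lead: "lead_coeff p = 1" and low: "\<And>i. i < m \<Longrightarrow> coeff p i = 0" and nz: "coeff p m \<noteq> 0"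
  shows "(\<Prod>z | poly p z = 0 \<and> z \<noteq> 0. z ^ Polynomial.order z p) = (-1) ^ (degree p - m) * coeff p m"
proof -
  have p0: "p \<noteq> 0" using nz by auto
  obtain A where A: "size A = degree p" "p = smult (lead_coeff p) (\<Prod>x\<in>#A. [:- x, 1:])"
    using alg_closed_imp_factorization[OF p0] by blast
  have pA: "p = (\<Prod>x\<in>#A. [:- x, 1:])" using A(2) lead by simp
  have "proots (\<Prod>x\<in>#A. [:- x, 1:]) = A" for A :: "'k multiset"
  proof (induction A)
    case (add x A)
    have "(\<Prod>x\<in>#A. [:- x, 1:]) \<noteq> 0" by (auto simp: prod_mset_zero_iff)
    then show ?case using add by (simp add: proots_mult del: mult_pCons_left)
  qed simp
  then have ord: "Polynomial.order z p = count A z" for z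
    using count_proots[OF p0, of z] pA by metis
  define B where "B = filter_mset (\<lambda>x. x \<noteq> 0) A"
  define q where "q = (\<Prod>x\<in>#B. [:- x, 1:])"
  let ?c = "count A 0"
  have split: "A = replicate_mset ?c 0 + B"
    unfolding B_def by (rule multiset_eqI) simp
  have pq: "p = monom 1 ?c * q"
  proof -
    have "(\<Prod>x\<in>#A. [:- x, 1:]) = (\<Prod>x\<in>#replicate_mset ?c 0. [:- x, 1:]) * q"
      by (subst split) (simp add: q_def)
    also have "(\<Prod>x\<in>#replicate_mset c 0. [:- x, 1:]) = (monom 1 c :: 'k poly)" for c
      by (induction c) (simp_all add: monom_Suc)
    finally show ?thesis using pA by simp
  qed
  have "coeff (\<Prod>x\<in>#B. [:- x, 1:]) 0 = (-1) ^ size B * prod_mset B" for B :: "'k multiset"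
    by (induction B) (simp_all add: coeff_mult_0)
  then have q0: "coeff q 0 = (-1) ^ size B * prod_mset B" unfolding q_def .
  have "0 \<notin># B" by (simp add: B_def)
  then have qnz: "coeff q 0 \<noteq> 0" unfolding q0 by simp
  have coeff_p: "coeff p i = (if i < ?c then 0 else coeff q (i - ?c))" for i
    unfolding pq by (simp add: coeff_monom_mult)
  have "m = ?c"
  proof (rule antisym)
    show "?c \<le> m" using nz coeff_p[of m] by (auto split: if_splits)
    show "m \<le> ?c" using low[of ?c] coeff_p[of ?c] qnz by force
  qed
  then have cm: "coeff p m = (-1) ^ size B * prod_mset B" using coeff_p[of m] q0 by simp
  have "size A = ?c + size B" by (subst split) simp
  then have size: "degree p - m = size B" using A(1) \<open>m = ?c\<close> by simp
  have "{z. poly p z = 0 \<and> z \<noteq> 0} = set_mset B"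
  proof -
    have "poly p z = 0 \<longleftrightarrow> z \<in># A" for z
      using ord[of z] order_root[of p z] p0 by (simp add: count_eq_zero_iff)
    then show ?thesis by (auto simp: B_def)
  qed
  moreover have "Polynomial.order z p = count B z" if "z \<in># B" for z
    using that ord by (auto simp: B_def)
  ultimately have "(\<Prod>z | poly p z = 0 \<and> z \<noteq> 0. z ^ Polynomial.order z p) = (\<Prod>z\<in>set_mset B. z ^ count B z)"
    by simp
  also have "\<dots> = prod_mset B" by (rule prod_mset_multiplicity[symmetric])
  finally show ?thesis unfolding cm size by (simp add: mult.assoc[symmetric] power_mult_distrib[symmetric])
qed

text \<open>\<open>vanish\<close> and \<open>nz\<close> place the lowest nonzero coefficient of the
  characteristic polynomial in degree n-r. The sign of that coefficient and the sign in Vieta's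
  formula are both (-1) to the power r and cancel.\<close>

lemma nonzero_eigenvalue_product_eq:
  fixes A :: "'k::field mat"
  assumes A: "A \<in> carrier_mat n n" and r: "r \<le> n"
    and vanish: "\<And>T. T \<subseteq> {0..<n} \<Longrightarrow> card T > r \<Longrightarrow> minor T (\<lambda>i j. A $$ (i, j)) = 0"
    and nz: "(\<Sum>T | T \<subseteq> {0..<n} \<and> card T = r. minor T (\<lambda>i j. A $$ (i, j))) \<noteq> 0"
  shows "nonzero_eigenvalue_product A
    = to_ac (\<Sum>T | T \<subseteq> {0..<n} \<and> card T = r. minor T (\<lambda>i j. A $$ (i, j)))"
proof -
  let ?S = "\<lambda>m. \<Sum>T | T \<subseteq> {0..<n} \<and> card T = m. minor T (\<lambda>i j. A $$ (i, j))"
  let ?A = "map_mat to_ac A"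
  let ?p = "char_poly ?A"
  have A': "?A \<in> carrier_mat n n" using A by simp
  have coeff: "coeff ?p (n - m) = to_ac ((-1) ^ m * ?S m)" if "m \<le> n" for m
  proof -
    have "minor T (\<lambda>i j. ?A $$ (i, j)) = to_ac (minor T (\<lambda>i j. A $$ (i, j)))" if "T \<subseteq> {0..<n}" for T
    proof -
      have "minor T (\<lambda>i j. ?A $$ (i, j)) = minor T (\<lambda>i j. to_ac (A $$ (i, j)))"
        using that A by (intro minor_cong) (auto simp: subset_iff)
      also have "\<dots> = to_ac (minor T (\<lambda>i j. A $$ (i, j)))" by (rule minor_hom) simp_all
      finally show ?thesis .
    qed
    then have "(\<Sum>T | T \<subseteq> {0..<n} \<and> card T = m. minor T (\<lambda>i j. ?A $$ (i, j))) = to_ac (?S m)"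
      unfolding to_ac_sum by (intro sum.cong) auto
    then show ?thesis using coeff_char_poly[OF A' that] by simp
  qed
  have deg: "degree ?p = n" "lead_coeff ?p = 1" using degree_monic_char_poly[OF A'] by auto
  have "nonzero_eigenvalue_product A = (\<Prod>z | poly ?p z = 0 \<and> z \<noteq> 0. z ^ Polynomial.order z ?p)"
    by (simp add: nonzero_eigenvalue_product_def Let_def eigenvalue_root_char_poly[OF A'])
  also have "\<dots> = (-1) ^ (degree ?p - (n - r)) * coeff ?p (n - r)"
  proof (rule prod_nonzero_roots[OF deg(2)])
    show "coeff ?p (n - r) \<noteq> 0" using nz by (simp add: coeff[OF r])
    fix i assume i: "i < n - r"
    have "?S (n - i) = 0" by (intro sum.neutral ballI) (use i vanish in auto)
    then show "coeff ?p i = 0" using coeff[of "n - i"] i by simp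
  qed
  also have "\<dots> = to_ac (?S r)"
    using r deg(1) by (simp add: coeff[OF r] mult.assoc[symmetric] power_mult_distrib[symmetric])
  finally show ?thesis .
qed

section \<open>The Laplacian with faces as indices\<close>

lemma face_list:
  assumes \<Delta>: "simplicial_complex \<Delta>"
  shows "distinct (face_list i \<Delta>)" "set (face_list i \<Delta>) = faces i \<Delta>"
proof -
  have fin: "finite F" if "F \<in> faces i \<Delta>" for F
    using that simplicial_complexD(2)[OF \<Delta>] by (auto simp: faces_def)
  have finI: "finite (sorted_list_of_set ` faces i \<Delta>)" using simplicial_complexD(4)[OF \<Delta>] by simp
  show "set (face_list i \<Delta>) = faces i \<Delta>"
    using fin by (auto simp: face_list_def set_sorted_list_of_set[OF finI] image_image)
  have "inj_on set (sorted_list_of_set ` faces i \<Delta>)"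
    using fin by (auto simp: inj_on_def)
  then show "distinct (face_list i \<Delta>)"
    unfolding face_list_def by (simp add: distinct_map set_sorted_list_of_set[OF finI])
qed

definition weighted_incidence :: "'v::linorder set \<Rightarrow> 'v set \<Rightarrow> 'v weight_field" where
  "weighted_incidence G F = of_int (Poly_Mapping.lookup (face_boundary F) G) * face_var F"

definition face_laplacian :: "int \<Rightarrow> 'v::linorder set set \<Rightarrow> 'v set \<Rightarrow> 'v set \<Rightarrow> 'v weight_field" where
  "face_laplacian k \<Delta> G H = (\<Sum>F\<in>faces k \<Delta>. weighted_incidence G F * weighted_incidence H F)"

lemma weighted_laplacian_entries:
  fixes \<Delta> :: "'v::linorder set set" and k :: int
  assumes \<Delta>: "simplicial_complex \<Delta>"
  defines "xs \<equiv> face_list (k - 1) \<Delta>"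
  shows "weighted_laplacian k \<Delta> \<in> carrier_mat (length xs) (length xs)"
    and "i < length xs \<Longrightarrow> j < length xs \<Longrightarrow> weighted_laplacian k \<Delta> $$ (i, j) = face_laplacian k \<Delta> (xs ! i) (xs ! j)"
proof -
  let ?B = "weighted_boundary_matrix k \<Delta>"
  let ?ys = "face_list k \<Delta>"
  have B: "?B \<in> carrier_mat (length xs) (length ?ys)"
    by (simp add: weighted_boundary_matrix_def boundary_matrix_def xs_def)
  show "weighted_laplacian k \<Delta> \<in> carrier_mat (length xs) (length xs)"
    unfolding weighted_laplacian_def using B by simp
  have Bij: "?B $$ (i, j) = weighted_incidence (xs ! i) (?ys ! j)" if "i < length xs" "j < length ?ys" for i j
    using that by (simp add: weighted_boundary_matrix_def boundary_matrix_def xs_def weighted_incidence_def)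
  assume ij: "i < length xs" "j < length xs"
  have "weighted_laplacian k \<Delta> $$ (i, j)
      = (\<Sum>c\<in>{0..<length ?ys}. weighted_incidence (xs ! i) (?ys ! c) * weighted_incidence (xs ! j) (?ys ! c))"
    using ij B Bij by (auto simp: weighted_laplacian_def scalar_prod_def intro!: sum.cong)
  also have "\<dots> = face_laplacian k \<Delta> (xs ! i) (xs ! j)"
  proof -
    have "bij_betw ((!) ?ys) {0..<length ?ys} (faces k \<Delta>)"
      using bij_betw_nth[OF face_list(1)[OF \<Delta>, of k] refl refl] face_list(2)[OF \<Delta>, of k]
      by (simp add: atLeast0LessThan)
    then show ?thesis unfolding face_laplacian_def by (rule sum.reindex_bij_betw)
  qed
  finally show "weighted_laplacian k \<Delta> $$ (i, j) = face_laplacian k \<Delta> (xs ! i) (xs ! j)" .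
qed

lemma det_submatrix_eq_minor:
  assumes A: "A \<in> carrier_mat n n" and I: "I \<subseteq> {0..<n}"
  shows "det (submatrix A I I) = minor I (\<lambda>i j. A $$ (i, j))"
proof -
  \<comment> \<open>The position of \<open>i\<close> in the increasing enumeration of
    \<open>I\<close>, inverse to \<open>pick I\<close>.\<close>
  let ?f = "\<lambda>i. card {a \<in> I. a < i}"
  have finI: "finite I" using I finite_subset by auto
  have card: "card {i. i < n \<and> i \<in> I} = card I" by (rule arg_cong[of _ _ card]) (use I in auto)
  have S: "submatrix A I I \<in> carrier_mat (card I) (card I)"
    using A card by (intro carrier_matI) (simp_all add: dim_submatrix)
  have inj: "inj_on ?f I" by (rule inj_on_inverseI[of _ "pick I"]) (rule pick_card_in_set)
  have "?f ` I = {0..<card I}"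
  proof (rule card_subset_eq)
    show "?f ` I \<subseteq> {0..<card I}" using finI by (auto intro!: psubset_card_mono)
    show "card (?f ` I) = card {0..<card I}" by (simp add: card_image[OF inj])
  qed simp
  then have bij: "bij_betw ?f I {0..<card I}" using inj by (simp add: bij_betw_def)
  have "det (submatrix A I I) = minor {0..<card I} (\<lambda>i j. submatrix A I I $$ (i, j))"
    by (rule det_eq_minor[OF S])
  also have "\<dots> = minor I (\<lambda>i j. submatrix A I I $$ (?f i, ?f j))"
    by (rule minor_reindex[OF bij finI, symmetric])
  also have "\<dots> = minor I (\<lambda>i j. A $$ (i, j))"
    using A I by (intro minor_cong submatrix_index_card) auto
  finally show ?thesis .
qed

text \<open>Characteristic 0, which permits dividing by homology orders and keeps tree counts
  nonzero in the weight field.\<close>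

lemma weight_field_of_nat_eq_0_iff: "(of_nat n :: 'v::linorder weight_field) = 0 \<longleftrightarrow> n = 0"
proof -
  have "(of_nat n :: 'v weight_field) = to_fract (of_nat n)"
    by (induction n) simp_all
  then show ?thesis by simp
qed

text \<open>Each indeterminate is a common factor of one column. Squaring removes the sign that
  depends on the choice of \<open>g\<close>.\<close>

lemma minor_weighted_incidence_sq:
  fixes S J :: "'v::linorder set set"
  assumes fin: "finite S" and g: "bij_betw g S J"
  shows "minor S (\<lambda>i j. weighted_incidence i (g j)) * minor S (\<lambda>i j. weighted_incidence i (g j))
    = of_nat ((nat \<bar>minor S (\<lambda>i j. Poly_Mapping.lookup (face_boundary (g i)) j)\<bar>)\<^sup>2) * (\<Prod>F\<in>J. face_var F)\<^sup>2"
proof -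
  let ?m = "minor S (\<lambda>i j. Poly_Mapping.lookup (face_boundary (g i)) j)"
  have "minor S (\<lambda>i j. weighted_incidence i (g j)) = minor S (\<lambda>i j. weighted_incidence j (g i))"
    by (rule minor_transpose[OF fin, symmetric])
  also have "\<dots> = minor S (\<lambda>i j. face_var (g i) * of_int (Poly_Mapping.lookup (face_boundary (g i)) j))"
    by (intro minor_cong) (simp add: weighted_incidence_def mult.commute)
  also have "\<dots> = (\<Prod>i\<in>S. face_var (g i)) * of_int ?m"
    by (simp only: minor_scale_rows minor_of_int)
  also have "(\<Prod>i\<in>S. face_var (g i)) = (\<Prod>F\<in>J. face_var F)"
    by (rule prod.reindex_bij_betw[OF g])
  finally have eq: "minor S (\<lambda>i j. weighted_incidence i (g j)) = (\<Prod>F\<in>J. face_var F) * of_int ?m" .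
  have "(of_int ?m :: 'v weight_field)\<^sup>2 = of_int (\<bar>?m\<bar>\<^sup>2)" by simp
  also have "\<bar>?m\<bar>\<^sup>2 = int ((nat \<bar>?m\<bar>)\<^sup>2)" by simp
  finally have "(of_int ?m :: 'v weight_field)\<^sup>2 = of_nat ((nat \<bar>?m\<bar>)\<^sup>2)" by (simp only: of_int_of_nat_eq)
  moreover have "minor S (\<lambda>i j. weighted_incidence i (g j)) * minor S (\<lambda>i j. weighted_incidence i (g j))
      = (of_int ?m)\<^sup>2 * (\<Prod>F\<in>J. face_var F)\<^sup>2"
    unfolding eq by (simp only: power2_eq_square mult_ac)
  ultimately show ?thesis by (simp only:)
qed

text \<open>All coefficients are nonnegative rationals, so the coefficient of the monomial of
  \<open>J0\<close> is positive whichever other terms share that monomial.\<close>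

lemma weighted_sum_nonzero:
  fixes c :: "'v::linorder set set \<Rightarrow> nat"
  assumes fin: "finite \<J>" and J0: "J0 \<in> \<J>" "c J0 \<noteq> 0"
  shows "(\<Sum>J\<in>\<J>. of_nat (c J) * (\<Prod>F\<in>J. face_var F)\<^sup>2 :: 'v weight_field) \<noteq> 0"
proof -
  define e :: "'v set set \<Rightarrow> 'v list \<Rightarrow>\<^sub>0 nat"
    where "e J = (\<Sum>F\<in>J. Poly_Mapping.single (sorted_list_of_set F) 1)" for J
  have prod: "(\<Prod>F\<in>J. face_var F) = to_fract (Poly_Mapping.single (e J) 1)" for J :: "'v set set"
    by (induction J rule: infinite_finite_induct)
      (simp_all add: e_def face_var_def to_fract_def[symmetric] mult_single flip: to_fract_mult)
  have nat: "of_nat n = (to_fract (Poly_Mapping.single 0 (of_nat n)) :: 'v weight_field)" for n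
    by (induction n) (simp_all add: single_add)
  let ?P = "\<Sum>J\<in>\<J>. Poly_Mapping.single (e J + e J) (of_nat (c J) :: rat)"
  have "(\<Sum>J\<in>\<J>. of_nat (c J) * (\<Prod>F\<in>J. face_var F)\<^sup>2 :: 'v weight_field) = to_fract ?P"
    unfolding to_fract_sum
  proof (rule sum.cong[OF refl])
    fix J
    show "of_nat (c J) * (\<Prod>F\<in>J. face_var F)\<^sup>2 = to_fract (Poly_Mapping.single (e J + e J) (of_nat (c J)))"
      unfolding prod nat power2_eq_square by (simp only: to_fract_mult[symmetric] mult_single) simp
  qed
  moreover have "?P \<noteq> 0"
  proof
    assume P: "?P = 0"
    have "0 < (\<Sum>J\<in>\<J>. Poly_Mapping.lookup (Poly_Mapping.single (e J + e J) (of_nat (c J) :: rat)) (e J0 + e J0))"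
      by (rule sum_pos2[OF fin J0(1)]) (use J0(2) in \<open>auto simp: lookup_single when_def\<close>)
    also have "\<dots> = Poly_Mapping.lookup ?P (e J0 + e J0)" by (rule lookup_sum[symmetric])
    finally show False unfolding P by simp
  qed
  ultimately show ?thesis by (simp only: to_fract_eq_0_iff not_False_eq_True)
qed

section \<open>Principal minors of the Laplacian and weighted tree counts\<close>

context
  fixes \<Delta> :: "'v::linorder set set"
  assumes \<Delta>: "simplicial_complex \<Delta>"
begin

lemma minor_face_laplacian:
  assumes S: "S \<subseteq> faces (k - 1) \<Delta>" and g: "\<And>J. J \<subseteq> faces k \<Delta> \<Longrightarrow> card J = card S \<Longrightarrow> bij_betw (g J) S J"
  shows "minor S (face_laplacian k \<Delta>) = (\<Sum>J | J \<subseteq> faces k \<Delta> \<and> card J = card S.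
    of_nat ((nat \<bar>minor S (\<lambda>i j. Poly_Mapping.lookup (face_boundary (g J i)) j)\<bar>)\<^sup>2) * (\<Prod>F\<in>J. face_var F)\<^sup>2)"
proof -
  have fin: "finite S" using S simplicial_complexD(4)[OF \<Delta>] finite_subset by blast
  have "minor S (face_laplacian k \<Delta>) = (\<Sum>J | J \<subseteq> faces k \<Delta> \<and> card J = card S.
    minor S (\<lambda>i j. weighted_incidence i (g J j)) * minor S (\<lambda>i j. weighted_incidence i (g J j)))"
    unfolding face_laplacian_def by (rule Cauchy_Binet[OF fin simplicial_complexD(4)[OF \<Delta>] g])
  also have "\<dots> = (\<Sum>J | J \<subseteq> faces k \<Delta> \<and> card J = card S.
    of_nat ((nat \<bar>minor S (\<lambda>i j. Poly_Mapping.lookup (face_boundary (g J i)) j)\<bar>)\<^sup>2) * (\<Prod>F\<in>J. face_var F)\<^sup>2)"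
    using g by (intro sum.cong refl minor_weighted_incidence_sq[OF fin]) auto
  finally show ?thesis .
qed

lemma choose_bijections:
  assumes "finite S"
  obtains g where "\<And>J. J \<subseteq> faces k \<Delta> \<Longrightarrow> card J = card S \<Longrightarrow> bij_betw (g J) S J"
proof -
  have "\<exists>h. bij_betw h S J" if "J \<subseteq> faces k \<Delta>" "card J = card S" for J
    using that assms finite_subset[OF that(1) simplicial_complexD(4)[OF \<Delta>]] by (intro finite_same_card_bij) auto
  then show thesis using that by metis
qed

text \<open>A nonzero term of the Cauchy--Binet sum would have independent rows, making its set
  \<open>J\<close> an independent set of faces larger than the rank.\<close>

lemma minor_face_laplacian_vanishes:
  assumes S: "S \<subseteq> faces (k - 1) \<Delta>" and card: "card S > face_rank k \<Delta>"
  shows "minor S (face_laplacian k \<Delta>) = 0"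
proof -
  have fin: "finite S" using S simplicial_complexD(4)[OF \<Delta>] finite_subset by blast
  obtain g where g: "\<And>J. J \<subseteq> faces k \<Delta> \<Longrightarrow> card J = card S \<Longrightarrow> bij_betw (g J) S J"
    using choose_bijections[OF fin] by metis
  have zero: "minor S (\<lambda>i j. Poly_Mapping.lookup (face_boundary (g J i)) j) = 0"
    if J: "J \<subseteq> faces k \<Delta>" "card J = card S" for J
  proof (rule ccontr)
    assume "minor S (\<lambda>i j. Poly_Mapping.lookup (face_boundary (g J i)) j) \<noteq> 0"
    note ind = independent_rows[OF fin this]
    note b = g[OF J]
    have "independent_family J face_boundary"
      unfolding independent_family_def
    proof (intro allI impI ballI)
      fix c F assume c: "lincomb J c face_boundary = 0" and F: "F \<in> J"
      have "lincomb S (\<lambda>i. c (g J i)) (\<lambda>i. lincomb S (Poly_Mapping.lookup (face_boundary (g J i))) frag_of) = 0"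
      proof (rule poly_mapping_eqI)
        fix a
        have "(\<Sum>i\<in>S. c (g J i) * Poly_Mapping.lookup (face_boundary (g J i)) a)
            = (\<Sum>F\<in>J. c F * Poly_Mapping.lookup (face_boundary F) a)"
          by (rule sum.reindex_bij_betw[OF b])
        also have "\<dots> = 0"
          using arg_cong[OF c, of "\<lambda>x. Poly_Mapping.lookup x a"] by (simp add: lookup_lincomb)
        finally show "Poly_Mapping.lookup (lincomb S (\<lambda>i. c (g J i))
            (\<lambda>i. lincomb S (Poly_Mapping.lookup (face_boundary (g J i))) frag_of)) a = Poly_Mapping.lookup 0 a"
          by (cases "a \<in> S") (simp_all add: lookup_lincomb[of S "\<lambda>i. c (g J i)"] lookup_lincomb_frag_of[OF fin])
      qed
      then have zero: "\<forall>i\<in>S. c (g J i) = 0" using ind unfolding independent_family_def by (elim allE impE)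
      have "F \<in> g J ` S" using F b by (simp add: bij_betw_def)
      then show "c F = 0" using zero by (elim imageE) simp
    qed
    then show False using independent_card_le_face_rank[OF \<Delta> J(1)] J(2) card by simp
  qed
  show ?thesis
    by (subst minor_face_laplacian[OF S g]) (auto intro!: sum.neutral simp: zero)
qed

lemma weighted_tree_count_eq:
  assumes "betti (k - 1) \<Delta> = 0" "k \<ge> -1" "k \<ge> 0 \<longrightarrow> faces k \<Delta> \<noteq> {}"
  shows "weighted_tree_count k \<Delta> = (\<Sum>J | J \<subseteq> faces k \<Delta> \<and> card J = face_rank k \<Delta>.
        of_nat ((homology_order (k - 1) (J \<union> skeleton (k - 1) \<Delta>))\<^sup>2) * (\<Prod>F\<in>J. face_var F)\<^sup>2)"
  unfolding weighted_tree_count_def complex_weight_def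
  by (rule sum_spanning_trees[OF \<Delta> assms, of "\<lambda>J. (\<Prod>F\<in>J. face_var F)\<^sup>2"])

lemma tree_count_eq:
  assumes "betti (k - 1) \<Delta> = 0" "k \<ge> -1" "k \<ge> 0 \<longrightarrow> faces k \<Delta> \<noteq> {}"
  shows "tree_count k \<Delta> = (\<Sum>J | J \<subseteq> faces k \<Delta> \<and> card J = face_rank k \<Delta>.
        (homology_order (k - 1) (J \<union> skeleton (k - 1) \<Delta>))\<^sup>2)"
  unfolding tree_count_def
  using sum_spanning_trees[OF \<Delta> assms, of "\<lambda>J. 1 :: nat"] by simp

lemma homology_order_nonzero:
  assumes "betti i \<Delta> = 0"
  shows "homology_order i \<Delta> \<noteq> 0"
  unfolding homology_order_eq_index[OF \<Delta>]
  using subgroup_index_nonzero_iff[OF simplicial_complexD(4)[OF \<Delta>] cycles_subgroup cycles_subset boundaries_subgroup]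
    betti_zero_imp_torsion[OF \<Delta> assms] by simp

text \<open>A maximal independent set of faces spans the boundaries rationally, and with vanishing
  Betti number also the cycles. Existence is needed for the nonvanishing of both tree
  counts.\<close>

lemma exists_spanning_faces:
  assumes "betti (k - 1) \<Delta> = 0"
  obtains J where "J \<subseteq> faces k \<Delta>" "card J = face_rank k \<Delta>"
    "homology_order (k - 1) (J \<union> skeleton (k - 1) \<Delta>) \<noteq> 0"
proof -
  obtain J where J: "J \<subseteq> faces k \<Delta>" "torsion_over (boundaries (k - 1) \<Delta>) (lattice_span J face_boundary)"
      "card J = face_rank k \<Delta>"
    using maximal_independent_faces[OF \<Delta> empty_subsetI independent_family_empty] by metis
  have "torsion_over (cycles (k - 1) \<Delta>) (lattice_span J face_boundary)"
    by (rule torsion_over_trans[OF betti_zero_imp_torsion[OF \<Delta> assms] J(2)])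
  then have "homology_order (k - 1) (J \<union> skeleton (k - 1) \<Delta>) \<noteq> 0"
    unfolding homology_order_union_skeleton[OF \<Delta> J(1)]
    using subgroup_index_nonzero_iff[OF simplicial_complexD(4)[OF \<Delta>] cycles_subgroup cycles_subset lattice_span_subgroup[of J face_boundary]]
    by simp
  then show thesis using that J by blast
qed

text \<open>The common source of both claims, with denominators cleared. It covers all
  \<open>U\<close> of the right size, trees or not, and can therefore be summed over
  \<open>U\<close>.\<close>

lemma minor_face_laplacian_complement:
  assumes betti: "betti (k - 1) \<Delta> = 0" and k: "k \<ge> 0" "faces k \<Delta> \<noteq> {}"
    and U: "U \<subseteq> faces (k - 1) \<Delta>" "card U = face_rank (k - 1) \<Delta>"
  shows "of_nat ((homology_order (k - 2) \<Delta>)\<^sup>2) * minor (faces (k - 1) \<Delta> - U) (face_laplacian k \<Delta>)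
    = of_nat ((homology_order (k - 2) (U \<union> skeleton (k - 2) \<Delta>))\<^sup>2) * weighted_tree_count k \<Delta>"
proof -
  let ?I = "faces (k - 1) \<Delta> - U"
  have fin: "finite (faces (k - 1) \<Delta>)" "finite U"
    using simplicial_complexD(4)[OF \<Delta>] finite_subset[OF U(1)] by auto
  have card: "card ?I = face_rank k \<Delta>"
    using face_rank_sum[OF \<Delta> betti_zero_imp_torsion[OF \<Delta> betti]] U fin by (simp add: card_Diff_subset)
  have finI: "finite ?I" using fin by simp
  obtain g where g: "\<And>J. J \<subseteq> faces k \<Delta> \<Longrightarrow> card J = card ?I \<Longrightarrow> bij_betw (g J) ?I J"
    using choose_bijections[OF finI] by metis
  let ?h = "homology_order (k - 2) \<Delta>" and ?hU = "homology_order (k - 2) (U \<union> skeleton (k - 2) \<Delta>)"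
  let ?m = "\<lambda>J. nat \<bar>minor ?I (\<lambda>i j. Poly_Mapping.lookup (face_boundary (g J i)) j)\<bar>"
  let ?hJ = "\<lambda>J. homology_order (k - 1) (J \<union> skeleton (k - 1) \<Delta>)"
  have key: "?h\<^sup>2 * (?m J)\<^sup>2 = ?hU\<^sup>2 * (?hJ J)\<^sup>2" if "J \<subseteq> faces k \<Delta>" "card J = card ?I" for J
    using minor_boundary_homology_orders[OF \<Delta> that(1) U g[OF that]]
    by (metis mult.commute power_mult_distrib)
  have "of_nat (?h\<^sup>2) * minor ?I (face_laplacian k \<Delta>)
     = (\<Sum>J | J \<subseteq> faces k \<Delta> \<and> card J = card ?I. of_nat (?h\<^sup>2 * (?m J)\<^sup>2) * (\<Prod>F\<in>J. face_var F)\<^sup>2)"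
    by (subst minor_face_laplacian[OF _ g]) (auto simp: sum_distrib_left mult.assoc simp del: of_nat_power)
  also have "\<dots> = (\<Sum>J | J \<subseteq> faces k \<Delta> \<and> card J = card ?I. of_nat (?hU\<^sup>2 * (?hJ J)\<^sup>2) * (\<Prod>F\<in>J. face_var F)\<^sup>2)"
    using key by (intro sum.cong refl) (simp only: mem_Collect_eq)
  also have "\<dots> = of_nat (?hU\<^sup>2) * weighted_tree_count k \<Delta>"
    using k by (subst weighted_tree_count_eq[OF betti]) (auto simp: card sum_distrib_left mult.assoc simp del: of_nat_power)
  finally show ?thesis .
qed

end

section \<open>Translation of the matrix quantities into face-indexed minors\<close>

lemma det_reduced_weighted_laplacian:
  assumes \<Delta>: "simplicial_complex \<Delta>"
  shows "det (reduced_weighted_laplacian k \<Delta> U) = minor (faces (k - 1) \<Delta> - U) (face_laplacian k \<Delta>)"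
proof -
  let ?xs = "face_list (k - 1) \<Delta>"
  let ?L = "weighted_laplacian k \<Delta>"
  define I where "I = {i. i < length ?xs \<and> ?xs ! i \<notin> U}"
  have "det (reduced_weighted_laplacian k \<Delta> U) = minor I (\<lambda>i j. ?L $$ (i, j))"
    unfolding reduced_weighted_laplacian_def Let_def I_def[symmetric]
    by (rule det_submatrix_eq_minor[OF weighted_laplacian_entries(1)[OF \<Delta>]]) (auto simp: I_def)
  also have "\<dots> = minor I (\<lambda>i j. face_laplacian k \<Delta> (?xs ! i) (?xs ! j))"
    by (rule minor_cong) (simp add: I_def weighted_laplacian_entries(2)[OF \<Delta>])
  also have "\<dots> = minor (faces (k - 1) \<Delta> - U) (face_laplacian k \<Delta>)"
  proof (rule minor_reindex)
    have "inj_on ((!) ?xs) I"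
      by (rule inj_on_nth[OF face_list(1)[OF \<Delta>]]) (simp add: I_def)
    moreover have "(!) ?xs ` I = faces (k - 1) \<Delta> - U"
      unfolding face_list(2)[OF \<Delta>, symmetric] by (auto simp: I_def in_set_conv_nth)
    ultimately show "bij_betw ((!) ?xs) I (faces (k - 1) \<Delta> - U)" by (simp add: bij_betw_def)
  qed (simp add: I_def)
  finally show ?thesis .
qed

lemma minor_weighted_laplacian:
  assumes \<Delta>: "simplicial_complex \<Delta>" and T: "T \<subseteq> {0..<length (face_list (k - 1) \<Delta>)}"
  shows "minor T (\<lambda>i j. weighted_laplacian k \<Delta> $$ (i, j))
    = minor ((!) (face_list (k - 1) \<Delta>) ` T) (face_laplacian k \<Delta>)"
proof -
  let ?xs = "face_list (k - 1) \<Delta>"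
  have "minor T (\<lambda>i j. weighted_laplacian k \<Delta> $$ (i, j)) = minor T (\<lambda>i j. face_laplacian k \<Delta> (?xs ! i) (?xs ! j))"
    using T by (intro minor_cong weighted_laplacian_entries(2)[OF \<Delta>]) auto
  also have "\<dots> = minor ((!) ?xs ` T) (face_laplacian k \<Delta>)"
    using T finite_subset[OF T]
    by (intro minor_reindex inj_on_imp_bij_betw inj_on_nth[OF face_list(1)[OF \<Delta>]]) auto
  finally show ?thesis .
qed

lemma weighted_pi_eq:
  assumes \<Delta>: "simplicial_complex \<Delta>" and r: "face_rank k \<Delta> \<le> card (faces (k - 1) \<Delta>)"
    and nz: "(\<Sum>S | S \<subseteq> faces (k - 1) \<Delta> \<and> card S = face_rank k \<Delta>. minor S (face_laplacian k \<Delta>)) \<noteq> 0"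
  shows "weighted_pi k \<Delta>
    = to_ac (\<Sum>S | S \<subseteq> faces (k - 1) \<Delta> \<and> card S = face_rank k \<Delta>. minor S (face_laplacian k \<Delta>))"
proof -
  let ?xs = "face_list (k - 1) \<Delta>"
  let ?n = "length ?xs" and ?r = "face_rank k \<Delta>"
  note fl = face_list[OF \<Delta>, of "k - 1"]
  have n: "?n = card (faces (k - 1) \<Delta>)" using distinct_card[OF fl(1)] fl(2) by simp
  have inj: "inj_on ((!) ?xs) {0..<?n}" by (rule inj_on_nth[OF fl(1)]) simp
  have img: "(!) ?xs ` {0..<?n} = faces (k - 1) \<Delta>" unfolding fl(2)[symmetric] by (auto simp: in_set_conv_nth)
  have card: "card ((!) ?xs ` T) = card T" if "T \<subseteq> {0..<?n}" for T
    by (rule card_image[OF inj_on_subset[OF inj that]])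
  have sum: "(\<Sum>T | T \<subseteq> {0..<?n} \<and> card T = ?r. minor T (\<lambda>i j. weighted_laplacian k \<Delta> $$ (i, j)))
      = (\<Sum>S | S \<subseteq> faces (k - 1) \<Delta> \<and> card S = ?r. minor S (face_laplacian k \<Delta>))"
  proof -
    have "inj_on ((`) ((!) ?xs)) {T. T \<subseteq> {0..<?n} \<and> card T = ?r}"
      by (rule inj_on_subset[OF inj_on_image_Pow[OF inj]]) auto
    moreover have "(`) ((!) ?xs) ` {T. T \<subseteq> {0..<?n} \<and> card T = ?r} = {S. S \<subseteq> faces (k - 1) \<Delta> \<and> card S = ?r}"
    proof (intro equalityI subsetI)
      fix S assume "S \<in> (`) ((!) ?xs) ` {T. T \<subseteq> {0..<?n} \<and> card T = ?r}"
      then show "S \<in> {S. S \<subseteq> faces (k - 1) \<Delta> \<and> card S = ?r}" using card img by auto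
    next
      fix S assume S: "S \<in> {S. S \<subseteq> faces (k - 1) \<Delta> \<and> card S = ?r}"
      then obtain T where T: "T \<subseteq> {0..<?n}" "S = (!) ?xs ` T" unfolding img[symmetric] by (auto simp: subset_image_iff)
      then show "S \<in> (`) ((!) ?xs) ` {T. T \<subseteq> {0..<?n} \<and> card T = ?r}" using S card[OF T(1)] by auto
    qed
    ultimately have "bij_betw ((`) ((!) ?xs)) {T. T \<subseteq> {0..<?n} \<and> card T = ?r} {S. S \<subseteq> faces (k - 1) \<Delta> \<and> card S = ?r}"
      by (simp add: bij_betw_def)
    from sum.reindex_bij_betw[OF this, of "\<lambda>S. minor S (face_laplacian k \<Delta>)"] show ?thesis
      by (simp add: minor_weighted_laplacian[OF \<Delta>] cong: sum.cong_simp conj_cong)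
  qed
  show ?thesis
    unfolding weighted_pi_def
  proof (subst nonzero_eigenvalue_product_eq[OF weighted_laplacian_entries(1)[OF \<Delta>]])
    show "?r \<le> ?n" using r n by simp
    show "minor T (\<lambda>i j. weighted_laplacian k \<Delta> $$ (i, j)) = 0" if T: "T \<subseteq> {0..<?n}" "card T > ?r" for T
      unfolding minor_weighted_laplacian[OF \<Delta> T(1)]
      using T card[OF T(1)] img by (intro minor_face_laplacian_vanishes[OF \<Delta>]) auto
  qed (use nz sum in simp_all)
qed

theorem theorem1p4:
  fixes \<Delta> :: "'v::linorder set set" and d :: nat
  assumes "simplicial_complex \<Delta>"
    and "complex_dim \<Delta> = int d"
    and "APC \<Delta>"
  shows "weighted_pi (int d) \<Delta> =
           to_ac (weighted_tree_count (int d) \<Delta> * of_nat (tree_count (int d - 1) \<Delta>)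
                    / of_nat ((homology_order (int d - 2) \<Delta>)\<^sup>2)) \<and>
         (\<forall>T U \<Delta>U.
            T \<in> spanning_trees (int d - 1) \<Delta> \<longrightarrow>
            U = faces (int d - 1) T \<longrightarrow>
            \<Delta>U = U \<union> skeleton (int d - 2) \<Delta> \<longrightarrow>
            weighted_tree_count (int d) \<Delta> =
              of_nat ((homology_order (int d - 2) \<Delta>)\<^sup>2) / of_nat ((homology_order (int d - 2) \<Delta>U)\<^sup>2)
                * det (reduced_weighted_laplacian (int d) \<Delta> U))"
proof -
  note \<Delta> = assms(1)
  let ?k = "int d"
  let ?N = "faces (?k - 1) \<Delta>" and ?r = "face_rank ?k \<Delta>" and ?r' = "face_rank (?k - 1) \<Delta>"
  let ?h = "homology_order (?k - 2) \<Delta>" and ?hU = "\<lambda>U. homology_order (?k - 2) (U \<union> skeleton (?k - 2) \<Delta>)"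
  let ?w = "weighted_tree_count ?k \<Delta>"
  \<comment> \<open>\<open>APC\<close> speaks of all integers below the dimension, so degree -2,
    which occurs for \<open>d = 0\<close>, is included.\<close>
  have betti: "betti (?k - 1) \<Delta> = 0" and betti2: "betti (?k - 1 - 1) \<Delta> = 0"
    using assms(2,3) by (simp_all add: APC_def)
  have ne: "faces ?k \<Delta> \<noteq> {}"
  proof -
    have "complex_dim \<Delta> \<in> insert (- 1) (face_dim ` \<Delta>)"
      unfolding complex_dim_def using simplicial_complexD(1)[OF \<Delta>] by (intro Max_in) auto
    then show ?thesis using assms(2) by (auto simp: faces_def)
  qed
  have ne': "?k - 1 \<ge> 0 \<longrightarrow> ?N \<noteq> {}"
  proof
    assume "?k - 1 \<ge> 0"
    obtain F where F: "F \<in> faces ?k \<Delta>" using ne by auto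
    have "face_boundary F \<noteq> 0" using face_boundary_nonzero[OF \<Delta> F] by simp
    moreover have "face_boundary F \<in> free_part ?N" by (rule face_boundary_in_free_part[OF \<Delta> F])
    ultimately show "?N \<noteq> {}" by (auto simp: free_part_def)
  qed
  have rank: "?r + ?r' = card ?N"
    by (rule face_rank_sum[OF \<Delta> betti_zero_imp_torsion[OF \<Delta> betti]])
  have finN: "finite ?N" by (rule simplicial_complexD(4)[OF \<Delta>])
  have h: "?h \<noteq> 0" using homology_order_nonzero[OF \<Delta> betti2] by (simp add: algebra_simps)
  have key: "of_nat (?h\<^sup>2) * minor (?N - U) (face_laplacian ?k \<Delta>) = of_nat ((?hU U)\<^sup>2) * ?w"
    if "U \<subseteq> ?N" "card U = ?r'" for U
    by (rule minor_face_laplacian_complement[OF \<Delta> betti _ ne that]) simp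
  have part2: "?w = of_nat (?h\<^sup>2) / of_nat ((?hU U)\<^sup>2) * det (reduced_weighted_laplacian ?k \<Delta> U)"
    if T: "T \<in> spanning_trees (?k - 1) \<Delta>" and U: "U = faces (?k - 1) T" for T U
  proof -
    obtain J where J: "T = J \<union> skeleton (?k - 1 - 1) \<Delta>" "J \<subseteq> ?N" "card J = ?r'"
      "homology_order (?k - 1 - 1) (J \<union> skeleton (?k - 1 - 1) \<Delta>) \<noteq> 0"
      using T unfolding spanning_trees_eq[OF \<Delta> betti2 _ ne', simplified] by auto
    have "U = J" unfolding U J(1) faces_union_skeleton[OF J(2)] by simp
    then have hU: "?hU U \<noteq> 0" and U': "U \<subseteq> ?N" "card U = ?r'" using J by (simp_all add: algebra_simps)
    have "(of_nat ((?hU U)\<^sup>2) :: 'v weight_field) \<noteq> 0"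
      unfolding weight_field_of_nat_eq_0_iff using hU by simp
    then show ?thesis
      using key[OF U'] unfolding det_reduced_weighted_laplacian[OF \<Delta>] by (simp add: field_simps)
  qed
  have part1: "weighted_pi ?k \<Delta> = to_ac (?w * of_nat (tree_count (?k - 1) \<Delta>) / of_nat (?h\<^sup>2))"
  proof -
    let ?S = "\<Sum>S | S \<subseteq> ?N \<and> card S = ?r. minor S (face_laplacian ?k \<Delta>)"
    \<comment> \<open>By \<open>rank\<close>, taking complements exchanges the row sets of maximal
      minors with the candidates for trees of dimension d-1.\<close>
    have "?S = (\<Sum>U | U \<subseteq> ?N \<and> card U = ?r'. minor (?N - U) (face_laplacian ?k \<Delta>))"
      by (rule sum.reindex_bij_witness[of _ "\<lambda>U. ?N - U" "\<lambda>S. ?N - S"])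
        (use rank finN in \<open>auto simp: card_Diff_subset finite_subset double_diff\<close>)
    then have "of_nat (?h\<^sup>2) * ?S = (\<Sum>U | U \<subseteq> ?N \<and> card U = ?r'. of_nat ((?hU U)\<^sup>2) * ?w)"
      using key by (simp add: sum_distrib_left del: of_nat_power)
    also have "\<dots> = ?w * of_nat (\<Sum>U | U \<subseteq> ?N \<and> card U = ?r'. (?hU U)\<^sup>2)"
      by (simp add: sum_distrib_left mult.commute)
    also have "(\<Sum>U | U \<subseteq> ?N \<and> card U = ?r'. (?hU U)\<^sup>2) = tree_count (?k - 1) \<Delta>"
      using tree_count_eq[OF \<Delta> betti2 _ ne'] by simp
    finally have hS: "of_nat (?h\<^sup>2) * ?S = ?w * of_nat (tree_count (?k - 1) \<Delta>)" .
    have h': "(of_nat (?h\<^sup>2) :: 'v weight_field) \<noteq> 0"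
      unfolding weight_field_of_nat_eq_0_iff using h by simp
    \<comment> \<open>By \<open>hS\<close>, nonvanishing of both tree counts gives
      \<open>?S \<noteq> 0\<close>; only then is \<open>?S\<close> known to be, up to sign, the
      lowest nonzero coefficient of the characteristic polynomial.\<close>
    have w: "?w \<noteq> 0"
    proof -
      obtain J where "J \<subseteq> faces ?k \<Delta>" "card J = ?r" "homology_order (?k - 1) (J \<union> skeleton (?k - 1) \<Delta>) \<noteq> 0"
        using exists_spanning_faces[OF \<Delta> betti] .
      moreover have "?k \<ge> - 1" by simp
      ultimately show ?thesis
        unfolding weighted_tree_count_eq[OF \<Delta> betti \<open>?k \<ge> - 1\<close> impI[OF ne]]
        using simplicial_complexD(4)[OF \<Delta>, of ?k] by (intro weighted_sum_nonzero[of _ J]) auto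
    qed
    have "tree_count (?k - 1) \<Delta> \<noteq> 0"
    proof -
      obtain J where "J \<subseteq> ?N" "card J = ?r'" "homology_order (?k - 1 - 1) (J \<union> skeleton (?k - 1 - 1) \<Delta>) \<noteq> 0"
        using exists_spanning_faces[OF \<Delta> betti2] .
      then show ?thesis
        using tree_count_eq[OF \<Delta> betti2 _ ne'] finN by auto
    qed
    then have "(of_nat (tree_count (?k - 1) \<Delta>) :: 'v weight_field) \<noteq> 0"
      by (simp add: weight_field_of_nat_eq_0_iff)
    then have "?S \<noteq> 0" using hS w by auto
    then have "weighted_pi ?k \<Delta> = to_ac ?S"
      using rank by (intro weighted_pi_eq[OF \<Delta>]) auto
    also have "?S = ?w * of_nat (tree_count (?k - 1) \<Delta>) / of_nat (?h\<^sup>2)"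
      using hS h' by (simp add: field_simps)
    finally show ?thesis .
  qed
  show ?thesis using part1 part2 by blast
qed

end
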